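(* The canonical images in $Y_{r,n}^{d}$ of the elements $$\{X^{\alpha}t^{\beta}g_{w}\;:\;\alpha\in \mathbb{Z}_{\ge 0}^{n}\text{ with }\alpha_{1},\ldots,\alpha_{n}< d,\ \beta\in \mathbb{Z}_{\ge 0}^{n}\text{ with }\beta_{1},\ldots,\beta_{n}< r,\ w\in \mathfrak{S}_{n}\}$$ form an $\mathcal{R}$-basis of $Y_{r,n}^{d}$.
   Context: Let $r,n,d\geq 1$ be integers, $\zeta=e^{2\pi i/r}$, let $q,v_1,\ldots,v_d$ be indeterminates and $\mathcal{R}=\mathbb{Z}[\tfrac1r,\zeta][q^{\pm1},v_1^{\pm1},\ldots,v_d^{\pm1}]$. The symmetric group $\mathfrak{S}_n$ acts on $\{1,\ldots,n\}$ on the right and $s_i=(i,i+1)$. The affine Yokonuma-Hecke algebra $\widehat{Y}_{r,n}$ is the associative $\mathcal{R}$-algebra generated by $t_1,\ldots,t_n,g_1,\ldots,g_{n-1},X_1^{\pm1}$ with relations: $g_ig_j=g_jg_i$ if $|i-j|\ge2$; $g_ig_{i+1}g_i=g_{i+1}g_ig_{i+1}$; $t_it_j=t_jt_i$; $g_it_j=t_{js_i}g_i$; $t_i^r=1$; $g_i^2=1+(q-q^{-1})e_ig_i$, where $e_i=\frac1r\sum_{s=0}^{r-1}t_i^st_{i+1}^{-s}$; $X_1X_1^{-1}=X_1^{-1}X_1=1$; $g_1X_1g_1X_1=X_1g_1X_1g_1$; $g_iX_1=X_1g_i$ for $i\ge2$; $t_jX_1=X_1t_j$ for all $j$. Put $X_{i+1}=g_iX_ig_i$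 for $1\le i\le n-1$; the elements $t_1,\ldots,t_n,X_1,\ldots,X_n$ commute pairwise. For $w\in\mathfrak{S}_n$ with reduced expression $w=s_{i_1}\cdots s_{i_k}$, $g_w=g_{i_1}\cdots g_{i_k}$ (well defined). Write $X^\alpha=X_1^{\alpha_1}\cdots X_n^{\alpha_n}$, $t^\beta=t_1^{\beta_1}\cdots t_n^{\beta_n}$. The cyclotomic Yokonuma-Hecke algebra is $Y_{r,n}^d=\widehat{Y}_{r,n}/\mathcal{J}_d$, where $\mathcal{J}_d$ is the two-sided ideal generated by $f_1=(X_1-v_1)\cdots(X_1-v_d)$. *)

theory Defs
  imports
    Complex_Main
    "HOL-Library.Poly_Mapping"
    "HOL-Library.FuncSet"
    "HOL-Combinatorics.Permutations"
    "HOL-Algebra.QuotRing"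
    "HOL-Algebra.Module"
    "HOL-Algebra.Generated_Rings"
begin

section \<open>The ground ring\<close>

definition ring_on :: "'a::ring_1 set \<Rightarrow> 'a ring" where
  "ring_on S = \<lparr>carrier = S, mult = (*), one = 1, zero = 0, add = (+)\<rparr>"

definition coeff_ring :: "nat \<Rightarrow> complex set" where
  "coeff_ring r = generate_ring (ring_on UNIV) {1 / of_nat r, exp (2 * of_real pi * \<i> / of_nat r)}"

text \<open>Laurent polynomials are finitely supported functions on Laurent monomials, with the
  convolution product; a Laurent monomial is a finitely supported exponent function with integer
  values.  The type allows complex coefficients and infinitely many indeterminates; the ground
  ring for \<open>r\<close> and \<open>d\<close> is cut out as a carrier set.\<close>

datatype indet = Q | V nat

type_synonym laurent = "(indet \<Rightarrow>\<^sub>0 int) \<Rightarrow>\<^sub>0 complex"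

definition ground_ring :: "nat \<Rightarrow> nat \<Rightarrow> laurent ring" where
  "ground_ring r d = ring_on
     {p. (\<forall>m. Poly_Mapping.lookup p m \<in> coeff_ring r) \<and>
         (\<forall>m \<in> Poly_Mapping.keys p. Poly_Mapping.keys m \<subseteq> insert Q (V ` {1..d}))}"

definition lconst :: "complex \<Rightarrow> laurent" where
  "lconst c = Poly_Mapping.single 0 c"

definition lvar :: "indet \<Rightarrow> int \<Rightarrow> laurent" where
  "lvar x k = Poly_Mapping.single (Poly_Mapping.single x k) 1"


section \<open>Free associative algebras, quotients and bases\<close>

datatype 'a fmonoid = Word (letters: "'a list")

instantiation fmonoid :: (type) monoid_add
begin

definition zero_fmonoid :: "'a fmonoid" where
  "0 = Word []"

definition plus_fmonoid :: "'a fmonoid \<Rightarrow> 'a fmonoid \<Rightarrow> 'a fmonoid" where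
  "u + w = Word (letters u @ letters w)"

instance
  by standard (simp_all add: zero_fmonoid_def plus_fmonoid_def)

end

text \<open>Noncommutative polynomials.  The monoid of words is written additively because
  \<^typ>\<open>'a \<Rightarrow>\<^sub>0 'b\<close> takes its convolution product from an additive monoid.\<close>

type_synonym ('g, 'c) ncpoly = "'g fmonoid \<Rightarrow>\<^sub>0 'c"

definition scalar :: "'c \<Rightarrow> ('g, 'c::ring_1) ncpoly" where
  "scalar c = Poly_Mapping.single 0 c"

definition gen :: "'g \<Rightarrow> ('g, 'c::ring_1) ncpoly" where
  "gen x = Poly_Mapping.single (Word [x]) 1"

definition free_algebra :: "('c::ring_1) ring \<Rightarrow> 'g set \<Rightarrow> ('c, ('g, 'c) ncpoly) module" where
  "free_algebra R G =
     \<lparr>carrier = {p. (\<forall>u. Poly_Mapping.lookup p u \<in> carrier R) \<and>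
                     (\<forall>u \<in> Poly_Mapping.keys p. set (letters u) \<subseteq> G)},
      mult = (*), one = 1, zero = 0, add = (+), smult = (\<lambda>c p. scalar c * p)\<rparr>"

text \<open>The factor ring together with the induced scalar multiplication, which is
  defined by means of representatives in the same way as \<^const>\<open>rcoset_mult\<close>.\<close>

definition quotient_algebra :: "('c, 'a) module \<Rightarrow> 'a set \<Rightarrow> ('c, 'a set) module" where
  "quotient_algebra A J =
     ring.extend (A Quot J) (module.fields (\<lambda>c C. \<Union>x\<in>C. J +>\<^bsub>A\<^esub> (c \<odot>\<^bsub>A\<^esub> x)))"

definition module_basis ::
    "('c, 'k) ring_scheme \<Rightarrow> ('c, 'm, 'l) module_scheme \<Rightarrow> 'i set \<Rightarrow> ('i \<Rightarrow> 'm) \<Rightarrow> bool" where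
  "module_basis R M I b \<longleftrightarrow>
     b \<in> I \<rightarrow> carrier M \<and>
     (\<forall>y \<in> carrier M. \<exists>S c. finite S \<and> S \<subseteq> I \<and> c \<in> S \<rightarrow> carrier R \<and>
        y = (\<Oplus>\<^bsub>M\<^esub>i\<in>S. c i \<odot>\<^bsub>M\<^esub> b i)) \<and>
     (\<forall>S c. finite S \<and> S \<subseteq> I \<and> c \<in> S \<rightarrow> carrier R \<and>
        (\<Oplus>\<^bsub>M\<^esub>i\<in>S. c i \<odot>\<^bsub>M\<^esub> b i) = \<zero>\<^bsub>M\<^esub> \<longrightarrow> (\<forall>i\<in>S. c i = \<zero>\<^bsub>R\<^esub>))"


section \<open>The affine Yokonuma-Hecke algebra\<close>

datatype yh_gen = T nat | G nat | X1 | X1_inv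

definition yh_gens :: "nat \<Rightarrow> yh_gen set" where
  "yh_gens n = T ` {1..n} \<union> G ` {1..<n} \<union> {X1, X1_inv}"

type_synonym yh_free = "(yh_gen, laurent) ncpoly"

abbreviation tt :: "nat \<Rightarrow> yh_free" where "tt j \<equiv> gen (T j)"
abbreviation gg :: "nat \<Rightarrow> yh_free" where "gg i \<equiv> gen (G i)"

text \<open>Negative powers of \<open>t\<close> are not available in the free algebra:
  the relation \<open>t\<^sup>r = 1\<close> turns the exponent \<open>-s\<close> into \<open>r - s\<close>.\<close>

definition ee :: "nat \<Rightarrow> nat \<Rightarrow> yh_free" where
  "ee r i = scalar (lconst (1 / of_nat r)) * (\<Sum>s<r. tt i ^ s * tt (i + 1) ^ (r - s))"

text \<open>\<open>(a, b) \<in> yh_rel r n\<close> stands for the defining relation \<open>a = b\<close>.  Since \<open>s\<^sub>i\<close> is an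
  involution, \<open>j s\<^sub>i\<close> is the value of the transposition at \<open>j\<close>.\<close>

inductive_set yh_rel :: "nat \<Rightarrow> nat \<Rightarrow> (yh_free \<times> yh_free) set" for r n :: nat where
  g_comm: "\<lbrakk>i \<in> {1..<n}; j \<in> {1..<n}; i + 2 \<le> j \<or> j + 2 \<le> i\<rbrakk>
    \<Longrightarrow> (gg i * gg j, gg j * gg i) \<in> yh_rel r n"
| g_braid: "\<lbrakk>i \<in> {1..<n}; i + 1 \<in> {1..<n}\<rbrakk>
    \<Longrightarrow> (gg i * gg (i + 1) * gg i, gg (i + 1) * gg i * gg (i + 1)) \<in> yh_rel r n"
| t_comm: "\<lbrakk>i \<in> {1..n}; j \<in> {1..n}\<rbrakk> \<Longrightarrow> (tt i * tt j, tt j * tt i) \<in> yh_rel r n"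
| g_t: "\<lbrakk>i \<in> {1..<n}; j \<in> {1..n}\<rbrakk>
    \<Longrightarrow> (gg i * tt j, tt (transpose i (i + 1) j) * gg i) \<in> yh_rel r n"
| t_order: "j \<in> {1..n} \<Longrightarrow> (tt j ^ r, 1) \<in> yh_rel r n"
| g_quadratic: "i \<in> {1..<n}
    \<Longrightarrow> (gg i ^ 2, 1 + scalar (lvar Q 1 - lvar Q (- 1)) * ee r i * gg i) \<in> yh_rel r n"
| X_inv_right: "(gen X1 * gen X1_inv, 1) \<in> yh_rel r n"
| X_inv_left: "(gen X1_inv * gen X1, 1) \<in> yh_rel r n"
| g_X_braid: "1 \<in> {1..<n}
    \<Longrightarrow> (gg 1 * gen X1 * gg 1 * gen X1, gen X1 * gg 1 * gen X1 * gg 1) \<in> yh_rel r n"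
| g_X_comm: "\<lbrakk>i \<in> {1..<n}; 2 \<le> i\<rbrakk> \<Longrightarrow> (gg i * gen X1, gen X1 * gg i) \<in> yh_rel r n"
| t_X_comm: "j \<in> {1..n} \<Longrightarrow> (tt j * gen X1, gen X1 * tt j) \<in> yh_rel r n"

definition yh_free_alg :: "nat \<Rightarrow> nat \<Rightarrow> nat \<Rightarrow> (laurent, yh_free) module" where
  "yh_free_alg r n d = free_algebra (ground_ring r d) (yh_gens n)"

definition yh_ideal :: "nat \<Rightarrow> nat \<Rightarrow> nat \<Rightarrow> yh_free set" where
  "yh_ideal r n d = Idl\<^bsub>yh_free_alg r n d\<^esub> ((\<lambda>(a, b). a - b) ` yh_rel r n)"

definition affine_YH :: "nat \<Rightarrow> nat \<Rightarrow> nat \<Rightarrow> (laurent, yh_free set) module" where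
  "affine_YH r n d = quotient_algebra (yh_free_alg r n d) (yh_ideal r n d)"

definition to_affine :: "nat \<Rightarrow> nat \<Rightarrow> nat \<Rightarrow> yh_free \<Rightarrow> yh_free set" where
  "to_affine r n d p = yh_ideal r n d +>\<^bsub>yh_free_alg r n d\<^esub> p"


section \<open>The cyclotomic quotient\<close>

definition f1 :: "nat \<Rightarrow> yh_free" where
  "f1 d = prod_list (map (\<lambda>k. gen X1 - scalar (lvar (V k) 1)) [1..<d + 1])"

definition cyclotomic_ideal :: "nat \<Rightarrow> nat \<Rightarrow> nat \<Rightarrow> yh_free set set" where
  "cyclotomic_ideal r n d = Idl\<^bsub>affine_YH r n d\<^esub> {to_affine r n d (f1 d)}"

definition cyclotomic_YH :: "nat \<Rightarrow> nat \<Rightarrow> nat \<Rightarrow> (laurent, yh_free set set) module" where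
  "cyclotomic_YH r n d = quotient_algebra (affine_YH r n d) (cyclotomic_ideal r n d)"

definition to_cyclotomic :: "nat \<Rightarrow> nat \<Rightarrow> nat \<Rightarrow> yh_free set \<Rightarrow> yh_free set set" where
  "to_cyclotomic r n d y = cyclotomic_ideal r n d +>\<^bsub>affine_YH r n d\<^esub> y"


section \<open>The standard monomials\<close>

text \<open>Only the values at positive indices are meaningful.\<close>

fun XX :: "nat \<Rightarrow> yh_free" where
  "XX 0 = 1"
| "XX (Suc 0) = gen X1"
| "XX (Suc (Suc i)) = gg (Suc i) * XX (Suc i) * gg (Suc i)"

text \<open>A permutation \<open>w\<close> is represented by the map \<open>j \<mapsto> j w\<close>.  As the action is on the right,
  \<open>s\<^sub>i\<^sub>1 \<cdots> s\<^sub>i\<^sub>k\<close> applies \<open>s\<^sub>i\<^sub>1\<close> first.\<close>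

definition perm_of_word :: "nat list \<Rightarrow> nat \<Rightarrow> nat" where
  "perm_of_word is = fold (\<lambda>i. transpose i (i + 1)) is"

definition reduced_expression :: "nat \<Rightarrow> nat list \<Rightarrow> (nat \<Rightarrow> nat) \<Rightarrow> bool" where
  "reduced_expression n is w \<longleftrightarrow>
     set is \<subseteq> {1..<n} \<and> perm_of_word is = w \<and>
     (\<forall>js. set js \<subseteq> {1..<n} \<and> perm_of_word js = w \<longrightarrow> length is \<le> length js)"

text \<open>By the braid relations, the image in the affine algebra does not depend on the chosen
  reduced expression.\<close>

definition g_perm :: "nat \<Rightarrow> (nat \<Rightarrow> nat) \<Rightarrow> yh_free" where
  "g_perm n w = prod_list (map gg (SOME is. reduced_expression n is w))"

definition X_mon :: "nat \<Rightarrow> (nat \<Rightarrow> nat) \<Rightarrow> yh_free" where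
  "X_mon n \<alpha> = prod_list (map (\<lambda>i. XX i ^ \<alpha> i) [1..<n + 1])"

definition t_mon :: "nat \<Rightarrow> (nat \<Rightarrow> nat) \<Rightarrow> yh_free" where
  "t_mon n \<beta> = prod_list (map (\<lambda>j. tt j ^ \<beta> j) [1..<n + 1])"

end

theory Submission
  imports Defs "HOL-Combinatorics.Perm"
begin

text \<open>
  The proof has two halves, joined by one family of representations.

  Spanning.  From \<open>X\<^sub>i\<^sub>+\<^sub>1 = g\<^sub>i X\<^sub>i g\<^sub>i\<close> and the quadratic relation one gets the Bernstein relations
  \<open>g\<^sub>i X\<^sub>i = X\<^sub>i\<^sub>+\<^sub>1 (g\<^sub>i - h e\<^sub>i)\<close> and \<open>g\<^sub>i X\<^sub>i\<^sub>+\<^sub>1 = X\<^sub>i g\<^sub>i + h e\<^sub>i X\<^sub>i\<^sub>+\<^sub>1\<close> with \<open>h = q - q\<^sup>-\<^sup>1\<close>.  They move \<open>g\<^sub>i\<close> past a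
  monomial \<open>X\<^sup>\<alpha>\<close> without ever exceeding the larger of the exponents \<open>\<alpha>\<^sub>i\<close> and \<open>\<alpha>\<^sub>i\<^sub>+\<^sub>1\<close>
  (\<open>Bernstein_monomial\<close>).  So the bound \<open>\<alpha>\<^sub>j < d\<close> survives left multiplication by \<open>g\<^sub>i\<close>.  It also survives
  left multiplication by \<open>X\<^sub>1\<close>, since \<open>f\<^sub>1 = 0\<close> reduces \<open>X\<^sub>1\<^sup>d\<close>, and by \<open>X\<^sub>1\<^sup>-\<^sup>1\<close>, which is a polynomial in \<open>X\<^sub>1\<close> because
  the constant coefficient of \<open>f\<^sub>1\<close> is a unit.  If \<open>u\<close> runs through the normal words
  \<open>(s\<^sub>j \<cdots> s\<^sub>n\<^sub>-\<^sub>1) (s\<^sub>k \<cdots> s\<^sub>n\<^sub>-\<^sub>2) \<cdots>\<close>, the span of the \<open>X\<^sup>\<alpha> t\<^sup>\<beta> g\<^sub>u\<close> is therefore a left ideal containing \<open>1\<close>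
  (\<open>g_NB\<close>, \<open>x_NB\<close>, \<open>T_NB\<close>, \<open>one_NB\<close>).

  Independence.  The same formulas describe a module that the algebra must have.  For every colouring
  of the labels \<open>1, \<dots>, n\<close> by residues modulo \<open>r\<close>, take the free module with basis \<open>X\<^sup>a \<otimes> \<sigma>\<close>, where \<open>a\<close> has
  entries below \<open>d\<close> and \<open>\<sigma>\<close> is a word of distinct labels.  Let \<open>t\<^sub>j\<close> act by a root of unity according to
  the colour of the \<open>j\<close>-th label, \<open>g\<^sub>i\<close> by a Demazure-Lusztig operator, and \<open>X\<^sub>1\<close> by the companion matrix
  of \<open>f\<^sub>1\<close>.  The relations among the \<open>g\<^sub>i\<close> hold already for unbounded exponents; there they reduce to words
  without variables (\<open>kernel_induct\<close>).  The only relation on which truncation has an effect is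
  \<open>g\<^sub>1 X\<^sub>1 g\<^sub>1 X\<^sub>1 = X\<^sub>1 g\<^sub>1 X\<^sub>1 g\<^sub>1\<close>: here \<open>g\<^sub>1 X\<^sub>1 g\<^sub>1\<close> differs from the truncated \<open>X\<^sub>2\<close> by a Bezoutian of \<open>f\<^sub>1\<close>, which the
  two variables multiply in the same way (\<open>Xt_braid\<close>).  On the sorted word, \<open>X\<^sup>\<alpha> t\<^sup>\<beta> g\<^sub>w\<close> gives a root of
  unity times the basis vector \<open>X\<^sup>\<alpha> \<otimes> w\<close> (\<open>R_standard\<close>), so different \<open>\<alpha>\<close> and \<open>w\<close> are separated at once
  and different \<open>\<beta>\<close> by letting the colouring vary (\<open>monomials_independent\<close>).

  Reduced expressions.  A word acts on the sorted word by plain swaps exactly if each letter creates an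
  inversion, and reduced expressions have this property (\<open>reduced_expression_ascending\<close>).  Spanning by
  normal words and independence show that the representations are jointly faithful, and they take the
  same values on \<open>g\<^sub>u\<close> for all ascending words \<open>u\<close> of a permutation.  Thus normal words may be
  replaced by any reduced expressions (\<open>monomial_word_independent\<close>), which takes the place of
  Matsumoto's theorem.
\<close>


section \<open>Free modules and linear operators\<close>

definition vscale :: "'c::comm_ring_1 \<Rightarrow> ('k \<Rightarrow>\<^sub>0 'c) \<Rightarrow> ('k \<Rightarrow>\<^sub>0 'c)" (infixr "*\<^sub>v" 75) where
  "c *\<^sub>v v = Poly_Mapping.map ((*) c) v"

lemma lookup_vscale [simp]: "Poly_Mapping.lookup (c *\<^sub>v v) k = c * Poly_Mapping.lookup v k"
  by (simp add: vscale_def Poly_Mapping.map.rep_eq when_def)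

interpretation vec: Modules.module "vscale :: 'c::comm_ring_1 \<Rightarrow> ('k \<Rightarrow>\<^sub>0 'c) \<Rightarrow> _"
  by standard (auto intro!: poly_mapping_eqI simp: lookup_add algebra_simps)

lemma keys_vscale: "Poly_Mapping.keys (c *\<^sub>v v) \<subseteq> Poly_Mapping.keys v"
  by (auto simp: in_keys_iff)

abbreviation unit_vec :: "'k \<Rightarrow> ('k \<Rightarrow>\<^sub>0 'c::comm_ring_1)" where
  "unit_vec k \<equiv> Poly_Mapping.single k 1"

definition lin_ext :: "('k \<Rightarrow> ('l \<Rightarrow>\<^sub>0 'c::comm_ring_1)) \<Rightarrow> ('k \<Rightarrow>\<^sub>0 'c) \<Rightarrow> ('l \<Rightarrow>\<^sub>0 'c)" where
  "lin_ext F v = (\<Sum>k\<in>Poly_Mapping.keys v. Poly_Mapping.lookup v k *\<^sub>v F k)"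

definition vlin :: "(('k \<Rightarrow>\<^sub>0 'c::comm_ring_1) \<Rightarrow> ('l \<Rightarrow>\<^sub>0 'c)) \<Rightarrow> bool" where
  "vlin D \<longleftrightarrow> (\<forall>u v. D (u + v) = D u + D v) \<and> (\<forall>c v. D (c *\<^sub>v v) = c *\<^sub>v D v)"

lemma vlin_add: "vlin D \<Longrightarrow> D (u + v) = D u + D v"
  and vlin_scale: "vlin D \<Longrightarrow> D (c *\<^sub>v v) = c *\<^sub>v D v"
  by (simp_all add: vlin_def)

lemma vlin_zero: assumes "vlin D" shows "D 0 = 0"
  using vlin_scale[OF assms, of 0 0] by simp

lemma vlin_minus: assumes "vlin D" shows "D (- v) = - D v"
  using vlin_scale[OF assms, of "-1" v] by simp

lemma vlin_diff: assumes "vlin D" shows "D (u - v) = D u - D v"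
  using vlin_add[OF assms, of u "-v"] vlin_minus[OF assms] by simp

lemma vlin_sum: assumes "vlin D" shows "D (\<Sum>i\<in>I. f i) = (\<Sum>i\<in>I. D (f i))"
  by (induction I rule: infinite_finite_induct)
    (simp_all add: vlin_zero[OF assms] vlin_add[OF assms])

lemmas vlin_rules = vlin_add vlin_scale vlin_zero vlin_minus vlin_diff vlin_sum

lemma lin_ext_superset:
  assumes "finite S" "Poly_Mapping.keys v \<subseteq> S"
  shows "lin_ext F v = (\<Sum>k\<in>S. Poly_Mapping.lookup v k *\<^sub>v F k)"
  unfolding lin_ext_def using assms by (intro sum.mono_neutral_left) (auto simp: in_keys_iff)

lemma vlin_lin_ext: "vlin (lin_ext F)"
proof -
  have "lin_ext F (u + v) = lin_ext F u + lin_ext F v" for u v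
  proof -
    let ?S = "Poly_Mapping.keys u \<union> Poly_Mapping.keys v"
    have "Poly_Mapping.keys (u + v) \<subseteq> ?S" by (rule keys_add)
    then show ?thesis
      by (simp add: lin_ext_superset[where S = ?S] lookup_add vec.scale_left_distrib sum.distrib)
  qed
  moreover have "lin_ext F (c *\<^sub>v v) = c *\<^sub>v lin_ext F v" for c v
    using keys_vscale[of c v]
    by (simp add: lin_ext_superset[where S = "Poly_Mapping.keys v"] vec.scale_sum_right)
  ultimately show ?thesis by (simp add: vlin_def)
qed

lemma lin_ext_unit [simp]: "lin_ext F (unit_vec k) = F k"
  by (simp add: lin_ext_def)

lemma vec_expand: "v = (\<Sum>k\<in>Poly_Mapping.keys v. Poly_Mapping.lookup v k *\<^sub>v unit_vec k)"
  by (rule poly_mapping_eqI)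
    (simp add: lookup_sum lookup_single when_def if_distrib[of "(*) _"] in_keys_iff cong: if_cong)

lemma vlin_eqI:
  assumes "vlin D" "vlin D'" "\<And>k. k \<in> S \<Longrightarrow> D (unit_vec k) = D' (unit_vec k)"
    and "Poly_Mapping.keys v \<subseteq> S"
  shows "D v = D' v"
proof -
  have "D v = (\<Sum>k\<in>Poly_Mapping.keys v. Poly_Mapping.lookup v k *\<^sub>v D (unit_vec k))"
    by (subst vec_expand[of v]) (simp add: vlin_sum[OF assms(1)] vlin_scale[OF assms(1)])
  also have "\<dots> = (\<Sum>k\<in>Poly_Mapping.keys v. Poly_Mapping.lookup v k *\<^sub>v D' (unit_vec k))"
    using assms(3,4) by (intro sum.cong) auto
  also have "\<dots> = D' v"
    by (subst (3) vec_expand[of v]) (simp add: vlin_sum[OF assms(2)] vlin_scale[OF assms(2)])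
  finally show ?thesis .
qed

lemma vlin_id [intro]: "vlin (\<lambda>v. v)" by (simp add: vlin_def)
lemma vlin_const_zero [intro]: "vlin (\<lambda>v. 0)" by (simp add: vlin_def)
lemma vlin_comp: "vlin f \<Longrightarrow> vlin g \<Longrightarrow> vlin (\<lambda>v. f (g v))" by (simp add: vlin_def)
lemma vlin_plus: "vlin f \<Longrightarrow> vlin g \<Longrightarrow> vlin (\<lambda>v. f v + g v)"
  by (simp add: vlin_def vec.scale_right_distrib)
lemma vlin_sub: "vlin f \<Longrightarrow> vlin g \<Longrightarrow> vlin (\<lambda>v. f v - g v)"
  by (simp add: vlin_def vec.scale_right_diff_distrib)
lemma vlin_smult: "vlin f \<Longrightarrow> vlin (\<lambda>v. c *\<^sub>v f v)"
  by (simp add: vlin_def vec.scale_right_distrib mult.commute)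
lemma vlin_setsum: "(\<And>i. i \<in> I \<Longrightarrow> vlin (f i)) \<Longrightarrow> vlin (\<lambda>v. \<Sum>i\<in>I. f i v)"
  by (simp add: vlin_def sum.distrib vec.scale_sum_right)

lemmas vlin_intros = vlin_id vlin_const_zero vlin_plus vlin_sub vlin_smult vlin_setsum

definition supported :: "'k set \<Rightarrow> ('k \<Rightarrow>\<^sub>0 'c::comm_ring_1) set" where
  "supported S = {v. Poly_Mapping.keys v \<subseteq> S}"

lemma supported_zero [simp]: "0 \<in> supported S" by (simp add: supported_def)
lemma supported_unit: "k \<in> S \<Longrightarrow> unit_vec k \<in> supported S" by (simp add: supported_def)
lemma supported_add [intro]: "u \<in> supported S \<Longrightarrow> v \<in> supported S \<Longrightarrow> u + v \<in> supported S"
  using keys_add[of u v] by (auto simp: supported_def)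
lemma supported_scale [intro]: "v \<in> supported S \<Longrightarrow> c *\<^sub>v v \<in> supported S"
  using keys_vscale[of c v] by (auto simp: supported_def)
lemma supported_minus [intro]: "v \<in> supported S \<Longrightarrow> - v \<in> supported S"
  using supported_scale[of v S "-1"] by simp
lemma supported_diff [intro]: "u \<in> supported S \<Longrightarrow> v \<in> supported S \<Longrightarrow> u - v \<in> supported S"
  using supported_add[of u S "-v"] supported_minus by auto
lemma supported_sum [intro]: "(\<And>i. i \<in> I \<Longrightarrow> f i \<in> supported S) \<Longrightarrow> (\<Sum>i\<in>I. f i) \<in> supported S"
  by (induction I rule: infinite_finite_induct) auto

lemma supported_vlin:
  assumes "vlin D" "\<And>k. k \<in> S \<Longrightarrow> D (unit_vec k) \<in> supported S'" "v \<in> supported S"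
  shows "D v \<in> supported S'"
proof -
  have "D v = (\<Sum>k\<in>Poly_Mapping.keys v. Poly_Mapping.lookup v k *\<^sub>v D (unit_vec k))"
    by (subst vec_expand[of v]) (simp add: vlin_sum[OF assms(1)] vlin_scale[OF assms(1)])
  also have "\<dots> \<in> supported S'" using assms(2,3) by (auto simp: supported_def[of S])
  finally show ?thesis .
qed

text \<open>Operator identities are checked on basis vectors.  The restriction to part of the basis matters
  because truncation makes some of them true only for small exponents.\<close>

lemma vlin_eq_on_supported:
  assumes "v \<in> supported S" "vlin D" "vlin D'" "\<And>k. k \<in> S \<Longrightarrow> D (unit_vec k) = D' (unit_vec k)"
  shows "D v = D' v"
  using assms vlin_eqI[of D D' S v] by (auto simp: supported_def)


section \<open>Demazure-Lusztig operators on coloured words\<close>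

text \<open>The basis vector \<open>(\<sigma>, a)\<close> stands for \<open>X\<^sub>1\<^sup>a\<^sup>1 X\<^sub>2\<^sup>a\<^sup>2 \<cdots> \<otimes> \<sigma>\<close>, where \<open>\<sigma>\<close> is read as the word of the labels
  \<open>\<sigma> 1, \<sigma> 2, \<dots>\<close>; only finitely many positions are ever touched.\<close>

type_synonym yvec = "(nat perm \<times> (nat \<Rightarrow> nat)) \<Rightarrow>\<^sub>0 laurent"

abbreviation bv :: "nat perm \<Rightarrow> (nat \<Rightarrow> nat) \<Rightarrow> yvec" where
  "bv \<sigma> a \<equiv> unit_vec (\<sigma>, a)"

notation Perm.apply (infixl "\<langle>$\<rangle>" 999)

definition swp :: "nat \<Rightarrow> nat perm" where
  "swp i = Perm.swap i (Suc i)"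

lemma apply_swp: "(\<sigma> * swp i) \<langle>$\<rangle> j = \<sigma> \<langle>$\<rangle> (transpose i (Suc i) j)"
  by (auto simp: swp_def apply_times transpose_def)

lemma apply_swp_simps [simp]:
  "(\<sigma> * swp i) \<langle>$\<rangle> i = \<sigma> \<langle>$\<rangle> (Suc i)"
  "(\<sigma> * swp i) \<langle>$\<rangle> (Suc i) = \<sigma> \<langle>$\<rangle> i"
  "j \<noteq> i \<Longrightarrow> j \<noteq> Suc i \<Longrightarrow> (\<sigma> * swp i) \<langle>$\<rangle> j = \<sigma> \<langle>$\<rangle> j"
  by (simp_all add: apply_swp)

lemma swp_swp [simp]: "\<sigma> * swp i * swp i = \<sigma>"
  by (rule perm_eqI) (simp add: apply_swp)

lemma swp_braid: "\<sigma> * swp i * swp (Suc i) * swp i = \<sigma> * swp (Suc i) * swp i * swp (Suc i)"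
  by (rule perm_eqI) (auto simp: apply_swp transpose_def)

lemma swp_commute: "i \<noteq> j \<Longrightarrow> i \<noteq> Suc j \<Longrightarrow> j \<noteq> Suc i \<Longrightarrow> \<sigma> * swp i * swp j = \<sigma> * swp j * swp i"
  by (rule perm_eqI) (auto simp: apply_swp transpose_def)

lemma perm_neq: "i \<noteq> j \<Longrightarrow> (\<sigma> :: nat perm) \<langle>$\<rangle> i \<noteq> \<sigma> \<langle>$\<rangle> j"
  by (simp add: apply_inj)

named_theorems vlin_I
declare vlin_intros [vlin_I]

lemma op_eqI: "vlin D \<Longrightarrow> vlin D' \<Longrightarrow> (\<And>\<sigma> a. D (bv \<sigma> a) = D' (bv \<sigma> a)) \<Longrightarrow> \<forall>v. D v = D' v"
  by (metis vlin_eqI[where S = UNIV] surj_pair subset_UNIV)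

definition hq :: laurent where "hq = lvar Q 1 - lvar Q (- 1)"

subsection \<open>Multiplication by the variables\<close>

definition Xop :: "nat \<Rightarrow> yvec \<Rightarrow> yvec" where
  "Xop j = lin_ext (\<lambda>(\<sigma>, a). bv \<sigma> (a(j := Suc (a j))))"

lemma Xop_bv [simp]: "Xop j (bv \<sigma> a) = bv \<sigma> (a(j := Suc (a j)))"
  by (simp add: Xop_def)

lemma vlin_Xop: "vlin (Xop j)" unfolding Xop_def by (rule vlin_lin_ext)
lemma vlin_Xop' [vlin_I]: "vlin f \<Longrightarrow> vlin (\<lambda>v. Xop j (f v))" by (rule vlin_comp[OF vlin_Xop])
lemmas Xop_lin = vlin_rules[OF vlin_Xop]

definition pair :: "nat \<Rightarrow> nat perm \<Rightarrow> (nat \<Rightarrow> nat) \<Rightarrow> nat \<Rightarrow> nat \<Rightarrow> yvec" where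
  "pair i \<sigma> a x y = bv \<sigma> (a(i := x, Suc i := y))"

lemma Xop_pair [simp]:
  "Xop i (pair i \<sigma> a x y) = pair i \<sigma> a (Suc x) y"
  "Xop (Suc i) (pair i \<sigma> a x y) = pair i \<sigma> a x (Suc y)"
  "j \<noteq> i \<Longrightarrow> j \<noteq> Suc i \<Longrightarrow> Xop j (pair i \<sigma> a x y) = pair i \<sigma> (a(j := Suc (a j))) x y"
  by (simp_all add: pair_def fun_upd_twist)

lemma pair_upd [simp]:
  "pair i \<sigma> (a(i := u)) x y = pair i \<sigma> a x y"
  "pair i \<sigma> (a(Suc i := u)) x y = pair i \<sigma> a x y"
  by (simp_all add: pair_def fun_upd_twist)

lemma bv_eq_pair: "bv \<sigma> a = pair i \<sigma> a (a i) (a (Suc i))"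
  by (simp add: pair_def)

text \<open>The divided difference \<open>X\<^sub>i\<^sub>+\<^sub>1 (p - s\<^sub>i p) / (X\<^sub>i\<^sub>+\<^sub>1 - X\<^sub>i)\<close> of the monomial \<open>p = X\<^sub>i\<^sup>x X\<^sub>i\<^sub>+\<^sub>1\<^sup>y\<close>.\<close>

definition dem :: "nat \<Rightarrow> nat perm \<Rightarrow> (nat \<Rightarrow> nat) \<Rightarrow> nat \<Rightarrow> nat \<Rightarrow> yvec" where
  "dem i \<sigma> a x y = (\<Sum>m\<in>{x<..y}. pair i \<sigma> a (x + y - m) m) - (\<Sum>m\<in>{y<..x}. pair i \<sigma> a (x + y - m) m)"

lemma dem_upd [simp]:
  "dem i \<sigma> (a(i := u)) x y = dem i \<sigma> a x y"
  "dem i \<sigma> (a(Suc i := u)) x y = dem i \<sigma> a x y"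
  by (simp_all add: dem_def)

lemma Xop_dem [simp]:
  "j \<noteq> i \<Longrightarrow> j \<noteq> Suc i \<Longrightarrow> Xop j (dem i \<sigma> a x y) = dem i \<sigma> (a(j := Suc (a j))) x y"
  by (simp add: dem_def Xop_lin)

lemma dem_same [simp]: "dem i \<sigma> a x x = 0"
  by (simp add: dem_def)

lemma dem_antisym: "dem i \<sigma> a x y = - dem i \<sigma> a y x"
  by (simp add: dem_def add.commute)

text \<open>Twisted Leibniz rules for the divided difference of \<open>p X\<^sub>i\<^sub>+\<^sub>1\<close> and of \<open>p X\<^sub>i\<close>; they become the Bernstein
  relations of the operators below.\<close>

lemma dem_Suc_right: "dem i \<sigma> a x (Suc y) = Xop i (dem i \<sigma> a x y) + pair i \<sigma> a x (Suc y)"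
proof (cases "x \<le> y")
  case True
  have "(\<Sum>m\<in>{x<..Suc y}. pair i \<sigma> a (x + Suc y - m) m)
      = (\<Sum>m\<in>{x<..y}. pair i \<sigma> a (x + Suc y - m) m) + pair i \<sigma> a x (Suc y)"
    using True by (simp add: atLeastSucAtMost_greaterThanAtMost[symmetric])
  moreover have "(\<Sum>m\<in>{x<..y}. pair i \<sigma> a (x + Suc y - m) m) = (\<Sum>m\<in>{x<..y}. Xop i (pair i \<sigma> a (x + y - m) m))"
    by (intro sum.cong) (auto simp: Suc_diff_le)
  ultimately show ?thesis using True by (simp add: dem_def Xop_lin)
next
  case False
  have "{y<..x} = insert (Suc y) {Suc y<..x}" using False by auto
  then have "(\<Sum>m\<in>{y<..x}. pair i \<sigma> a (x + Suc y - m) m)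
      = (\<Sum>m\<in>{Suc y<..x}. pair i \<sigma> a (x + Suc y - m) m) + pair i \<sigma> a x (Suc y)"
    by simp
  moreover have "(\<Sum>m\<in>{y<..x}. pair i \<sigma> a (x + Suc y - m) m) = (\<Sum>m\<in>{y<..x}. Xop i (pair i \<sigma> a (x + y - m) m))"
    by (intro sum.cong) (auto simp: Suc_diff_le)
  ultimately show ?thesis using False by (simp add: dem_def Xop_lin algebra_simps)
qed

lemma dem_Suc_left: "dem i \<sigma> a (Suc x) y = Xop (Suc i) (dem i \<sigma> a x y) - pair i \<sigma> a x (Suc y)"
proof -
  have shift: "(\<Sum>m\<in>{u<..w}. Xop (Suc i) (pair i \<sigma> a (x + y - m) m))
      = (\<Sum>m\<in>{Suc u<..Suc w}. pair i \<sigma> a (Suc x + y - m) m)" for u w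
    by (rule sum.reindex_bij_witness[where i = "\<lambda>m. m - 1" and j = Suc]) auto
  show ?thesis
  proof (cases "x < y")
    case True
    have "{Suc x<..Suc y} = insert (Suc y) {Suc x<..y}" using True by auto
    then show ?thesis using True by (simp add: dem_def Xop_lin shift del: Xop_pair)
  next
    case False
    have "{y<..Suc x} = insert (Suc y) {Suc y<..Suc x}" using False by auto
    then show ?thesis using False by (simp add: dem_def Xop_lin shift del: Xop_pair)
  qed
qed

text \<open>A colouring attaches to every label the exponent of the root of unity by which \<open>t\<close> acts on it.
  The idempotent \<open>e\<^sub>i\<close> projects onto the words whose labels at \<open>i\<close> and \<open>i + 1\<close> have the same colour.\<close>

locale coloured =
  fixes col :: "nat \<Rightarrow> nat"
begin

definition same :: "nat \<Rightarrow> nat perm \<Rightarrow> bool" where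
  "same i \<sigma> \<longleftrightarrow> col (\<sigma> \<langle>$\<rangle> i) = col (\<sigma> \<langle>$\<rangle> (Suc i))"

text \<open>The operator of \<open>g\<^sub>i\<close>.  On words it is the Hecke \<open>R\<close>-matrix, which swaps an ascending pair of labels and
  adds \<open>q - q\<^sup>-\<^sup>1\<close> times the identity to the swap of a descending pair of one colour; the polynomial
  part follows from moving \<open>g\<^sub>i\<close> past a monomial.  Since the labels are distinct, a sorted word is
  moved by plain swaps along any word of ascents, which is what separates the permutations.\<close>

definition Gfun :: "nat \<Rightarrow> nat perm \<Rightarrow> (nat \<Rightarrow> nat) \<Rightarrow> nat \<Rightarrow> nat \<Rightarrow> yvec" where
  "Gfun i \<sigma> a x y = pair i (\<sigma> * swp i) a y x +
     (if same i \<sigma>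
      then hq *\<^sub>v (dem i \<sigma> a x y + (if \<sigma> \<langle>$\<rangle> (Suc i) < \<sigma> \<langle>$\<rangle> i then pair i \<sigma> a y x else 0))
      else 0)"

definition Gop :: "nat \<Rightarrow> yvec \<Rightarrow> yvec" where
  "Gop i = lin_ext (\<lambda>(\<sigma>, a). Gfun i \<sigma> a (a i) (a (Suc i)))"

definition Eop :: "nat \<Rightarrow> yvec \<Rightarrow> yvec" where
  "Eop i = lin_ext (\<lambda>(\<sigma>, a). if same i \<sigma> then bv \<sigma> a else 0)"

lemma vlin_Gop: "vlin (Gop j)" unfolding Gop_def by (rule vlin_lin_ext)
lemma vlin_Gop' [vlin_I]: "vlin f \<Longrightarrow> vlin (\<lambda>v. Gop j (f v))" by (rule vlin_comp[OF vlin_Gop])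
lemmas Gop_lin = vlin_rules[OF vlin_Gop]
lemma vlin_Eop: "vlin (Eop j)" unfolding Eop_def by (rule vlin_lin_ext)
lemma vlin_Eop' [vlin_I]: "vlin f \<Longrightarrow> vlin (\<lambda>v. Eop j (f v))" by (rule vlin_comp[OF vlin_Eop])
lemmas Eop_lin = vlin_rules[OF vlin_Eop]
lemmas op_lin = Xop_lin Gop_lin Eop_lin

lemma Gop_bv: "Gop i (bv \<sigma> a) = Gfun i \<sigma> a (a i) (a (Suc i))"
  by (simp add: Gop_def)

lemma Gfun_upd [simp]:
  "Gfun i \<sigma> (a(i := u)) x y = Gfun i \<sigma> a x y"
  "Gfun i \<sigma> (a(Suc i := u)) x y = Gfun i \<sigma> a x y"
  by (simp_all add: Gfun_def)

lemma Gop_pair: "Gop i (pair i \<sigma> a x y) = Gfun i \<sigma> a x y"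
  by (simp add: pair_def Gop_bv)

lemma Eop_bv: "Eop i (bv \<sigma> a) = (if same i \<sigma> then bv \<sigma> a else 0)"
  by (simp add: Eop_def)

lemma Eop_pair: "Eop j (pair i \<sigma> a x y) = (if same j \<sigma> then pair i \<sigma> a x y else 0)"
  by (simp add: pair_def Eop_bv)

lemma Eop_dem: "Eop j (dem i \<sigma> a x y) = (if same j \<sigma> then dem i \<sigma> a x y else 0)"
  by (simp add: dem_def Eop_lin Eop_pair)

lemma same_swp [simp]: "same i (\<sigma> * swp i) \<longleftrightarrow> same i \<sigma>"
  by (auto simp: same_def)

lemma same_far [simp]: "i + 2 \<le> j \<or> j + 2 \<le> i \<Longrightarrow> same i (\<sigma> * swp j) \<longleftrightarrow> same i \<sigma>"
  by (auto simp: same_def)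

lemma E_E: "Eop i (Eop i v) = Eop i v"
proof -
  have "\<forall>v. Eop i (Eop i v) = Eop i v"
    by (rule op_eqI) (auto intro!: vlin_I vlin_Eop simp: Eop_bv Eop_lin)
  then show ?thesis ..
qed

lemma E_X: "Eop i (Xop j v) = Xop j (Eop i v)"
proof -
  have "\<forall>v. Eop i (Xop j v) = Xop j (Eop i v)"
    by (rule op_eqI) (auto intro!: vlin_I vlin_Eop vlin_Xop simp: Eop_bv op_lin)
  then show ?thesis ..
qed

lemma E_G: "Eop i (Gop i v) = Gop i (Eop i v)"
proof -
  have "\<forall>v. Eop i (Gop i v) = Gop i (Eop i v)"
    by (rule op_eqI) (auto intro!: vlin_I vlin_Eop vlin_Gop simp: Eop_bv Gop_bv op_lin Gfun_def Eop_pair Eop_dem)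
  then show ?thesis ..
qed

lemma E_G_far:
  assumes "i + 2 \<le> j \<or> j + 2 \<le> i"
  shows "Eop i (Gop j v) = Gop j (Eop i v)"
proof -
  have "\<forall>v. Eop i (Gop j v) = Gop j (Eop i v)"
    using assms
    by (intro op_eqI) (auto intro!: vlin_I vlin_Eop vlin_Gop simp: Eop_bv Gop_bv op_lin Gfun_def Eop_pair Eop_dem)
  then show ?thesis ..
qed

lemma G_X_left: "Gop i (Xop i v) = Xop (Suc i) (Gop i v - hq *\<^sub>v Eop i v)"
proof -
  have "\<forall>v. Gop i (Xop i v) = Xop (Suc i) (Gop i v - hq *\<^sub>v Eop i v)"
  proof (rule op_eqI)
    fix \<sigma> a
    show "Gop i (Xop i (bv \<sigma> a)) = Xop (Suc i) (Gop i (bv \<sigma> a) - hq *\<^sub>v Eop i (bv \<sigma> a))"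
      by (auto simp: Gop_bv Eop_bv Gfun_def op_lin dem_Suc_left vec.scale_right_distrib
          vec.scale_right_diff_distrib bv_eq_pair[of \<sigma> a i] Gop_pair Eop_pair algebra_simps)
  qed (auto intro!: vlin_I)
  then show ?thesis ..
qed

lemma G_X_right: "Gop i (Xop (Suc i) v) = Xop i (Gop i v) + hq *\<^sub>v Eop i (Xop (Suc i) v)"
proof -
  have "\<forall>v. Gop i (Xop (Suc i) v) = Xop i (Gop i v) + hq *\<^sub>v Eop i (Xop (Suc i) v)"
  proof (rule op_eqI)
    fix \<sigma> a
    show "Gop i (Xop (Suc i) (bv \<sigma> a)) = Xop i (Gop i (bv \<sigma> a)) + hq *\<^sub>v Eop i (Xop (Suc i) (bv \<sigma> a))"
      by (auto simp: Gop_bv Eop_bv Gfun_def op_lin dem_Suc_right vec.scale_right_distrib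
          bv_eq_pair[of \<sigma> _ i] Gop_pair Eop_pair algebra_simps)
  qed (auto intro!: vlin_I)
  then show ?thesis ..
qed

lemma G_X_far:
  assumes "j \<noteq> i" "j \<noteq> Suc i"
  shows "Gop i (Xop j v) = Xop j (Gop i v)"
proof -
  have "\<forall>v. Gop i (Xop j v) = Xop j (Gop i v)"
    using assms
    by (intro op_eqI) (auto intro!: vlin_I vlin_Xop vlin_Gop simp: Gop_bv op_lin Gfun_def)
  then show ?thesis ..
qed

subsection \<open>The Hecke relations\<close>

text \<open>An identity \<open>D = 0\<close> of operators need not be checked on all polynomials: the kernel of \<open>D\<close> is everything
  as soon as it contains the vectors without variables at the affected positions and is stable under
  multiplication by these variables.\<close>

lemma kernel_induct:
  assumes D: "vlin D" and I: "finite I"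
    and base: "\<And>\<sigma> a. (\<And>i. i \<in> I \<Longrightarrow> a i = 0) \<Longrightarrow> D (bv \<sigma> a) = 0"
    and step: "\<And>i v. i \<in> I \<Longrightarrow> D v = 0 \<Longrightarrow> D (Xop i v) = 0"
  shows "D v = 0"
proof -
  have "D (bv \<sigma> a) = 0" for \<sigma> a
  proof (induction "\<Sum>i\<in>I. a i" arbitrary: a)
    case 0
    then show ?case using I by (intro base) simp
  next
    case (Suc n)
    then obtain i where i: "i \<in> I" "a i \<noteq> 0"
      by (metis sum.neutral nat.distinct(1))
    let ?a = "a(i := a i - 1)"
    have "(\<Sum>i\<in>I. a i) = a i + (\<Sum>j\<in>I - {i}. a j)" "(\<Sum>j\<in>I. ?a j) = (a i - 1) + (\<Sum>j\<in>I - {i}. a j)"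
      using i I by (simp_all add: sum.remove)
    with Suc(2) i have "D (bv \<sigma> ?a) = 0" by (intro Suc(1)) auto
    from step[OF i(1) this] show ?case using i(2) by simp
  qed
  then have "\<forall>v. D v = 0" by (intro op_eqI[OF D]) (auto intro: vlin_I)
  then show ?thesis ..
qed

lemma bv_swap: "a i = x \<Longrightarrow> a (Suc i) = x \<Longrightarrow> pair i \<sigma> a x x = bv \<sigma> a"
  by (auto simp: pair_def fun_upd_idem)

lemma Gop_bv_zero:
  assumes "a i = 0" "a (Suc i) = 0"
  shows "Gop i (bv \<sigma> a) = bv (\<sigma> * swp i) a
    + (if same i \<sigma> \<and> \<sigma> \<langle>$\<rangle> (Suc i) < \<sigma> \<langle>$\<rangle> i then hq *\<^sub>v bv \<sigma> a else 0)"
  using assms by (auto simp: Gop_bv Gfun_def bv_swap)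

text \<open>By the Bernstein relations \<open>g\<^sub>i\<^sup>2 - (q - q\<^sup>-\<^sup>1) e\<^sub>i g\<^sub>i - 1\<close> commutes with \<open>X\<^sub>i\<close> and \<open>X\<^sub>i\<^sub>+\<^sub>1\<close>, so only words
  remain to be checked.\<close>

lemma G_quadratic: "Gop i (Gop i v) = v + hq *\<^sub>v Eop i (Gop i v)"
proof -
  define D where "D v = Gop i (Gop i v) - hq *\<^sub>v Eop i (Gop i v) - v" for v
  have "D v = 0" for v
  proof (rule kernel_induct[where D = D and I = "{i, Suc i}"])
    show "vlin D" unfolding D_def by (intro vlin_I)
  next
    fix \<sigma> and a :: "nat \<Rightarrow> nat" assume "\<And>j. j \<in> {i, Suc i} \<Longrightarrow> a j = 0"
    then show "D (bv \<sigma> a) = 0"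
      using perm_neq[of i "Suc i" \<sigma>] by (simp add: D_def Gop_bv_zero op_lin Eop_bv)
  next
    fix j v assume j: "j \<in> {i, Suc i}" and v: "D v = 0"
    have "D (Xop i v) = Xop i (D v)" "D (Xop (Suc i) v) = Xop (Suc i) (D v)"
      by (simp_all add: D_def G_X_left G_X_right op_lin E_X E_G[symmetric] E_E
          vec.scale_right_distrib vec.scale_right_diff_distrib)
    then show "D (Xop j v) = 0" using j v by (auto simp: op_lin)
  qed simp
  from this[of v] show ?thesis by (simp add: D_def algebra_simps)
qed

lemma G_commute_less:
  assumes ij: "i + 2 \<le> j"
  shows "Gop i (Gop j v) = Gop j (Gop i v)"
proof -
  have neq: "i \<noteq> j" "i \<noteq> Suc j" "j \<noteq> Suc i" "j \<noteq> i" "Suc i \<noteq> Suc j" "Suc j \<noteq> i" "Suc i \<noteq> j"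
    using ij by auto
  have E_far: "Eop i (Gop j v) = Gop j (Eop i v)" "Eop j (Gop i v) = Gop i (Eop j v)" for v
    using ij by (auto intro: E_G_far)
  have same: "same i (\<sigma> * swp j) \<longleftrightarrow> same i \<sigma>" "same j (\<sigma> * swp i) \<longleftrightarrow> same j \<sigma>" for \<sigma>
    using ij by (auto intro: same_far)
  define D where "D v = Gop i (Gop j v) - Gop j (Gop i v)" for v
  have "D v = 0" for v
  proof (rule kernel_induct[where D = D and I = "{i, Suc i, j, Suc j}"])
    show "vlin D" unfolding D_def by (intro vlin_I)
  next
    fix \<sigma> and a :: "nat \<Rightarrow> nat" assume "\<And>k. k \<in> {i, Suc i, j, Suc j} \<Longrightarrow> a k = 0"
    moreover have "\<sigma> * swp i * swp j = \<sigma> * swp j * swp i"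
      by (rule swp_commute[OF neq(1-3)])
    ultimately show "D (bv \<sigma> a) = 0"
      using neq by (simp add: D_def Gop_bv_zero op_lin same vec.scale_right_distrib add_ac)
  next
    fix k v assume k: "k \<in> {i, Suc i, j, Suc j}" and v: "D v = 0"
    from v have comm: "Gop i (Gop j v) = Gop j (Gop i v)" by (simp add: D_def)
    consider "k = i" | "k = Suc i" | "k = j" | "k = Suc j" using k by auto
    then show "D (Xop k v) = 0"
      using neq by cases (simp_all add: D_def G_X_left G_X_right G_X_far op_lin E_X E_far comm)
  qed simp
  from this[of v] show ?thesis by (simp add: D_def)
qed

lemma G_commute:
  assumes "i + 2 \<le> j \<or> j + 2 \<le> i"
  shows "Gop i (Gop j v) = Gop j (Gop i v)"
  using assms G_commute_less[of i j v] G_commute_less[of j i v] by auto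

text \<open>The inverse of \<open>g\<^sub>i\<close> given by the quadratic relation.\<close>

definition Ginv :: "nat \<Rightarrow> yvec \<Rightarrow> yvec" where
  "Ginv i v = Gop i v - hq *\<^sub>v Eop i v"

lemma vlin_Ginv: "vlin (Ginv i)"
  unfolding Ginv_def by (intro vlin_I vlin_Gop vlin_Eop)
lemmas Ginv_lin = vlin_rules[OF vlin_Ginv]

lemma G_Ginv [simp]: "Gop i (Ginv i v) = v"
  by (simp add: Ginv_def op_lin G_quadratic E_G)

lemma Ginv_G [simp]: "Ginv i (Gop i v) = v"
  by (simp add: Ginv_def op_lin G_quadratic)

lemma G_X_G: "Gop i (Xop i (Gop i v)) = Xop (Suc i) v"
  by (simp add: G_X_left flip: Ginv_def)

text \<open>On colour words, \<open>g\<^sub>i\<close> acts by the transposition \<open>s\<^sub>i\<close>, and \<open>e\<^sub>i\<close> is a scalar.\<close>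

definition colour_space :: "(nat \<Rightarrow> nat) \<Rightarrow> yvec set" where
  "colour_space \<kappa> = supported {(\<sigma>, a). (\<lambda>j. col (\<sigma> \<langle>$\<rangle> j)) = \<kappa>}"

lemma Eop_colour:
  assumes "v \<in> colour_space \<kappa>"
  shows "Eop i v = (if \<kappa> i = \<kappa> (Suc i) then v else 0)"
proof (cases "\<kappa> i = \<kappa> (Suc i)")
  case True
  have "Eop i v = v"
    by (rule vlin_eq_on_supported[OF assms[unfolded colour_space_def]])
      (use True in \<open>auto intro!: vlin_I vlin_Eop simp: Eop_bv same_def\<close>)
  then show ?thesis using True by simp
next
  case False
  have "Eop i v = 0"
    by (rule vlin_eq_on_supported[OF assms[unfolded colour_space_def]])
      (use False in \<open>auto intro!: vlin_I vlin_Eop simp: Eop_bv same_def\<close>)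
  then show ?thesis using False by simp
qed

lemma Gop_colour:
  assumes "v \<in> colour_space \<kappa>"
  shows "Gop i v \<in> colour_space (\<kappa> \<circ> transpose i (Suc i))"
  using assms unfolding colour_space_def
proof (rule supported_vlin[OF vlin_Gop, rotated])
  fix k assume "k \<in> {(\<sigma>, a :: nat \<Rightarrow> nat). (\<lambda>j. col (\<sigma> \<langle>$\<rangle> j)) = \<kappa>}"
  then obtain \<sigma> a where k: "k = (\<sigma>, a)" and \<kappa>: "\<kappa> = (\<lambda>j. col (\<sigma> \<langle>$\<rangle> j))" by auto
  have *: "(\<lambda>j. col (\<sigma> \<langle>$\<rangle> j)) = \<kappa> \<circ> transpose i (Suc i)" if "same i \<sigma>"
    using that by (auto simp: \<kappa> same_def fun_eq_iff transpose_def)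
  have **: "(\<lambda>j. col ((\<sigma> * swp i) \<langle>$\<rangle> j)) = \<kappa> \<circ> transpose i (Suc i)"
    by (auto simp: \<kappa> fun_eq_iff apply_swp)
  show "Gop i (unit_vec k) \<in> supported {(\<sigma>, a). (\<lambda>j. col (\<sigma> \<langle>$\<rangle> j)) = \<kappa> \<circ> transpose i (Suc i)}"
    using * ** unfolding k Gop_bv Gfun_def dem_def pair_def
    by (auto intro!: supported_unit supported_sum supported_add supported_diff supported_scale)
qed

lemma colour_spaceI: "bv \<sigma> a \<in> colour_space (\<lambda>j. col (\<sigma> \<langle>$\<rangle> j))"
  by (simp add: colour_space_def supported_unit)

lemma E_braid: "Gop i (Gop (Suc i) (Eop i v)) = Eop (Suc i) (Gop i (Gop (Suc i) v))"
proof -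
  have "\<forall>v. Gop i (Gop (Suc i) (Eop i v)) = Eop (Suc i) (Gop i (Gop (Suc i) v))"
  proof (rule op_eqI)
    fix \<sigma> a
    show "Gop i (Gop (Suc i) (Eop i (bv \<sigma> a))) = Eop (Suc i) (Gop i (Gop (Suc i) (bv \<sigma> a)))"
      by (simp add: Eop_colour[OF colour_spaceI] Eop_colour[OF Gop_colour[OF Gop_colour[OF colour_spaceI]]] op_lin)
  qed (intro vlin_I)+
  then show ?thesis ..
qed

lemma E_braid': "Gop (Suc i) (Gop i (Eop (Suc i) v)) = Eop i (Gop (Suc i) (Gop i v))"
proof -
  have "\<forall>v. Gop (Suc i) (Gop i (Eop (Suc i) v)) = Eop i (Gop (Suc i) (Gop i v))"
  proof (rule op_eqI)
    fix \<sigma> a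
    show "Gop (Suc i) (Gop i (Eop (Suc i) (bv \<sigma> a))) = Eop i (Gop (Suc i) (Gop i (bv \<sigma> a)))"
      by (simp add: Eop_colour[OF colour_spaceI] Eop_colour[OF Gop_colour[OF Gop_colour[OF colour_spaceI]]] op_lin)
  qed (intro vlin_I)+
  then show ?thesis ..
qed

text \<open>The difference \<open>D\<close> of the two sides satisfies \<open>D g\<^sub>i = ((q - q\<^sup>-\<^sup>1) e\<^sub>i\<^sub>+\<^sub>1 - g\<^sub>i\<^sub>+\<^sub>1) D\<close> and its mirror image, so the
  kernel of \<open>D\<close> is stable under \<open>g\<^sub>i\<close>, \<open>g\<^sub>i\<^sub>+\<^sub>1\<close> and their inverses.  Moving \<open>X\<^sub>i\<close> through both sides
  gives \<open>D X\<^sub>i = X\<^sub>i\<^sub>+\<^sub>2 g\<^sup>-\<^sup>1 g\<^sup>-\<^sup>1 D g\<^sup>-\<^sup>1 g\<^sup>-\<^sup>1\<close>, hence the kernel is stable under \<open>X\<^sub>i\<close>, and then under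
  \<open>X\<^sub>i\<^sub>+\<^sub>1 = g\<^sub>i X\<^sub>i g\<^sub>i\<close> and \<open>X\<^sub>i\<^sub>+\<^sub>2\<close>.\<close>

lemma G_braid: "Gop i (Gop (Suc i) (Gop i v)) = Gop (Suc i) (Gop i (Gop (Suc i) v))"
proof -
  let ?j = "Suc i"
  define D where "D v = Gop i (Gop ?j (Gop i v)) - Gop ?j (Gop i (Gop ?j v))" for v
  have linD: "vlin D" unfolding D_def by (intro vlin_I)
  note D_lin = vlin_rules[OF linD]
  have DE: "D (Eop i v) = Eop ?j (D v)" "D (Eop ?j v) = Eop i (D v)" for v
    by (simp_all add: D_def op_lin E_braid E_braid' E_G[symmetric])
  have DG: "D (Gop i v) = hq *\<^sub>v Eop ?j (D v) - Gop ?j (D v)"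
    "D (Gop ?j v) = hq *\<^sub>v Eop i (D v) - Gop i (D v)" for v
    by (simp_all add: D_def op_lin G_quadratic E_braid E_braid' E_G[symmetric]
        vec.scale_right_diff_distrib)
  have kerG: "D (Gop i v) = 0" "D (Gop ?j v) = 0" "D (Ginv i v) = 0" "D (Ginv ?j v) = 0"
    if "D v = 0" for v
    using that by (simp_all add: DG DE Ginv_def D_lin op_lin)
  have DX: "D (Xop i v) = Xop (Suc ?j) (Ginv ?j (Ginv i (D (Ginv ?j (Ginv i v)))))" for v
  proof -
    have "D (Xop i v) = Xop (Suc ?j) (Gop i (Ginv ?j (Ginv i v)) - Ginv ?j (Ginv i (Gop ?j v)))"
      by (simp add: D_def G_X_left[folded Ginv_def] G_X_far op_lin)
    also have "Gop i (Ginv ?j (Ginv i v)) - Ginv ?j (Ginv i (Gop ?j v))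
       = Ginv ?j (Ginv i (D (Ginv ?j (Ginv i v))))"
      by (simp add: D_def Ginv_lin)
    finally show ?thesis .
  qed
  have kerX: "D (Xop i v) = 0" if "D v = 0" for v
    using that by (simp add: DX kerG op_lin Ginv_lin)
  have kerX': "D (Xop ?j v) = 0" if "D v = 0" for v
    using that by (simp add: G_X_G[symmetric] kerX kerG)
  have kerX'': "D (Xop (Suc ?j) v) = 0" if "D v = 0" for v
    using that by (simp add: G_X_G[of ?j, symmetric] kerX' kerG)
  have "D v = 0" for v
  proof (rule kernel_induct[where D = D and I = "{i, ?j, Suc ?j}", OF linD])
    fix \<sigma> and a :: "nat \<Rightarrow> nat" assume "\<And>k. k \<in> {i, ?j, Suc ?j} \<Longrightarrow> a k = 0"
    then have zero: "a i = 0" "a ?j = 0" "a (Suc ?j) = 0" by auto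
    show "D (bv \<sigma> a) = 0"
      using perm_neq[of i ?j \<sigma>] perm_neq[of ?j "Suc ?j" \<sigma>] perm_neq[of i "Suc ?j" \<sigma>]
      by (simp add: D_def Gop_bv_zero[where a = a] zero op_lin same_def swp_braid vec.scale_right_distrib) (simp add: mult.assoc)
  qed (use kerX kerX' kerX'' in auto)
  from this[of v] show ?thesis by (simp add: D_def)
qed
definition boxed :: "nat set \<Rightarrow> nat \<Rightarrow> (nat perm \<times> (nat \<Rightarrow> nat)) set" where
  "boxed I B = {(\<sigma>, a). \<forall>i\<in>I. a i < B}"

lemma bv_boxed: "(\<And>i. i \<in> I \<Longrightarrow> a i < B) \<Longrightarrow> bv \<sigma> a \<in> supported (boxed I B)"
  by (auto simp: boxed_def intro: supported_unit)

text \<open>The exponents in a divided difference of a monomial lie between the two exponents of the monomial,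
  so an upper bound that is common to positions \<open>i\<close> and \<open>i + 1\<close> is preserved.\<close>

lemma Gop_boxed:
  assumes v: "v \<in> supported (boxed I B)" and I: "i \<in> I \<longleftrightarrow> Suc i \<in> I"
  shows "Gop i v \<in> supported (boxed I B)"
proof (rule supported_vlin[OF vlin_Gop _ v])
  fix k assume "k \<in> boxed I B"
  then obtain \<sigma> a where k: "k = (\<sigma>, a)" and a: "\<And>i. i \<in> I \<Longrightarrow> a i < B"
    by (auto simp: boxed_def)
  have pair: "pair i \<tau> a x y \<in> supported (boxed I B)" if "i \<in> I \<Longrightarrow> x < B" "i \<in> I \<Longrightarrow> y < B" for \<tau> x y
    unfolding pair_def by (rule bv_boxed) (use that a I in auto)
  have ab: "a i < B" "a (Suc i) < B" if "i \<in> I" using that a I by auto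
  have "dem i \<sigma> a (a i) (a (Suc i)) \<in> supported (boxed I B)"
    unfolding dem_def by (intro supported_diff supported_sum pair) (use ab in force)+
  then show "Gop i (unit_vec k) \<in> supported (boxed I B)"
    unfolding k Gop_bv Gfun_def using ab
    by (auto intro!: supported_add supported_scale pair)
qed

lemma Eop_boxed: "v \<in> supported S \<Longrightarrow> Eop i v \<in> supported S"
  by (rule supported_vlin[OF vlin_Eop]) (auto simp: Eop_bv intro: supported_unit)

end

subsection \<open>Truncation\<close>

text \<open>On the vectors with exponents below \<open>d\<close>, the variable \<open>X\<^sub>j\<close> acts by the companion matrix of the monic
  polynomial with coefficients \<open>f\<close>.  All relations that involve \<open>g\<^sub>i\<close> with \<open>i \<noteq> j\<close>, \<open>i + 1 \<noteq> j\<close> survive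
  truncation; the braid relation between \<open>g\<^sub>i\<close> and \<open>X\<^sub>i\<close> does so for a subtler reason.\<close>

locale truncated = coloured +
  fixes d :: nat and f :: "nat \<Rightarrow> laurent" and f0inv :: laurent
  assumes d_pos: "1 \<le> d" and f_monic: "f d = 1" and f0inv: "f0inv * f 0 = 1"
begin

definition Xt :: "nat \<Rightarrow> yvec \<Rightarrow> yvec" where
  "Xt j = lin_ext (\<lambda>(\<sigma>, a). if Suc (a j) < d then bv \<sigma> (a(j := Suc (a j)))
     else - (\<Sum>m<d. f m *\<^sub>v bv \<sigma> (a(j := m))))"

lemma vlin_Xt: "vlin (Xt j)" unfolding Xt_def by (rule vlin_lin_ext)
lemma vlin_Xt' [vlin_I]: "vlin g \<Longrightarrow> vlin (\<lambda>v. Xt j (g v))" by (rule vlin_comp[OF vlin_Xt])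
lemmas Xt_lin = vlin_rules[OF vlin_Xt]

lemma Xt_bv: "Xt j (bv \<sigma> a) = (if Suc (a j) < d then bv \<sigma> (a(j := Suc (a j)))
     else - (\<Sum>m<d. f m *\<^sub>v bv \<sigma> (a(j := m))))"
  by (simp add: Xt_def)

lemma Xt_pair:
  "Xt i (pair i \<sigma> a x y) = (if Suc x < d then pair i \<sigma> a (Suc x) y
     else - (\<Sum>m<d. f m *\<^sub>v pair i \<sigma> a m y))"
  "Xt (Suc i) (pair i \<sigma> a x y) = (if Suc y < d then pair i \<sigma> a x (Suc y)
     else - (\<Sum>m<d. f m *\<^sub>v pair i \<sigma> a x m))"
  by (simp_all add: pair_def Xt_bv fun_upd_twist)

lemma Xt_Xop_far:
  assumes "i \<noteq> j" shows "Xt j (Xop i v) = Xop i (Xt j v)"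
proof -
  have "\<forall>v. Xt j (Xop i v) = Xop i (Xt j v)"
    by (rule op_eqI) (use assms in \<open>auto intro!: vlin_I vlin_Xop vlin_Xt simp: Xt_bv op_lin fun_upd_twist\<close>)
  then show ?thesis ..
qed

lemma Xt_commute: "Xt j (Xt i v) = Xt i (Xt j v)"
proof (cases "i = j")
  case False
  have "\<forall>v. Xt j (Xt i v) = Xt i (Xt j v)"
  proof (rule op_eqI)
    fix \<sigma> and a :: "nat \<Rightarrow> nat"
    have twist: "a(j := m, i := l) = a(i := l, j := m)" for m l using False by (rule fun_upd_twist[symmetric])
    show "Xt j (Xt i (bv \<sigma> a)) = Xt i (Xt j (bv \<sigma> a))"
      using False
      by (simp add: Xt_bv Xt_lin twist vec.scale_sum_right sum_negf)
         (subst sum.swap, simp add: mult.commute)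
  qed (intro vlin_I)+
  then show ?thesis ..
qed simp

lemma E_Xt: "Eop i (Xt j v) = Xt j (Eop i v)"
proof -
  have "\<forall>v. Eop i (Xt j v) = Xt j (Eop i v)"
    by (rule op_eqI) (auto intro!: vlin_I vlin_Eop vlin_Xt simp: Xt_bv op_lin Xt_lin Eop_bv)
  then show ?thesis ..
qed

lemma G_Xt_far:
  assumes "j \<noteq> i" "j \<noteq> Suc i"
  shows "Gop i (Xt j v) = Xt j (Gop i v)"
proof -
  define D where "D v = Gop i (Xt j v) - Xt j (Gop i v)" for v
  have "D v = 0" for v
  proof (rule kernel_induct[where D = D and I = "{i, Suc i}"])
    show "vlin D" unfolding D_def by (intro vlin_I)
  next
    fix \<sigma> and a :: "nat \<Rightarrow> nat" assume "\<And>k. k \<in> {i, Suc i} \<Longrightarrow> a k = 0"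
    then show "D (bv \<sigma> a) = 0"
      using assms
      by (cases "same i \<sigma>"; cases "\<sigma> \<langle>$\<rangle> (Suc i) < \<sigma> \<langle>$\<rangle> i")
        (simp_all add: D_def Gop_bv_zero op_lin Xt_lin Xt_bv sum.distrib vec.scale_right_distrib
          vec.scale_sum_right mult.commute)
  next
    fix k v assume k: "k \<in> {i, Suc i}" and v: "D v = 0"
    from v have comm: "Gop i (Xt j v) = Xt j (Gop i v)" by (simp add: D_def)
    consider "k = i" | "k = Suc i" using k by auto
    then show "D (Xop k v) = 0"
      using assms by cases (simp_all add: D_def G_X_left G_X_right Xt_Xop_far op_lin Xt_lin E_X E_Xt comm)
  qed simp
  from this[of v] show ?thesis by (simp add: D_def)
qed

lemma Xt_boxed:
  assumes "v \<in> supported (boxed I d)"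
  shows "Xt j v \<in> supported (boxed I d)"
proof (rule supported_vlin[OF vlin_Xt _ assms])
  fix k assume "k \<in> boxed I d"
  then obtain \<sigma> a where "k = (\<sigma>, a)" "\<And>i. i \<in> I \<Longrightarrow> a i < d" by (auto simp: boxed_def)
  then show "Xt j (unit_vec k) \<in> supported (boxed I d)"
    by (auto simp: Xt_bv intro!: supported_minus supported_sum supported_scale bv_boxed)
qed

lemma Xt_low:
  assumes "v \<in> supported {(\<sigma>, a). Suc (a j) < d}"
  shows "Xt j v = Xop j v"
  by (rule vlin_eq_on_supported[OF assms vlin_Xt vlin_Xop]) (auto simp: Xt_bv)

lemma pair_low:
  "Suc x < d \<Longrightarrow> pair i \<sigma> a x y \<in> supported {(\<sigma>, a). Suc (a i) < d}"
  "Suc y < d \<Longrightarrow> pair i \<sigma> a x y \<in> supported {(\<sigma>, a). Suc (a (Suc i)) < d}"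
  by (auto simp: pair_def intro!: supported_unit)

text \<open>\<open>quo m y\<close> is \<open>(X\<^sub>i\<^sup>m X\<^sub>i\<^sub>+\<^sub>1\<^sup>y\<^sup>+\<^sup>1 - X\<^sub>i\<^sup>y\<^sup>+\<^sup>1 X\<^sub>i\<^sub>+\<^sub>1\<^sup>m) / (X\<^sub>i\<^sub>+\<^sub>1 - X\<^sub>i)\<close>.\<close>

definition quo :: "nat \<Rightarrow> nat perm \<Rightarrow> (nat \<Rightarrow> nat) \<Rightarrow> nat \<Rightarrow> nat \<Rightarrow> yvec" where
  "quo i \<sigma> a m y = dem i \<sigma> a m y + pair i \<sigma> a y m"

text \<open>The Bezoutian \<open>(X\<^sub>i\<^sup>y\<^sup>+\<^sup>1 f(X\<^sub>i\<^sub>+\<^sub>1) - X\<^sub>i\<^sub>+\<^sub>1\<^sup>y\<^sup>+\<^sup>1 f(X\<^sub>i)) / (X\<^sub>i\<^sub>+\<^sub>1 - X\<^sub>i)\<close>, with the leading coefficient of \<open>f\<close>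
  written separately.\<close>

definition bez :: "nat \<Rightarrow> nat perm \<Rightarrow> (nat \<Rightarrow> nat) \<Rightarrow> nat \<Rightarrow> yvec" where
  "bez i \<sigma> a y = - (\<Sum>m<d. f m *\<^sub>v quo i \<sigma> a m y) - quo i \<sigma> a d y"

text \<open>Reduction modulo \<open>f(X\<^sub>i)\<close> does not commute with divided differences.  The defect replaces the top
  power of \<open>X\<^sub>i\<close> by a Bezoutian.\<close>

definition Rop :: "nat \<Rightarrow> yvec \<Rightarrow> yvec" where
  "Rop i = lin_ext (\<lambda>(\<sigma>, a). if Suc (a i) = d then bez i \<sigma> a (a (Suc i)) else 0)"

lemma vlin_Rop: "vlin (Rop j)" unfolding Rop_def by (rule vlin_lin_ext)
lemma vlin_Rop' [vlin_I]: "vlin g \<Longrightarrow> vlin (\<lambda>v. Rop j (g v))" by (rule vlin_comp[OF vlin_Rop])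
lemmas Rop_lin = vlin_rules[OF vlin_Rop]

lemma bez_upd [simp]:
  "bez i \<sigma> (a(i := u)) y = bez i \<sigma> a y" "bez i \<sigma> (a(Suc i := u)) y = bez i \<sigma> a y"
  by (simp_all add: bez_def quo_def)

lemma Rop_bv: "Rop i (bv \<sigma> a) = (if Suc (a i) = d then bez i \<sigma> a (a (Suc i)) else 0)"
  by (simp add: Rop_def)

lemma Rop_pair: "Rop i (pair i \<sigma> a x y) = (if Suc x = d then bez i \<sigma> a y else 0)"
  by (simp add: Rop_def pair_def)

lemma Rop_low:
  assumes "v \<in> supported {(\<sigma>, a). Suc (a i) < d}"
  shows "Rop i v = 0"
  by (rule vlin_eq_on_supported[OF assms vlin_Rop vlin_const_zero]) (auto simp: Rop_def)

lemma E_Rop: "Eop i (Rop i v) = Rop i (Eop i v)"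
proof -
  have "\<forall>v. Eop i (Rop i v) = Rop i (Eop i v)"
  proof (rule op_eqI)
    fix \<sigma> a
    show "Eop i (Rop i (bv \<sigma> a)) = Rop i (Eop i (bv \<sigma> a))"
      by (auto simp: Rop_bv Eop_bv Eop_lin Rop_lin bez_def quo_def Eop_pair Eop_dem)
  qed (intro vlin_I)+
  then show ?thesis ..
qed

text \<open>The degree bounds that decide where truncation takes effect: no power \<open>X\<^sub>i\<^sup>d\<^sup>-\<^sup>1\<close> occurs here, in
  the next lemma exactly one that is compensated, and dually for \<open>X\<^sub>i\<^sub>+\<^sub>1\<close> further below.\<close>

lemma quo_low:
  assumes "m < d" "Suc y < d"
  shows "quo i \<sigma> a m y \<in> supported {(\<sigma>, a). Suc (a i) < d}"
proof (cases "m \<le> y")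
  case True
  then show ?thesis unfolding quo_def dem_def
    by (intro supported_add supported_diff supported_sum pair_low) (use assms in auto)
next
  case False
  have "{y<..m} = insert m {y<..<m}" using False by auto
  then have "quo i \<sigma> a m y = - (\<Sum>k\<in>{y<..<m}. pair i \<sigma> a (m + y - k) k)"
    using False by (simp add: quo_def dem_def)
  also have "\<dots> \<in> supported {(\<sigma>, a). Suc (a i) < d}"
    by (intro supported_minus supported_sum pair_low) (use assms in auto)
  finally show ?thesis .
qed

lemma quo_top_low:
  assumes "Suc y < d"
  shows "quo i \<sigma> a d y + pair i \<sigma> a (d - 1) (Suc y) \<in> supported {(\<sigma>, a). Suc (a i) < d}"
proof -
  have "{y<..d} = insert d (insert (Suc y) {Suc y<..<d})" using assms by auto
  then have "quo i \<sigma> a d y + pair i \<sigma> a (d - 1) (Suc y)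
      = - (\<Sum>k\<in>{Suc y<..<d}. pair i \<sigma> a (d + y - k) k)"
    using assms by (simp add: quo_def dem_def)
  also have "\<dots> \<in> supported {(\<sigma>, a). Suc (a i) < d}"
    by (intro supported_minus supported_sum pair_low) (use assms in auto)
  finally show ?thesis .
qed

lemma dem_top_low:
  "dem i \<sigma> a m (d - 1) \<in> supported {(\<sigma>, a). Suc (a i) < d}" if "m < d"
  unfolding dem_def
  by (intro supported_diff supported_sum pair_low) (use that in auto)

lemma quo_Suc: "quo i \<sigma> a m (Suc y) = Xop i (quo i \<sigma> a m y) + pair i \<sigma> a m (Suc y)"
  by (simp add: quo_def dem_Suc_right Xop_lin)

lemma quo_d_pred: "quo i \<sigma> a d (d - 1) = 0"
proof -
  have "{d - 1<..d} = {d}" using d_pos by auto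
  then show ?thesis using d_pos by (simp add: quo_def dem_def)
qed

lemma dem_pair_low:
  assumes "Suc x < d" "y < d"
  shows "dem i \<sigma> a x y - pair i \<sigma> a x y \<in> supported {(\<sigma>, a). Suc (a (Suc i)) < d}"
proof (cases "x < y")
  case True
  have "{x<..y} = insert y {x<..<y}" using True by auto
  then have "dem i \<sigma> a x y - pair i \<sigma> a x y = (\<Sum>k\<in>{x<..<y}. pair i \<sigma> a (x + y - k) k)"
    using True by (simp add: dem_def)
  also have "\<dots> \<in> supported {(\<sigma>, a). Suc (a (Suc i)) < d}"
    by (intro supported_sum pair_low) (use assms in auto)
  finally show ?thesis .
next
  case False
  then show ?thesis unfolding dem_def
    by (intro supported_diff supported_sum pair_low) (use assms in auto)
qed

lemma dem_pair_top_low: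
  assumes "y < d"
  shows "dem i \<sigma> a (d - 1) y - pair i \<sigma> a (d - 1) y + pair i \<sigma> a y (d - 1)
    \<in> supported {(\<sigma>, a). Suc (a (Suc i)) < d}"
proof (cases "y = d - 1")
  case True then show ?thesis by simp
next
  case False
  then have "{y<..d - 1} = insert (d - 1) {y<..<d - 1}" using assms by auto
  then have "dem i \<sigma> a (d - 1) y - pair i \<sigma> a (d - 1) y + pair i \<sigma> a y (d - 1)
    = - (\<Sum>k\<in>{y<..<d - 1}. pair i \<sigma> a (d - 1 + y - k) k) - pair i \<sigma> a (d - 1) y"
    using False assms by (simp add: dem_def)
  also have "\<dots> \<in> supported {(\<sigma>, a). Suc (a (Suc i)) < d}"
    by (intro supported_minus supported_diff supported_sum pair_low) (use assms False in auto)
  finally show ?thesis .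
qed

lemma Xt_dem_pair:
  assumes "y < d"
  shows "Xt (Suc i) (dem i \<sigma> a (d - 1) y - pair i \<sigma> a (d - 1) y)
    = quo i \<sigma> a d y + (\<Sum>m<d. f m *\<^sub>v pair i \<sigma> a y m)"
proof -
  let ?u = "dem i \<sigma> a (d - 1) y - pair i \<sigma> a (d - 1) y"
  have d: "Suc (d - 1) = d" using d_pos by simp
  have "Xt (Suc i) ?u + Xt (Suc i) (pair i \<sigma> a y (d - 1)) = Xop (Suc i) ?u + pair i \<sigma> a y d"
    using Xt_low[OF dem_pair_top_low[OF assms, of i \<sigma> a]]
    unfolding Xt_lin(1) Xop_lin(1) Xop_pair d .
  moreover have "Xop (Suc i) ?u = dem i \<sigma> a d y"
    using dem_Suc_left[of i \<sigma> a "d - 1" y] unfolding d by (simp add: Xop_lin)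
  moreover have "Xt (Suc i) (pair i \<sigma> a y (d - 1)) = - (\<Sum>m<d. f m *\<^sub>v pair i \<sigma> a y m)"
    using d_pos by (simp add: Xt_pair)
  ultimately show ?thesis
    by (simp add: quo_def diff_eq_eq del: One_nat_def)
qed

text \<open>\<open>X\<^sub>i\<close> times the Bezoutian for \<open>y\<close> is the Bezoutian for \<open>y + 1\<close> plus \<open>X\<^sub>i\<^sub>+\<^sub>1\<^sup>y\<^sup>+\<^sup>1 f(X\<^sub>i)\<close>, and the second term
  is removed by truncation.\<close>

lemma Xt_bez:
  assumes "Suc y < d"
  shows "Xt i (bez i \<sigma> a y) = bez i \<sigma> a (Suc y)"
proof -
  have 1: "Xt i (quo i \<sigma> a m y) = quo i \<sigma> a m (Suc y) - pair i \<sigma> a m (Suc y)" if "m < d" for m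
    using Xt_low[OF quo_low[OF that assms]] quo_Suc by simp
  have "Xt i (quo i \<sigma> a d y) + Xt i (pair i \<sigma> a (d - 1) (Suc y)) = quo i \<sigma> a d (Suc y)"
    using Xt_low[OF quo_top_low[OF assms, of i \<sigma> a]] quo_Suc[of i \<sigma> a d y] d_pos by (simp add: Xt_lin Xop_lin)
  then have 2: "Xt i (quo i \<sigma> a d y) = quo i \<sigma> a d (Suc y) + (\<Sum>m<d. f m *\<^sub>v pair i \<sigma> a m (Suc y))"
    using d_pos by (simp add: Xt_pair algebra_simps)
  show ?thesis
    by (simp add: bez_def Xt_lin 1 2 vec.scale_right_diff_distrib sum_subtractf)
qed

lemma Rop_bez:
  assumes "Suc y < d"
  shows "Rop i (bez i \<sigma> a y) = bez i \<sigma> a (Suc y)"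
proof -
  have 1: "Rop i (quo i \<sigma> a m y) = 0" if "m < d" for m
    by (rule Rop_low[OF quo_low[OF that assms]])
  have "Rop i (quo i \<sigma> a d y) + Rop i (pair i \<sigma> a (d - 1) (Suc y)) = 0"
    using Rop_low[OF quo_top_low[OF assms]] by (simp add: Rop_lin)
  then have 2: "Rop i (quo i \<sigma> a d y) = - bez i \<sigma> a (Suc y)"
    using d_pos by (simp add: Rop_pair eq_neg_iff_add_eq_0)
  show ?thesis by (simp add: bez_def[of i \<sigma> a y] Rop_lin 1 2)
qed

lemma Rop_bez_top: "Rop i (bez i \<sigma> a (d - 1)) = - (\<Sum>m<d. f m *\<^sub>v bez i \<sigma> a m)"
proof -
  have "Rop i (quo i \<sigma> a m (d - 1)) = bez i \<sigma> a m" if "m < d" for m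
    using Rop_low[OF dem_top_low[OF that]] d_pos by (simp add: quo_def Rop_lin Rop_pair)
  then show ?thesis by (simp add: bez_def[of i \<sigma> a "d - 1"] Rop_lin quo_d_pred del: One_nat_def)
qed

text \<open>Here \<open>y + 1 = d\<close>, and the Bezoutian for \<open>d\<close> would have to be reduced modulo \<open>f(X\<^sub>i\<^sub>+\<^sub>1)\<close>.  The terms
  \<open>f\<^sub>l f\<^sub>m\<close> times a divided difference cancel by antisymmetry.\<close>

lemma Xt_bez_top: "Xt i (bez i \<sigma> a (d - 1)) = - (\<Sum>m<d. f m *\<^sub>v bez i \<sigma> a m)"
proof -
  have quo_d: "quo i \<sigma> a d l = - Xop i (dem i \<sigma> a l (d - 1))" for l
    using dem_Suc_right[of i \<sigma> a l "d - 1"] dem_antisym[of i \<sigma> a d l] d_pos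
    by (simp add: quo_def)
  have "Xt i (quo i \<sigma> a m (d - 1)) = - quo i \<sigma> a d m - (\<Sum>l<d. f l *\<^sub>v pair i \<sigma> a l m)" if "m < d" for m
    using Xt_low[OF dem_top_low[OF that, of i \<sigma> a]] d_pos by (simp add: quo_def[of i \<sigma> a m] quo_d Xt_lin Xt_pair)
  then have L: "Xt i (bez i \<sigma> a (d - 1)) = (\<Sum>m<d. f m *\<^sub>v quo i \<sigma> a d m) + (\<Sum>m<d. \<Sum>l<d. (f m * f l) *\<^sub>v pair i \<sigma> a l m)"
    by (simp add: bez_def[of i \<sigma> a "d - 1"] Xt_lin quo_d_pred vec.scale_right_diff_distrib
        sum_subtractf sum_negf vec.scale_sum_right del: One_nat_def)
  define S where "S = (\<Sum>l<d. \<Sum>m<d. (f l * f m) *\<^sub>v dem i \<sigma> a m l)"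
  have "S = (\<Sum>m<d. \<Sum>l<d. (f l * f m) *\<^sub>v dem i \<sigma> a m l)"
    unfolding S_def by (rule sum.swap)
  also have "\<dots> = - S"
    unfolding S_def sum_negf[symmetric]
    by (intro sum.cong refl) (subst dem_antisym, simp add: mult.commute)
  finally have "S + S = 0" by (metis add.left_inverse)
  \<comment> \<open>Coefficients are complex, so twice a vector vanishes only if the vector does.\<close>
  have S0: "S = 0"
  proof (intro poly_mapping_eqI)
    fix k l
    have "Poly_Mapping.lookup (Poly_Mapping.lookup S k) l + Poly_Mapping.lookup (Poly_Mapping.lookup S k) l = 0"
      using \<open>S + S = 0\<close> by (metis lookup_add lookup_zero)
    then show "Poly_Mapping.lookup (Poly_Mapping.lookup S k) l = Poly_Mapping.lookup (Poly_Mapping.lookup 0 k) l"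
      by simp
  qed
  have "(\<Sum>m<d. f m *\<^sub>v bez i \<sigma> a m)
      = - S - (\<Sum>m<d. \<Sum>l<d. (f m * f l) *\<^sub>v pair i \<sigma> a m l) - (\<Sum>m<d. f m *\<^sub>v quo i \<sigma> a d m)"
    by (simp add: bez_def quo_def[of i \<sigma> a _ _] S_def vec.scale_sum_right vec.scale_right_distrib
        vec.scale_right_diff_distrib sum.distrib sum_subtractf sum_negf)
  moreover have "(\<Sum>m<d. \<Sum>l<d. (f m * f l) *\<^sub>v pair i \<sigma> a l m)
      = (\<Sum>m<d. \<Sum>l<d. (f m * f l) *\<^sub>v pair i \<sigma> a m l)"
    by (subst sum.swap) (simp add: mult.commute)
  ultimately show ?thesis unfolding L S0 by simp
qed

text \<open>The left Bernstein relation after truncation.  For \<open>a i < d - 1\<close> it is the untruncated relation; for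
  \<open>a i = d - 1\<close> the vector \<open>X\<^sub>i\<^sup>d\<close> is replaced by its reduction before \<open>g\<^sub>i\<close> acts, and the Bezoutian is
  the difference.\<close>

lemma G_Xt:
  assumes v: "v \<in> supported {(\<sigma>, a). a i < d \<and> a (Suc i) < d}"
  shows "Gop i (Xt i v) = Xt (Suc i) (Ginv i v) + hq *\<^sub>v Rop i (Eop i v)"
proof (rule vlin_eq_on_supported[OF v])
  fix k assume "k \<in> {(\<sigma> :: nat perm, a). a i < d \<and> a (Suc i) < d}"
  then obtain \<sigma> a where k: "k = (\<sigma>, a)" and a: "a i < d" "a (Suc i) < d" by auto
  define x y where "x = a i" and "y = a (Suc i)"
  have bv: "unit_vec k = pair i \<sigma> a x y" by (simp add: k x_def y_def pair_def)
  have xy: "x < d" "y < d" using a by (simp_all add: x_def y_def)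
  show "Gop i (Xt i (unit_vec k)) = Xt (Suc i) (Ginv i (unit_vec k)) + hq *\<^sub>v Rop i (Eop i (unit_vec k))"
  proof (cases "Suc x < d")
    case True
    have "Xt (Suc i) (dem i \<sigma> a x y - pair i \<sigma> a x y) = Xop (Suc i) (dem i \<sigma> a x y - pair i \<sigma> a x y)"
      by (rule Xt_low[OF dem_pair_low[OF True xy(2)]])
    then have "Xt (Suc i) (dem i \<sigma> a x y) - Xt (Suc i) (pair i \<sigma> a x y) = dem i \<sigma> a (Suc x) y"
      by (simp add: Xt_lin Xop_lin dem_Suc_left)
    then have *: "Xt (Suc i) (dem i \<sigma> a x y) = dem i \<sigma> a (Suc x) y + Xt (Suc i) (pair i \<sigma> a x y)"
      by (simp add: algebra_simps)
    have **: "Xt (Suc i) (pair i \<tau> a y x) = pair i \<tau> a y (Suc x)" for \<tau>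
      using True by (simp add: Xt_pair)
    have ***: "Xt i (pair i \<sigma> a x y) = pair i \<sigma> a (Suc x) y" using True by (simp add: Xt_pair)
    show ?thesis
      using True unfolding bv ***
      by (simp add: Ginv_def Gop_pair Gfun_def Xt_lin * ** Eop_pair Rop_pair Rop_lin
          vec.scale_right_distrib)
  next
    case False
    then have x: "x = d - 1" and d1: "Suc (d - 1) = d" using xy by auto
    have *: "Xt (Suc i) (dem i \<sigma> a x y)
      = Xt (Suc i) (pair i \<sigma> a x y) - bez i \<sigma> a y - (\<Sum>m<d. f m *\<^sub>v dem i \<sigma> a m y)"
      using Xt_dem_pair[OF xy(2), of i \<sigma> a]
      by (simp add: x Xt_lin bez_def quo_def vec.scale_right_distrib sum.distrib algebra_simps)
    have **: "Xt (Suc i) (pair i \<tau> a y x) = - (\<Sum>m<d. f m *\<^sub>v pair i \<tau> a y m)" for \<tau>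
      using d1 by (simp add: Xt_pair x)
    have ***: "Xt i (pair i \<sigma> a x y) = - (\<Sum>m<d. f m *\<^sub>v pair i \<sigma> a m y)" using d1 by (simp add: Xt_pair x)
    have G: "Gop i (pair i \<sigma> a x y) = pair i (\<sigma> * swp i) a y x +
     (if same i \<sigma> then hq *\<^sub>v (dem i \<sigma> a x y + (if \<sigma> \<langle>$\<rangle> (Suc i) < \<sigma> \<langle>$\<rangle> i then pair i \<sigma> a y x else 0)) else 0)"
      by (simp add: Gop_pair Gfun_def)
    have R: "Rop i (pair i \<sigma> a x y) = bez i \<sigma> a y" using d1 by (simp add: Rop_pair x)
    show ?thesis
      unfolding bv ***
      by (simp add: Ginv_def G Gop_lin Gop_pair[of i \<sigma> a _ y] Gfun_def Xt_lin * ** Eop_pair R Rop_lin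
          vec.scale_right_distrib vec.scale_right_diff_distrib sum.distrib vec.scale_sum_right
          mult.commute sum_negf)
  qed
qed (auto intro!: vlin_I vlin_comp[OF vlin_Xt vlin_Ginv])

text \<open>Both sides shift \<open>y\<close> by one in the Bezoutian, or replace the Bezoutian for \<open>y = d - 1\<close> by minus
  the combination of all Bezoutians with coefficients \<open>f\<close>.\<close>

lemma Rop_square:
  assumes v: "v \<in> supported {(\<sigma>, a). a i < d \<and> a (Suc i) < d}"
  shows "Rop i (Rop i v) = Rop i (Xt (Suc i) v)" "Xt i (Rop i v) = Rop i (Xt (Suc i) v)"
proof -
  have *: "Rop i (Rop i (unit_vec k)) = Rop i (Xt (Suc i) (unit_vec k)) \<and>
    Xt i (Rop i (unit_vec k)) = Rop i (Xt (Suc i) (unit_vec k))"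
    if "k \<in> {(\<sigma> :: nat perm, a). a i < d \<and> a (Suc i) < d}" for k
  proof -
    from that obtain \<sigma> a where k: "k = (\<sigma>, a)" and a: "a i < d" "a (Suc i) < d" by auto
    define x y where "x = a i" and "y = a (Suc i)"
    have bv: "unit_vec k = pair i \<sigma> a x y" by (simp add: k x_def y_def pair_def)
    have xy: "x < d" "y < d" using a by (simp_all add: x_def y_def)
    show ?thesis
    proof (cases "Suc y < d")
      case True
      then show ?thesis unfolding bv
        by (simp add: Rop_pair Rop_lin Xt_lin Xt_pair Xt_bez Rop_bez)
    next
      case False
      then have y: "y = d - 1" using xy by auto
      show ?thesis unfolding bv
        using False by (simp add: Rop_pair Rop_lin Xt_lin Xt_pair y Xt_bez_top[simplified] Rop_bez_top[simplified])
    qed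
  qed
  show "Rop i (Rop i v) = Rop i (Xt (Suc i) v)" "Xt i (Rop i v) = Rop i (Xt (Suc i) v)"
    by (rule vlin_eq_on_supported[OF v]; use * in \<open>auto intro!: vlin_I vlin_Rop\<close>)+
qed

text \<open>The operator \<open>g\<^sub>i X\<^sub>i g\<^sub>i\<close> is the truncated \<open>X\<^sub>i\<^sub>+\<^sub>1\<close> plus \<open>(q - q\<^sup>-\<^sup>1) R e\<^sub>i g\<^sub>i\<close> with the defect \<open>R\<close>.  That it
  commutes with \<open>X\<^sub>i\<close> comes down to \<open>X\<^sub>i R = R X\<^sub>i\<^sub>+\<^sub>1 = R\<^sup>2\<close>.\<close>

lemma Xt_braid:
  assumes v: "v \<in> supported {(\<sigma>, a). a i < d \<and> a (Suc i) < d}"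
  shows "Gop i (Xt i (Gop i (Xt i v))) = Xt i (Gop i (Xt i (Gop i v)))"
proof -
  have box: "{(\<sigma> :: nat perm, a). a i < d \<and> a (Suc i) < d} = boxed {i, Suc i} d"
    by (auto simp: boxed_def)
  note v' = v[unfolded box]
  have GXG: "Gop i (Xt i (Gop i w)) = Xt (Suc i) w + hq *\<^sub>v Rop i (Eop i (Gop i w))"
    if "w \<in> supported (boxed {i, Suc i} d)" for w
    using G_Xt[of "Gop i w" i] Gop_boxed[OF that, of i] by (simp add: box)
  have "Gop i (Xt i (Gop i (Xt i v)))
      = Xt (Suc i) (Xt i v) + hq *\<^sub>v Rop i (Eop i (Xt (Suc i) (Ginv i v) + hq *\<^sub>v Rop i (Eop i v)))"
    by (simp only: GXG[OF Xt_boxed[OF v']]) (simp only: G_Xt[OF v])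
  also have "\<dots> = Xt (Suc i) (Xt i v) + hq *\<^sub>v Rop i (Xt (Suc i) (Eop i (Gop i v)))"
    using Rop_square(1)[OF Eop_boxed[OF v], of i]
    by (simp add: Eop_lin Rop_lin Xt_lin E_Xt E_Rop E_E Ginv_def vec.scale_right_diff_distrib vec.scale_right_distrib)
  also have "\<dots> = Xt i (Gop i (Xt i (Gop i v)))"
    using Rop_square(2)[of "Eop i (Gop i v)" i] Eop_boxed[OF Gop_boxed[OF v', of i], of i]
    by (simp add: GXG[OF v'] Xt_lin box) (rule Xt_commute)
  finally show ?thesis .
qed

end


section \<open>Roots of unity and characters\<close>

definition zeta :: "nat \<Rightarrow> complex" where
  "zeta r = exp (2 * of_real pi * \<i> / of_nat r)"

lemma zeta_power: "zeta r ^ k = cis (2 * pi * real k / real r)"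
proof -
  have "zeta r = cis (2 * pi / real r)"
    by (simp add: zeta_def cis_conv_exp mult.commute)
  then show ?thesis by (simp add: DeMoivre mult.commute)
qed

lemma zeta_order: "r \<ge> 1 \<Longrightarrow> zeta r ^ r = 1"
  by (simp add: zeta_power)

lemma zeta_power_order: "r \<ge> 1 \<Longrightarrow> (zeta r ^ k) ^ r = 1"
  by (metis power_mult mult.commute zeta_order power_one)

lemma zeta_nonzero [simp]: "zeta r \<noteq> 0"
  by (simp add: zeta_def)

lemma zeta_inj:
  assumes "a < r" "b < r" "zeta r ^ a = zeta r ^ b"
  shows "a = b"
proof -
  have "inj_on (\<lambda>k. cis (2 * pi * real k / real r)) {..<r}"
    using bij_betw_roots_unity[of r] assms(1) by (simp add: bij_betw_def)
  then show ?thesis using assms unfolding zeta_power by (auto dest: inj_onD)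
qed

lemma character_orthogonality:
  assumes "a < r" "b < r"
  shows "(\<Sum>s<r. (zeta r ^ a * inverse (zeta r ^ b)) ^ s) = (if a = b then of_nat r else 0)"
proof (cases "a = b")
  case True
  then show ?thesis by simp
next
  case False
  let ?z = "zeta r ^ a * inverse (zeta r ^ b)"
  have r: "r \<ge> 1" using assms by simp
  have "?z \<noteq> 1"
    using zeta_inj[OF assms] False by (auto simp: field_simps)
  moreover have "?z ^ r = 1"
    by (simp add: power_mult_distrib power_inverse zeta_power_order[OF r])
  ultimately show ?thesis using False by (simp add: sum_gp_strict)
qed

lemma lconst_simps [simp]:
  "lconst 1 = 1" "lconst 0 = 0" "lconst (x * y) = lconst x * lconst y" "lconst (x + y) = lconst x + lconst y"
  by (simp_all add: lconst_def mult_single single_add)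

lemma lconst_sum: "lconst (\<Sum>i\<in>I. g i) = (\<Sum>i\<in>I. lconst (g i))"
  by (induction I rule: infinite_finite_induct) simp_all

lemma lconst_prod: "lconst (\<Prod>i\<in>I. g i) = (\<Prod>i\<in>I. lconst (g i))"
  by (induction I rule: infinite_finite_induct) simp_all

lemma lconst_power: "lconst (x ^ k) = lconst x ^ k"
  by (induction k) simp_all

section \<open>Representations of free algebras\<close>

lemma scalar_mult_eq: "scalar c * p = c *\<^sub>v p"
  by (simp add: scalar_def vscale_def mult_map_scale_conv_mult)

lemma scalar_commute: "scalar (c :: 'c::comm_ring_1) * p = p * scalar c"
proof -
  have l: "vlin (\<lambda>p :: ('g, 'c) ncpoly. scalar c * p)"
    unfolding scalar_mult_eq by (intro vlin_intros)
  have r: "vlin (\<lambda>p :: ('g, 'c) ncpoly. p * scalar c)"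
    by (simp add: vlin_def distrib_right scalar_mult_eq[symmetric] mult.assoc)
  show ?thesis
    by (rule vlin_eqI[OF l r, where S = UNIV]) (auto simp: scalar_def mult_single)
qed

lemma vlin_mult_right: "vlin (\<lambda>p :: ('g, 'c::comm_ring_1) ncpoly. p * q)"
  by (simp add: vlin_def distrib_right scalar_mult_eq[symmetric] mult.assoc)

lemma vlin_mult_left: "vlin (\<lambda>p :: ('g, 'c::comm_ring_1) ncpoly. q * p)"
proof -
  have "q * (scalar c * v) = scalar c * (q * v)" for c :: 'c and v
    by (simp add: mult.assoc[symmetric] scalar_commute[of c q])
  then show ?thesis by (simp add: vlin_def distrib_left scalar_mult_eq)
qed

text \<open>The action of noncommutative polynomials that is determined by operators for the generators.\<close>

definition rho :: "('g \<Rightarrow> ('k \<Rightarrow>\<^sub>0 'c) \<Rightarrow> ('k \<Rightarrow>\<^sub>0 'c)) \<Rightarrow> ('g, 'c::comm_ring_1) ncpoly \<Rightarrow> ('k \<Rightarrow>\<^sub>0 'c) \<Rightarrow> ('k \<Rightarrow>\<^sub>0 'c)" where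
  "rho act p v = lin_ext (\<lambda>u. foldr act (letters u) v) p"

lemma vlin_rho_left: "vlin (\<lambda>p. rho act p v)"
  unfolding rho_def by (rule vlin_lin_ext)

lemmas rho_left = vlin_rules[OF vlin_rho_left]

lemma vlin_foldr: "(\<And>x. vlin (act x)) \<Longrightarrow> vlin (foldr act w)"
  by (induction w) (auto simp: vlin_def)

lemma vlin_rho: assumes "\<And>x. vlin (act x)" shows "vlin (rho act p)"
proof -
  have "vlin (foldr act w)" for w by (rule vlin_foldr) fact
  then show ?thesis unfolding rho_def lin_ext_def by (intro vlin_intros)
qed

lemma rho_one [simp]: "rho act 1 v = v"
proof -
  have "rho act (unit_vec 0) v = v" by (simp add: rho_def zero_fmonoid_def)
  then show ?thesis by (simp only: single_one)
qed

lemma rho_gen [simp]: "rho act (gen x) = act x"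
  by (simp add: rho_def gen_def fun_eq_iff)

lemma rho_mult:
  assumes "\<And>x. vlin (act x)"
  shows "rho act (p * q) v = rho act p (rho act q v)"
proof -
  have unit: "rho act (unit_vec u * unit_vec w) v = rho act (unit_vec u) (rho act (unit_vec w) v)" for u w
    by (simp add: rho_def mult_single plus_fmonoid_def)
  have l: "vlin (\<lambda>q. rho act (p * q) v)" for p
    by (rule vlin_comp[OF vlin_rho_left vlin_mult_left])
  have r: "vlin (\<lambda>q. rho act p (rho act q v))" for p
    by (rule vlin_comp[OF vlin_rho[OF assms] vlin_rho_left])
  have l': "vlin (\<lambda>p. rho act (p * q) v)"
    by (rule vlin_comp[OF vlin_rho_left vlin_mult_right])
  have q: "rho act (unit_vec u * q) v = rho act (unit_vec u) (rho act q v)" for u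
    by (rule vlin_eqI[OF l[of "unit_vec u"] r[of "unit_vec u"], where S = UNIV and v = q]) (simp_all only: unit subset_UNIV)
  show ?thesis
    by (rule vlin_eqI[OF l' vlin_rho_left[of act "rho act q v"], where S = UNIV and v = p]) (simp_all only: q subset_UNIV)
qed

lemma rho_scalar' [simp]: "rho act (scalar c) v = c *\<^sub>v v"
  using rho_left(2)[of act c 1 v] by (simp add: scalar_mult_eq[symmetric])

lemma rho_power: assumes "\<And>x. vlin (act x)" shows "rho act (p ^ k) v = (rho act p ^^ k) v"
  by (induction k) (simp_all add: rho_mult[OF assms])

section \<open>The module of the cyclotomic algebra\<close>

fun word_perm :: "nat list \<Rightarrow> nat perm" where
  "word_perm [] = 1"
| "word_perm (i # u) = word_perm u * swp i"

lemma apply_word_perm: "word_perm u \<langle>$\<rangle> j = perm_of_word u j"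
  by (induction u arbitrary: j) (simp_all add: perm_of_word_def apply_swp)

text \<open>Applied from the right to a sorted word of labels, each letter of an ascending word swaps a pair of
  labels in ascending order, so no correction terms arise.\<close>

fun ascending :: "nat list \<Rightarrow> bool" where
  "ascending [] = True"
| "ascending (i # u) \<longleftrightarrow> ascending u \<and> perm_of_word u i < perm_of_word u (Suc i)"

locale yh_module = truncated +
  fixes r :: nat
  assumes r_pos: "1 \<le> r" and col_less: "col j < r"
begin

definition Dop :: "(nat perm \<Rightarrow> laurent) \<Rightarrow> yvec \<Rightarrow> yvec" where
  "Dop \<chi> = lin_ext (\<lambda>(\<sigma>, a). \<chi> \<sigma> *\<^sub>v bv \<sigma> a)"

lemma vlin_Dop: "vlin (Dop \<chi>)" unfolding Dop_def by (rule vlin_lin_ext)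
lemma vlin_Dop' [vlin_I]: "vlin g \<Longrightarrow> vlin (\<lambda>v. Dop \<chi> (g v))" by (rule vlin_comp[OF vlin_Dop])
lemmas Dop_lin = vlin_rules[OF vlin_Dop]

lemma Dop_bv: "Dop \<chi> (bv \<sigma> a) = \<chi> \<sigma> *\<^sub>v bv \<sigma> a"
  by (simp add: Dop_def)

lemma Dop_pair: "Dop \<chi> (pair i \<sigma> a x y) = \<chi> \<sigma> *\<^sub>v pair i \<sigma> a x y"
  by (simp add: pair_def Dop_bv)

lemma Dop_dem: "Dop \<chi> (dem i \<sigma> a x y) = \<chi> \<sigma> *\<^sub>v dem i \<sigma> a x y"
  by (simp add: dem_def Dop_lin Dop_pair vec.scale_right_diff_distrib vec.scale_sum_right)

lemma Dop_Dop: "Dop \<chi> (Dop \<psi> v) = Dop (\<lambda>\<sigma>. \<chi> \<sigma> * \<psi> \<sigma>) v"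
proof -
  have "\<forall>v. Dop \<chi> (Dop \<psi> v) = Dop (\<lambda>\<sigma>. \<chi> \<sigma> * \<psi> \<sigma>) v"
    by (rule op_eqI) (auto intro!: vlin_I vlin_Dop simp: Dop_bv Dop_lin mult.commute)
  then show ?thesis ..
qed

lemma Dop_one: "Dop (\<lambda>\<sigma>. 1) v = v"
proof -
  have "\<forall>v. Dop (\<lambda>\<sigma>. 1) v = v"
    by (rule op_eqI) (auto intro!: vlin_I vlin_Dop simp: Dop_bv)
  then show ?thesis ..
qed

lemma Dop_sum: "(\<Sum>s\<in>S. Dop (\<chi> s) v) = Dop (\<lambda>\<sigma>. \<Sum>s\<in>S. \<chi> s \<sigma>) v"
proof -
  have "\<forall>v. (\<Sum>s\<in>S. Dop (\<chi> s) v) = Dop (\<lambda>\<sigma>. \<Sum>s\<in>S. \<chi> s \<sigma>) v"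
    by (rule op_eqI) (auto intro!: vlin_I vlin_Dop simp: Dop_bv vec.scale_sum_left)
  then show ?thesis ..
qed

lemma Dop_scale: "c *\<^sub>v Dop \<chi> v = Dop (\<lambda>\<sigma>. c * \<chi> \<sigma>) v"
proof -
  have "\<forall>v. c *\<^sub>v Dop \<chi> v = Dop (\<lambda>\<sigma>. c * \<chi> \<sigma>) v"
    by (rule op_eqI) (auto intro!: vlin_I vlin_Dop simp: Dop_bv)
  then show ?thesis ..
qed

lemma Dop_power: "(Dop \<chi> ^^ k) v = Dop (\<lambda>\<sigma>. \<chi> \<sigma> ^ k) v"
  by (induction k) (simp_all add: Dop_one Dop_Dop)

lemma Dop_Xt: "Dop \<chi> (Xt j v) = Xt j (Dop \<chi> v)"
proof -
  have "\<forall>v. Dop \<chi> (Xt j v) = Xt j (Dop \<chi> v)"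
    by (rule op_eqI)
      (auto intro!: vlin_I vlin_Dop vlin_Xt simp: Xt_bv Dop_lin Xt_lin Dop_bv vec.scale_sum_right mult.commute)
  then show ?thesis ..
qed

lemma Dop_supported: "v \<in> supported S \<Longrightarrow> Dop \<chi> v \<in> supported S"
  by (rule supported_vlin[OF vlin_Dop]) (auto simp: Dop_bv intro!: supported_unit supported_scale)

lemma Eop_Dop: "Eop i = Dop (\<lambda>\<sigma>. if same i \<sigma> then 1 else 0)"
  unfolding Eop_def Dop_def by (rule arg_cong[where f = lin_ext]) auto

definition tchar :: "nat \<Rightarrow> nat perm \<Rightarrow> laurent" where
  "tchar j \<sigma> = lconst (zeta r ^ col (\<sigma> \<langle>$\<rangle> j))"

abbreviation Top :: "nat \<Rightarrow> yvec \<Rightarrow> yvec" where "Top j \<equiv> Dop (tchar j)"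

lemma tchar_order: "tchar j \<sigma> ^ r = 1"
  by (simp add: tchar_def zeta_power_order[OF r_pos] flip: lconst_power)

lemma tchar_swp: "tchar j (\<sigma> * swp i) = tchar (transpose i (Suc i) j) \<sigma>"
  by (simp add: tchar_def apply_swp)

lemma tchar_same: "same i \<sigma> \<Longrightarrow> tchar (transpose i (Suc i) j) \<sigma> = tchar j \<sigma>"
  by (auto simp: tchar_def same_def transpose_def)

lemma G_T: "Gop i (Top j v) = Top (transpose i (Suc i) j) (Gop i v)"
proof -
  have "\<forall>v. Gop i (Top j v) = Top (transpose i (Suc i) j) (Gop i v)"
    by (rule op_eqI)
      (auto intro!: vlin_I simp: Dop_bv Gop_lin Gop_bv Gfun_def Dop_lin Dop_pair Dop_dem tchar_swp
        tchar_same vec.scale_right_distrib mult.commute)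
  then show ?thesis ..
qed

lemma idempotent_sum: "lconst (1 / of_nat r) * (\<Sum>s<r. tchar i \<sigma> ^ s * tchar (Suc i) \<sigma> ^ (r - s)) = (if same i \<sigma> then 1 else 0)"
proof -
  let ?a = "col (\<sigma> \<langle>$\<rangle> i)" and ?b = "col (\<sigma> \<langle>$\<rangle> (Suc i))"
  have "(zeta r ^ ?a) ^ s * (zeta r ^ ?b) ^ (r - s) = (zeta r ^ ?a * inverse (zeta r ^ ?b)) ^ s" if "s < r" for s
  proof -
    have "(zeta r ^ ?b) ^ r = 1"
      by (rule zeta_power_order[OF r_pos])
    then have "(zeta r ^ ?b) ^ (r - s) = inverse ((zeta r ^ ?b) ^ s)"
      using that by (simp add: power_diff inverse_eq_divide)
    then show ?thesis by (simp add: power_mult_distrib power_inverse)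
  qed
  then have "(\<Sum>s<r. (zeta r ^ ?a) ^ s * (zeta r ^ ?b) ^ (r - s)) = (if ?a = ?b then of_nat r else 0)"
    using character_orthogonality[OF col_less col_less] by simp
  then have "1 / of_nat r * (\<Sum>s<r. (zeta r ^ ?a) ^ s * (zeta r ^ ?b) ^ (r - s)) = (if ?a = ?b then 1 else 0)"
    using r_pos by simp
  then have "lconst (1 / of_nat r * (\<Sum>s<r. (zeta r ^ ?a) ^ s * (zeta r ^ ?b) ^ (r - s))) = (if ?a = ?b then 1 else 0)"
    by simp
  then show ?thesis
    by (simp only: lconst_simps lconst_sum lconst_power tchar_def same_def)
qed

text \<open>The inverse of \<open>X\<^sub>1\<close> exists because the constant coefficient of \<open>f\<close> is invertible.\<close>

definition Xinv :: "yvec \<Rightarrow> yvec" where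
  "Xinv v = - f0inv *\<^sub>v (\<Sum>m<d. f (Suc m) *\<^sub>v (Xt 1 ^^ m) v)"

lemma vlin_funpow: "vlin (g :: yvec \<Rightarrow> yvec) \<Longrightarrow> vlin (g ^^ k)"
  by (induction k) (auto simp: vlin_def)

lemma vlin_Xinv: "vlin Xinv"
  unfolding Xinv_def by (intro vlin_intros vlin_funpow vlin_Xt)

lemma Xt_power_bv: "k < d \<Longrightarrow> (Xt j ^^ k) (bv \<sigma> (a(j := 0))) = bv \<sigma> (a(j := k))"
  by (induction k) (simp_all add: Xt_bv)

text \<open>The truncated \<open>X\<^sub>j\<close> is a root of \<open>f\<close> by construction on the vectors with \<open>a j = 0\<close>, and its powers carry
  these to all others.\<close>

lemma Xt_annihilated:
  assumes v: "v \<in> supported (boxed I d)" and j: "j \<in> I"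
  shows "(\<Sum>m\<le>d. f m *\<^sub>v (Xt j ^^ m) v) = 0"
proof (rule vlin_eq_on_supported[OF v])
  show "vlin (\<lambda>v. \<Sum>m\<le>d. f m *\<^sub>v (Xt j ^^ m) v)"
    by (intro vlin_intros vlin_funpow vlin_Xt)
next
  fix k assume "k \<in> boxed I d"
  then obtain \<sigma> a where k: "k = (\<sigma>, a)" and a: "a j < d" using j by (auto simp: boxed_def)
  let ?v = "bv \<sigma> (a(j := 0))"
  have "(Xt j ^^ d) ?v = Xt j ((Xt j ^^ (d - 1)) ?v)"
    using d_pos by (cases d) simp_all
  also have "\<dots> = - (\<Sum>m<d. f m *\<^sub>v bv \<sigma> (a(j := m)))"
    using d_pos Xt_power_bv[of "d - 1" j \<sigma> a] by (simp add: Xt_bv)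
  finally have "(\<Sum>m\<le>d. f m *\<^sub>v (Xt j ^^ m) ?v) = 0"
    by (simp add: lessThan_Suc_atMost[symmetric] Xt_power_bv f_monic)
  then have "(Xt j ^^ a j) (\<Sum>m\<le>d. f m *\<^sub>v (Xt j ^^ m) ?v) = 0"
    by (simp add: vlin_zero[OF vlin_funpow[OF vlin_Xt]])
  moreover have "(Xt j ^^ a j) ((Xt j ^^ m) ?v) = (Xt j ^^ m) (bv \<sigma> a)" for m
    using fun_cong[OF funpow_add[of "a j" m "Xt j"], of ?v] fun_cong[OF funpow_add[of m "a j" "Xt j"], of ?v]
      Xt_power_bv[OF a, of j \<sigma> a] by (simp add: add.commute)
  ultimately show "(\<Sum>m\<le>d. f m *\<^sub>v (Xt j ^^ m) (unit_vec k)) = 0"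
    by (simp add: k vlin_sum[OF vlin_funpow[OF vlin_Xt]] vlin_scale[OF vlin_funpow[OF vlin_Xt]])
qed (auto intro: vlin_intros)

lemma Xinv_Xt:
  assumes v: "v \<in> supported (boxed I d)" and j: "1 \<in> I"
  shows "Xinv (Xt 1 v) = v" "Xt 1 (Xinv v) = v"
proof -
  have shift: "(\<Sum>m<d. f (Suc m) *\<^sub>v (Xt 1 ^^ Suc m) v) = - f 0 *\<^sub>v v"
  proof -
    have "(\<Sum>m\<le>d. f m *\<^sub>v (Xt 1 ^^ m) v) = f 0 *\<^sub>v v + (\<Sum>m<d. f (Suc m) *\<^sub>v (Xt 1 ^^ Suc m) v)"
      by (simp only: lessThan_Suc_atMost[symmetric] sum.lessThan_Suc_shift funpow_0)
    then show ?thesis using Xt_annihilated[OF v j] by (simp add: eq_neg_iff_add_eq_0 add.commute del: funpow.simps)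
  qed
  then show "Xinv (Xt 1 v) = v"
    using f0inv by (simp add: Xinv_def funpow_swap1)
  show "Xt 1 (Xinv v) = v"
    using shift f0inv by (simp add: Xinv_def Xt_lin)
qed

lemma funpow_supported:
  "(\<And>v. v \<in> S \<Longrightarrow> g v \<in> S) \<Longrightarrow> v \<in> S \<Longrightarrow> (g ^^ k) v \<in> S"
  by (induction k) auto

lemma Xinv_boxed: "v \<in> supported (boxed I d) \<Longrightarrow> Xinv v \<in> supported (boxed I d)"
  unfolding Xinv_def
  by (intro supported_scale supported_sum funpow_supported[where g = "Xt 1"] Xt_boxed)

fun act :: "yh_gen \<Rightarrow> yvec \<Rightarrow> yvec" where
  "act (T j) = Top j"
| "act (G i) = Gop i"
| "act X1 = Xt 1"
| "act X1_inv = Xinv"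

lemma vlin_act: "vlin (act x)"
  by (cases x) (simp_all add: vlin_Dop vlin_Gop vlin_Xt vlin_Xinv)

abbreviation R :: "yh_free \<Rightarrow> yvec \<Rightarrow> yvec" where "R \<equiv> rho act"

lemmas R_mult = rho_mult[of act, OF vlin_act]
lemmas R_power = rho_power[of act, OF vlin_act]
lemmas R_lin = vlin_rules[OF vlin_rho[of act, OF vlin_act]]
lemmas R_left = rho_left[of act]

definition valid :: "nat \<Rightarrow> yvec set" where
  "valid n = supported (boxed {1..n} d)"

lemma act_valid:
  assumes "x \<in> yh_gens n" "v \<in> valid n"
  shows "act x v \<in> valid n"
  using assms unfolding valid_def yh_gens_def
  by (auto intro!: Dop_supported Gop_boxed Xt_boxed Xinv_boxed)

lemma R_valid:
  assumes "\<And>u. u \<in> Poly_Mapping.keys p \<Longrightarrow> set (letters u) \<subseteq> yh_gens n" "v \<in> valid n"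
  shows "R p v \<in> valid n"
proof -
  have "foldr act w v \<in> valid n" if "set w \<subseteq> yh_gens n" for w
    using that by (induction w) (auto intro: act_valid simp: assms)
  then show ?thesis
    unfolding rho_def lin_ext_def valid_def
    by (intro supported_sum supported_scale) (use assms(1) in auto)
qed

text \<open>On a word the sum defining \<open>e\<^sub>i\<close> is a sum over the \<open>r\<close>-th roots of unity.\<close>

lemma R_ee: "R (ee r i) v = Eop i v"
proof -
  have "R (ee r i) v = lconst (1 / of_nat r) *\<^sub>v (\<Sum>s<r. Dop (\<lambda>\<sigma>. tchar i \<sigma> ^ s * tchar (Suc i) \<sigma> ^ (r - s)) v)"
    by (simp add: ee_def R_mult R_power R_left Dop_power Dop_Dop)
  also have "\<dots> = Eop i v"
    by (simp only: Dop_sum Dop_scale idempotent_sum Eop_Dop)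
  finally show ?thesis .
qed

lemma R_relation:
  assumes "(p, q) \<in> yh_rel r n" and n: "1 \<le> n" and v: "v \<in> valid n"
  shows "R p v = R q v"
  using assms(1)
proof cases
  case (g_comm i j)
  then show ?thesis using G_commute[of i j v] by (simp add: R_mult)
next
  case (g_braid i)
  then show ?thesis by (simp add: R_mult G_braid)
next
  case (t_comm i j)
  then show ?thesis by (simp add: R_mult Dop_Dop mult.commute)
next
  case (g_t i j)
  then show ?thesis by (simp add: R_mult G_T)
next
  case (t_order j)
  then show ?thesis by (simp add: R_power Dop_power tchar_order Dop_one)
next
  case (g_quadratic i)
  then show ?thesis
    by (simp add: R_mult R_left power2_eq_square R_ee G_quadratic flip: hq_def)
next
  case X_inv_right
  then show ?thesis using Xinv_Xt[of v "{1..n}"] v n by (simp add: R_mult valid_def)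
next
  case X_inv_left
  then show ?thesis using Xinv_Xt[of v "{1..n}"] v n by (simp add: R_mult valid_def)
next
  case g_X_braid
  have "v \<in> supported {(\<sigma>, a). a 1 < d \<and> a (Suc 1) < d}"
    using v g_X_braid by (force simp: valid_def boxed_def supported_def)
  then show ?thesis using g_X_braid Xt_braid[of v 1] by (simp add: R_mult)
next
  case (g_X_comm i)
  then show ?thesis by (simp add: R_mult G_Xt_far)
next
  case (t_X_comm j)
  then show ?thesis by (simp add: R_mult Dop_Xt)
qed

subsection \<open>Values of the standard monomials\<close>

text \<open>If the exponents at the positions up to \<open>i\<close> stay below \<open>d - 1\<close>, truncation is not felt, and
  \<open>g\<^sub>i\<^sub>-\<^sub>1 \<cdots> g\<^sub>1 X\<^sub>1 g\<^sub>1 \<cdots> g\<^sub>i\<^sub>-\<^sub>1\<close> acts as the variable \<open>X\<^sub>i\<close>.\<close>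

lemma R_XX:
  assumes "v \<in> supported (boxed {1..i} (d - 1))" "1 \<le> i"
  shows "R (XX i) v = Xop i v"
  using assms
proof (induction i arbitrary: v rule: XX.induct)
  case 2
  then have "v \<in> supported {(\<sigma>, a). Suc (a 1) < d}"
    by (force simp: boxed_def supported_def)
  then show ?case by (simp add: Xt_low)
next
  case (3 i)
  have "Gop (Suc i) v \<in> supported (boxed {1..Suc (Suc i)} (d - 1))"
    by (rule Gop_boxed) (use 3 in auto)
  then have "Gop (Suc i) v \<in> supported (boxed {1..Suc i} (d - 1))"
    by (force simp: boxed_def supported_def)
  from 3(1)[OF this] show ?case by (simp add: R_mult G_X_G)
qed simp

lemma R_XX_power:
  assumes "\<And>j. 1 \<le> j \<Longrightarrow> j \<le> i \<Longrightarrow> a j = 0" "1 \<le> i" "m < d"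
  shows "R (XX i ^ m) (bv \<sigma> a) = bv \<sigma> (a(i := m))"
  using assms(3)
proof (induction m)
  case 0
  then show ?case using assms by (simp add: fun_upd_idem)
next
  case (Suc m)
  have "bv \<sigma> (a(i := m)) \<in> supported (boxed {1..i} (d - 1))"
    by (rule bv_boxed) (use Suc assms in auto)
  from R_XX[OF this assms(2)] have "R (XX i) (bv \<sigma> (a(i := m))) = bv \<sigma> (a(i := Suc m))"
    by (simp only: Xop_bv fun_upd_same fun_upd_upd)
  then show ?case using Suc by (simp add: R_mult del: fun_upd_apply)
qed

lemma R_X_mon:
  assumes "\<And>j. 1 \<le> j \<Longrightarrow> j \<le> n \<Longrightarrow> \<alpha> j < d"
  shows "R (X_mon n \<alpha>) (bv \<sigma> (\<lambda>_. 0)) = bv \<sigma> (\<lambda>j. if 1 \<le> j \<and> j \<le> n then \<alpha> j else 0)"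
proof -
  \<comment> \<open>The factors act from the right, so the exponents at lower positions are still zero.\<close>
  have "R (prod_list (map (\<lambda>i. XX i ^ \<alpha> i) [k..<n + 1])) (bv \<sigma> (\<lambda>_. 0))
     = bv \<sigma> (\<lambda>j. if k \<le> j \<and> j \<le> n then \<alpha> j else 0)" if "k \<le> n + 1" "1 \<le> k" for k
    using that
  proof (induction k rule: inc_induct)
    case base
    have "(\<lambda>j. if n + 1 \<le> j \<and> j \<le> n then \<alpha> j else 0) = (\<lambda>_. 0)" by auto
    then show ?case by simp
  next
    case (step k)
    have "[k..<n + 1] = k # [Suc k..<n + 1]" using step by (simp add: upt_conv_Cons)
    moreover have "(\<lambda>j. if Suc k \<le> j \<and> j \<le> n then \<alpha> j else 0)(k := \<alpha> k) = (\<lambda>j. if k \<le> j \<and> j \<le> n then \<alpha> j else 0)"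
      using step by (auto simp: fun_eq_iff)
    ultimately show ?case
      using step assms[of k] by (simp add: R_mult R_XX_power del: upt_Suc)
  qed
  from this[of 1] show ?thesis by (simp add: X_mon_def)
qed

lemma R_t_mon:
  "R (t_mon n \<beta>) (bv \<sigma> a) = (\<Prod>j=1..n. tchar j \<sigma> ^ \<beta> j) *\<^sub>v bv \<sigma> a"
proof -
  have "R (prod_list (map (\<lambda>j. tt j ^ \<beta> j) l)) (bv \<sigma> a) = (\<Prod>j\<leftarrow>l. tchar j \<sigma> ^ \<beta> j) *\<^sub>v bv \<sigma> a" for l
    by (induction l) (simp_all add: R_mult R_lin R_power Dop_power Dop_bv mult.commute)
  from this[of "[1..<n + 1]"] show ?thesis
    unfolding t_mon_def by (simp add: prod.distinct_set_conv_list[symmetric] atLeastLessThanSuc_atLeastAtMost del: upt_Suc)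
qed

lemma R_word:
  assumes "ascending u"
  shows "R (prod_list (map gg u)) (bv 1 (\<lambda>_. 0)) = bv (word_perm u) (\<lambda>_. 0)"
  using assms
  by (induction u) (simp_all add: R_mult Gop_bv_zero flip: apply_word_perm)

lemma R_standard:
  assumes "\<And>j. 1 \<le> j \<Longrightarrow> j \<le> n \<Longrightarrow> \<alpha> j < d" "ascending u"
  shows "R (X_mon n \<alpha> * t_mon n \<beta> * prod_list (map gg u)) (bv 1 (\<lambda>_. 0))
    = (\<Prod>j=1..n. tchar j (word_perm u) ^ \<beta> j) *\<^sub>v bv (word_perm u) (\<lambda>j. if 1 \<le> j \<and> j \<le> n then \<alpha> j else 0)"
  by (simp add: R_mult R_word[OF assms(2)] R_t_mon R_lin R_X_mon assms(1))

end

subsection \<open>Linear independence of the standard monomials\<close>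

lemma character_sum_PiE:
  assumes \<beta>: "\<beta> \<in> {1..n} \<rightarrow>\<^sub>E {..<r}" and \<gamma>: "\<gamma> \<in> {1..n} \<rightarrow>\<^sub>E {..<r}"
  shows "(\<Sum>c\<in>{1..n} \<rightarrow>\<^sub>E {..<r}. \<Prod>j=1..n. (zeta r ^ \<beta> j * inverse (zeta r ^ \<gamma> j)) ^ c j)
    = (if \<beta> = \<gamma> then of_nat r ^ n else 0)"
proof -
  have "(\<Sum>c\<in>{1..n} \<rightarrow>\<^sub>E {..<r}. \<Prod>j=1..n. (zeta r ^ \<beta> j * inverse (zeta r ^ \<gamma> j)) ^ c j)
    = (\<Prod>j=1..n. \<Sum>s<r. (zeta r ^ \<beta> j * inverse (zeta r ^ \<gamma> j)) ^ s)"
    by (rule prod_sum_PiE[symmetric]) auto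
  also have "\<dots> = (\<Prod>j=1..n. if \<beta> j = \<gamma> j then of_nat r else 0)"
    using \<beta> \<gamma> by (intro prod.cong character_orthogonality) (auto simp: PiE_iff)
  also have "\<dots> = (if \<beta> = \<gamma> then of_nat r ^ n else 0)"
  proof (cases "\<beta> = \<gamma>")
    case False
    then obtain j where "j \<in> {1..n}" "\<beta> j \<noteq> \<gamma> j"
      using PiE_ext[OF \<beta> \<gamma>] by blast
    then show ?thesis using False by (intro trans[OF prod_zero]) auto
  qed simp
  finally show ?thesis .
qed

text \<open>Fourier inversion on the group of residue vectors modulo \<open>r\<close>.\<close>

lemma characters_independent:
  fixes C :: "(nat \<Rightarrow> nat) \<Rightarrow> laurent"
  assumes r: "1 \<le> r"
    and zero: "\<And>c. c \<in> {1..n} \<rightarrow>\<^sub>E {..<r} \<Longrightarrow>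
      (\<Sum>\<beta>\<in>{1..n} \<rightarrow>\<^sub>E {..<r}. C \<beta> * lconst (\<Prod>j=1..n. (zeta r ^ \<beta> j) ^ c j)) = 0"
    and \<gamma>: "\<gamma> \<in> {1..n} \<rightarrow>\<^sub>E {..<r}"
  shows "C \<gamma> = 0"
proof -
  let ?I = "{1..n} \<rightarrow>\<^sub>E {..<r}"
  have fin: "finite ?I" by (intro finite_PiE) auto
  have "0 = (\<Sum>c\<in>?I. (\<Sum>\<beta>\<in>?I. C \<beta> * lconst (\<Prod>j=1..n. (zeta r ^ \<beta> j) ^ c j)) * lconst (\<Prod>j=1..n. inverse (zeta r ^ \<gamma> j) ^ c j))"
    by (intro sum.neutral[symmetric] ballI) (simp only: zero mult_zero_left)
  also have "\<dots> = (\<Sum>c\<in>?I. \<Sum>\<beta>\<in>?I. C \<beta> * lconst (\<Prod>j=1..n. (zeta r ^ \<beta> j * inverse (zeta r ^ \<gamma> j)) ^ c j))"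
    by (simp only: sum_distrib_right mult.assoc lconst_simps(3)[symmetric] prod.distrib[symmetric] power_mult_distrib)
  also have "\<dots> = (\<Sum>\<beta>\<in>?I. C \<beta> * lconst (\<Sum>c\<in>?I. \<Prod>j=1..n. (zeta r ^ \<beta> j * inverse (zeta r ^ \<gamma> j)) ^ c j))"
    by (subst sum.swap) (simp only: sum_distrib_left lconst_sum)
  also have "\<dots> = (\<Sum>\<beta>\<in>?I. if \<beta> = \<gamma> then C \<beta> * lconst (of_nat r ^ n) else 0)"
    by (intro sum.cong refl) (simp only: character_sum_PiE[OF _ \<gamma>] if_distrib[of lconst] if_distrib[of "(*) _"] lconst_simps(2) mult_zero_right cong: if_cong)
  also have "\<dots> = C \<gamma> * lconst (of_nat r ^ n)"
    using fin \<gamma> by simp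
  finally have "C \<gamma> * lconst (of_nat r ^ n) * lconst (1 / of_nat r ^ n) = 0" by simp
  then have "C \<gamma> * lconst (of_nat r ^ n * (1 / of_nat r ^ n)) = 0"
    by (simp only: mult.assoc lconst_simps(3))
  then show ?thesis using r by simp
qed


section \<open>Words in the adjacent transpositions\<close>

lemma perm_of_word_simps [simp]:
  "perm_of_word [] = id"
  "perm_of_word (i # u) = perm_of_word u \<circ> transpose i (Suc i)"
  by (simp_all add: perm_of_word_def)

lemma perm_of_word_append: "perm_of_word (u @ w) = perm_of_word w \<circ> perm_of_word u"
  by (simp add: perm_of_word_def)

lemma perm_of_word_permutes:
  "set u \<subseteq> {1..<n} \<Longrightarrow> perm_of_word u permutes {1..n}"
proof (induction u)
  case (Cons i u)
  then have "transpose i (Suc i) permutes {1..n}" by (intro permutes_swap_id) auto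
  then show ?case using Cons unfolding perm_of_word_simps by (intro permutes_compose) auto
qed (simp add: permutes_id)

definition inversions :: "nat \<Rightarrow> (nat \<Rightarrow> nat) \<Rightarrow> (nat \<times> nat) set" where
  "inversions n w = {(x, y). 1 \<le> x \<and> x < y \<and> y \<le> n \<and> w y < w x}"

lemma finite_inversions: "finite (inversions n w)"
  by (rule finite_subset[of _ "{1..n} \<times> {1..n}"]) (auto simp: inversions_def)

text \<open>Apart from the pair \<open>(i, i + 1)\<close> itself, the transposition permutes the pairs of positions in order.\<close>

lemma inversions_ascent:
  assumes i: "i \<in> {1..<n}" and asc: "w i < w (Suc i)"
  shows "card (inversions n (w \<circ> transpose i (Suc i))) = Suc (card (inversions n w))"
proof -
  let ?s = "transpose i (Suc i)"
  let ?I = "inversions n w" and ?J = "inversions n (w \<circ> ?s)"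
  have ss: "?s (?s x) = x" for x by simp
  have less: "?s x < ?s y" if "x < y" "(x, y) \<noteq> (i, Suc i)" for x y
    using that by (auto simp: transpose_def)
  have range: "1 \<le> ?s x" "?s x \<le> n" if "1 \<le> x" "x \<le> n" for x
    using that i by (auto simp: transpose_def)
  have noI: "(i, Suc i) \<notin> ?I" using asc by (auto simp: inversions_def)
  have inJ: "(i, Suc i) \<in> ?J" using asc i by (auto simp: inversions_def)
  have "bij_betw (map_prod ?s ?s) ?I (?J - {(i, Suc i)})"
  proof (rule bij_betwI[where g = "map_prod ?s ?s"])
    show "map_prod ?s ?s \<in> ?I \<rightarrow> ?J - {(i, Suc i)}"
    proof safe
      fix x y assume xy: "(x, y) \<in> ?I"
      then have "(x, y) \<noteq> (i, Suc i)" using noI by auto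
      with xy less range show "map_prod ?s ?s (x, y) \<in> ?J" by (auto simp: inversions_def)
      assume "map_prod ?s ?s (x, y) = (i, Suc i)"
      then have sx: "?s x = i" and sy: "?s y = Suc i" by simp_all
      have "x = Suc i" using ss[of x] unfolding sx by simp
      moreover have "y = i" using ss[of y] unfolding sy by simp
      ultimately have "x = Suc i" "y = i" by simp_all
      with xy show False by (auto simp: inversions_def)
    qed
    show "map_prod ?s ?s \<in> ?J - {(i, Suc i)} \<rightarrow> ?I"
      using less range by (auto simp: inversions_def)
  qed (auto simp: ss)
  then have "card ?I = card (?J - {(i, Suc i)})" by (rule bij_betw_same_card)
  then show ?thesis using inJ finite_inversions[of n "w \<circ> ?s"]
    by (metis card_Suc_Diff1)
qed

text \<open>Each letter changes the number of inversions by one, so a word is at least as long as the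
  number of inversions of its permutation, with equality exactly for ascending words.\<close>

lemma inversions_word:
  assumes "set u \<subseteq> {1..<n}"
  shows "card (inversions n (perm_of_word u)) \<le> length u \<and>
    (card (inversions n (perm_of_word u)) = length u \<longleftrightarrow> ascending u)"
  using assms
proof (induction u)
  case Nil
  have "inversions n id = {}" by (auto simp: inversions_def)
  then have none: "card (inversions n (perm_of_word [])) = 0"
    unfolding perm_of_word_simps by (simp only: card.empty)
  show ?case unfolding none by simp
next
  case (Cons i u)
  let ?w = "perm_of_word u" and ?s = "transpose i (Suc i)"
  from Cons.prems have i: "i \<in> {1..<n}" and u: "set u \<subseteq> {1..<n}" by auto
  note IH = Cons.IH[OF u]
  have "inj ?w" using perm_of_word_permutes[OF u] by (rule permutes_inj)
  then have neq: "?w i \<noteq> ?w (Suc i)" using inj_eq[of ?w i "Suc i"] by simp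
  have w: "perm_of_word (i # u) = ?w \<circ> ?s" by (rule perm_of_word_simps)
  define c c' where "c = card (inversions n ?w)" and "c' = card (inversions n (?w \<circ> ?s))"
  have IH': "c \<le> length u" "c = length u \<longleftrightarrow> ascending u" using IH unfolding c_def by blast+
  have "c' \<le> Suc (length u) \<and> (c' = Suc (length u) \<longleftrightarrow> ascending u \<and> ?w i < ?w (Suc i))"
  proof (cases "?w i < ?w (Suc i)")
    case True
    have "c' = Suc c" unfolding c_def c'_def by (rule inversions_ascent[OF i True])
    then show ?thesis using IH' True by auto
  next
    case False
    have ss: "?w \<circ> ?s \<circ> ?s = ?w" by (simp only: comp_assoc transpose_comp_involutory comp_id)
    have "(?w \<circ> ?s) i < (?w \<circ> ?s) (Suc i)" using False neq by simp
    from inversions_ascent[OF i this] have "c = Suc c'" unfolding c_def c'_def ss .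
    then show ?thesis using IH' False by auto
  qed
  then show ?case unfolding c'_def w by (simp only: list.size ascending.simps add_Suc_right add_0_right)
qed

text \<open>Normal forms: a permutation is determined by the position of \<open>n\<close> and the permutation of
  \<open>{1..n - 1}\<close> that remains when \<open>n\<close> has been moved to the end.\<close>

fun normal_words :: "nat \<Rightarrow> nat list set" where
  "normal_words 0 = {[]}"
| "normal_words (Suc m) = {[j..<Suc m] @ u | j u. j \<in> {1..Suc m} \<and> u \<in> normal_words m}"

lemma normal_words_letters: "u \<in> normal_words m \<Longrightarrow> set u \<subseteq> {1..<m}"
  by (induction m arbitrary: u) fastforce+

lemma perm_of_block:
  assumes "j \<le> m"
  shows "perm_of_word [j..<m] j = m"
    and "i < j \<Longrightarrow> perm_of_word [j..<m] i = i"
  using assms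
proof (induction j rule: inc_induct)
  case (step k)
  have "[k..<m] = k # [Suc k..<m]" using step by (simp add: upt_conv_Cons)
  with step show "perm_of_word [k..<m] k = m" "i < k \<Longrightarrow> perm_of_word [k..<m] i = i" by auto
qed auto

text \<open>Behind each letter of the block, the largest label already stands at the position to its right.\<close>

lemma normal_words_ascending: "u \<in> normal_words m \<Longrightarrow> ascending u"
proof (induction m arbitrary: u)
  case (Suc m)
  then obtain j w where u: "u = [j..<Suc m] @ w" and j: "j \<in> {1..Suc m}" and w: "w \<in> normal_words m" by auto
  have perm: "perm_of_word w permutes {1..m}" by (rule perm_of_word_permutes[OF normal_words_letters[OF w]])
  have "ascending ([k..<Suc m] @ w)" if "k \<le> Suc m" "1 \<le> k" for k
    using that
  proof (induction k rule: inc_induct)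
    case base then show ?case using Suc.IH[OF w] by simp
  next
    case (step k)
    have "perm_of_word ([Suc k..<Suc m] @ w) k = perm_of_word w k"
      using step by (simp add: perm_of_word_append perm_of_block del: upt_Suc)
    moreover have "perm_of_word ([Suc k..<Suc m] @ w) (Suc k) = Suc m"
      using step permutes_not_in[OF perm, of "Suc m"] by (simp add: perm_of_word_append perm_of_block del: upt_Suc)
    moreover have "perm_of_word w k \<le> m" using permutes_in_image[OF perm, of k] step by auto
    ultimately show ?case using step by (simp add: upt_conv_Cons del: upt_Suc)
  qed
  then show ?case using j u by simp
qed simp

lemma normal_words_inj: "inj_on perm_of_word (normal_words m)"
proof (induction m)
  case (Suc m)
  show ?case
  proof (rule inj_onI)
    fix u u' assume "u \<in> normal_words (Suc m)" "u' \<in> normal_words (Suc m)"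
      and eq: "perm_of_word u = perm_of_word u'"
    then obtain j w j' w' where
      u: "u = [j..<Suc m] @ w" "j \<in> {1..Suc m}" "w \<in> normal_words m" and
      u': "u' = [j'..<Suc m] @ w'" "j' \<in> {1..Suc m}" "w' \<in> normal_words m" by auto
    have last: "perm_of_word ([k..<Suc m] @ v) k = Suc m" if "k \<in> {1..Suc m}" "v \<in> normal_words m" for k v
      using that permutes_not_in[OF perm_of_word_permutes[OF normal_words_letters[OF that(2)]], of "Suc m"]
      by (simp add: perm_of_word_append perm_of_block del: upt_Suc)
    have perm: "perm_of_word [k..<Suc m] permutes {1..Suc m}" if "k \<in> {1..Suc m}" for k
      using that by (intro perm_of_word_permutes) auto
    have "perm_of_word u permutes {1..Suc m}"
      using \<open>u \<in> normal_words (Suc m)\<close> by (intro perm_of_word_permutes normal_words_letters)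
    from permutes_inj[OF this] have j: "j = j'"
      using last[OF u(2,3)] last[OF u'(2,3)] eq u(1) u'(1) by (metis injD)
    have "surj (perm_of_word [j..<Suc m])" by (rule permutes_surj[OF perm[OF u(2)]])
    moreover have "perm_of_word w \<circ> perm_of_word [j..<Suc m] = perm_of_word w' \<circ> perm_of_word [j..<Suc m]"
      using eq unfolding u(1) u'(1) j by (simp add: perm_of_word_append)
    ultimately have "perm_of_word w = perm_of_word w'" by (metis surj_fun_eq surjD fun_eq_iff comp_apply)
    with Suc.IH u u' show "u = u'" by (auto simp: j dest: inj_onD)
  qed
qed simp

lemma normal_words_surj:
  assumes "w permutes {1..m}"
  shows "\<exists>u\<in>normal_words m. perm_of_word u = w"
  using assms
proof (induction m arbitrary: w)
  case 0
  then show ?case by (auto simp: permutes_empty)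
next
  case (Suc m)
  obtain j where j: "w j = Suc m" using permutes_surj[OF Suc.prems] by (metis surjD)
  then have jm: "j \<in> {1..Suc m}" using permutes_in_image[OF Suc.prems, of j] by simp
  let ?b = "perm_of_word [j..<Suc m]"
  let ?c = "inv_into UNIV ?b"
  have b: "?b permutes {1..Suc m}" using jm by (intro perm_of_word_permutes) auto
  have inv: "?c \<circ> ?b = id" "?b \<circ> ?c = id"
    using permutes_inv_o[OF b] by auto
  let ?w = "w \<circ> ?c"
  have perm: "?w permutes {1..Suc m}" by (intro permutes_compose permutes_inv b Suc.prems)
  have "?b j = Suc m" using jm by (intro perm_of_block) auto
  then have fixed: "?w (Suc m) = Suc m" using j fun_cong[OF inv(1), of j] by simp
  have "?w permutes {1..m}"
    using fixed by (intro permutes_superset[OF perm]) (auto simp: le_Suc_eq)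
  from Suc.IH[OF this] obtain u where u: "u \<in> normal_words m" "perm_of_word u = ?w" by blast
  have "perm_of_word ([j..<Suc m] @ u) = w \<circ> (?c \<circ> ?b)"
    by (simp only: perm_of_word_append u(2) comp_assoc)
  with inv u(1) jm show ?case by (intro bexI[of _ "[j..<Suc m] @ u"]) auto
qed

lemma reduced_expression_exists:
  assumes "w permutes {1..n}"
  shows "\<exists>u. reduced_expression n u w"
proof -
  let ?P = "\<lambda>u. set u \<subseteq> {1..<n} \<and> perm_of_word u = w"
  obtain u where "?P u" using normal_words_surj[OF assms] normal_words_letters by blast
  then obtain v where "?P v" "\<And>u. ?P u \<Longrightarrow> length v \<le> length u"
    using ex_has_least_nat[of ?P u length] by blast
  then show ?thesis unfolding reduced_expression_def by blast
qed

text \<open>A normal word is ascending, so the minimal length of a word for \<open>w\<close> is the number of inversions.\<close>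

lemma reduced_expression_ascending:
  assumes "reduced_expression n u w"
  shows "ascending u"
proof -
  have u: "set u \<subseteq> {1..<n}" "perm_of_word u = w"
    and min: "\<And>v. set v \<subseteq> {1..<n} \<Longrightarrow> perm_of_word v = w \<Longrightarrow> length u \<le> length v"
    using assms by (auto simp: reduced_expression_def)
  have "w permutes {1..n}" using perm_of_word_permutes[OF u(1)] u(2) by simp
  then obtain v where v: "v \<in> normal_words n" "perm_of_word v = w"
    using normal_words_surj by blast
  have "card (inversions n w) = length v"
    using inversions_word[OF normal_words_letters[OF v(1)]] normal_words_ascending[OF v(1)] v(2) by simp
  with min[OF normal_words_letters[OF v(1)] v(2)] inversions_word[OF u(1)] u(2)
  have "card (inversions n (perm_of_word u)) = length u" by simp
  then show ?thesis using inversions_word[OF u(1)] by simp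
qed


section \<open>Left multiplication on standard monomials\<close>

text \<open>A ring with a set \<open>K\<close> of coefficients acting through central elements, and the \<open>K\<close>-submodules
  spanned by its subsets.\<close>

locale scalar_ring = ring S for S (structure) +
  fixes K :: "'c::comm_ring_1 set" and sc :: "'c \<Rightarrow> 'a"
  assumes K_one: "1 \<in> K" and K_mult: "\<And>a b. a \<in> K \<Longrightarrow> b \<in> K \<Longrightarrow> a * b \<in> K"
    and sc_closed [simp]: "\<And>a. a \<in> K \<Longrightarrow> sc a \<in> carrier S"
    and sc_one: "sc 1 = \<one>" and K_minus: "- 1 \<in> K" and sc_minus: "sc (- 1) = \<ominus> \<one>"
    and sc_mult: "\<And>a b. a \<in> K \<Longrightarrow> b \<in> K \<Longrightarrow> sc (a * b) = sc a \<otimes> sc b"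
    and sc_central: "\<And>a y. a \<in> K \<Longrightarrow> y \<in> carrier S \<Longrightarrow> y \<otimes> sc a = sc a \<otimes> y"
begin

inductive_set rspan :: "'a set \<Rightarrow> 'a set" for W where
  zero: "\<zero> \<in> rspan W"
| step: "c \<in> K \<Longrightarrow> w \<in> W \<Longrightarrow> v \<in> rspan W \<Longrightarrow> sc c \<otimes> w \<oplus> v \<in> rspan W"

lemma rspan_carrier: "W \<subseteq> carrier S \<Longrightarrow> v \<in> rspan W \<Longrightarrow> v \<in> carrier S"
  by (erule rspan.induct) auto

lemma rspan_multiple:
  assumes "W \<subseteq> carrier S" "c \<in> K" "w \<in> W"
  shows "sc c \<otimes> w \<in> rspan W"
proof -
  have "sc c \<otimes> w \<oplus> \<zero> \<in> rspan W" by (intro rspan.intros assms)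
  then show ?thesis using assms by (simp add: subsetD)
qed

lemma rspan_base: "W \<subseteq> carrier S \<Longrightarrow> w \<in> W \<Longrightarrow> w \<in> rspan W"
  using rspan_multiple[OF _ K_one, of W w] by (simp add: sc_one subsetD)

lemma rspan_add:
  assumes W: "W \<subseteq> carrier S" and u: "u \<in> rspan W" and v: "v \<in> rspan W"
  shows "u \<oplus> v \<in> rspan W"
  using u
proof induction
  case zero
  then show ?case using v rspan_carrier[OF W v] by simp
next
  case (step c w u')
  have "w \<in> carrier S" "u' \<in> carrier S" "v \<in> carrier S"
    using W step(2) rspan_carrier[OF W step(3)] rspan_carrier[OF W v] by auto
  then have "sc c \<otimes> w \<oplus> u' \<oplus> v = sc c \<otimes> w \<oplus> (u' \<oplus> v)"
    using step(1) by (intro a_assoc) auto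
  then show ?case using rspan.step[OF step(1,2,4)] by simp
qed

lemma rspan_scale:
  assumes W: "W \<subseteq> carrier S" and c: "c \<in> K" and u: "u \<in> rspan W"
  shows "sc c \<otimes> u \<in> rspan W"
  using u
proof induction
  case zero
  then show ?case using c by (simp add: rspan.zero)
next
  case (step c' w u)
  have "w \<in> carrier S" "u \<in> carrier S" using W step(2) rspan_carrier[OF W step(3)] by auto
  then have "sc c \<otimes> (sc c' \<otimes> w \<oplus> u) = sc (c * c') \<otimes> w \<oplus> sc c \<otimes> u"
    using step(1) c by (simp add: r_distr m_assoc sc_mult)
  then show ?case using step c by (simp add: rspan.step K_mult)
qed

lemma rspan_minus:
  assumes "W \<subseteq> carrier S" "u \<in> rspan W"
  shows "\<ominus> u \<in> rspan W"
  using rspan_scale[OF assms(1) K_minus assms(2)] rspan_carrier[OF assms]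
  by (simp add: sc_minus l_minus)

lemma rspan_lin:
  assumes W: "W \<subseteq> carrier S" and W': "W' \<subseteq> carrier S" and y: "y \<in> carrier S"
    and base: "\<And>w. w \<in> W \<Longrightarrow> y \<otimes> w \<in> rspan W'" and v: "v \<in> rspan W"
  shows "y \<otimes> v \<in> rspan W'"
  using v
proof induction
  case zero
  then show ?case using y by (simp add: rspan.zero)
next
  case (step c w v)
  have wv: "w \<in> carrier S" "v \<in> carrier S" using W step(2) rspan_carrier[OF W step(3)] by auto
  have "y \<otimes> (sc c \<otimes> w) = sc c \<otimes> (y \<otimes> w)"
    using step(1) wv y by (simp add: m_assoc[symmetric] sc_central)
  then have "y \<otimes> (sc c \<otimes> w \<oplus> v) = sc c \<otimes> (y \<otimes> w) \<oplus> y \<otimes> v"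
    using step(1) wv y by (simp add: r_distr)
  then show ?case
    using rspan_scale[OF W' step(1) base[OF step(2)]] step(4) by (simp add: rspan_add[OF W'])
qed

lemma rspan_lin_right:
  assumes W: "W \<subseteq> carrier S" and W': "W' \<subseteq> carrier S" and y: "y \<in> carrier S"
    and base: "\<And>w. w \<in> W \<Longrightarrow> w \<otimes> y \<in> rspan W'" and v: "v \<in> rspan W"
  shows "v \<otimes> y \<in> rspan W'"
  using v
proof induction
  case zero
  then show ?case using y by (simp add: rspan.zero)
next
  case (step c w v)
  have wv: "w \<in> carrier S" "v \<in> carrier S" using W step(2) rspan_carrier[OF W step(3)] by auto
  have "(sc c \<otimes> w \<oplus> v) \<otimes> y = sc c \<otimes> (w \<otimes> y) \<oplus> v \<otimes> y"
    using step(1) wv y by (simp add: l_distr m_assoc)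
  then show ?case
    using rspan_scale[OF W' step(1) base[OF step(2)]] step(4) by (simp add: rspan_add[OF W'])
qed

definition mono :: "(nat \<Rightarrow> 'a) \<Rightarrow> nat list \<Rightarrow> (nat \<Rightarrow> nat) \<Rightarrow> 'a" where
  "mono z l \<alpha> = foldr (\<lambda>j y. z j [^] \<alpha> j \<otimes> y) l \<one>"

lemma mono_Nil: "mono z [] \<alpha> = \<one>"
  and mono_Cons: "mono z (j # l) \<alpha> = z j [^] \<alpha> j \<otimes> mono z l \<alpha>"
  by (simp_all add: mono_def)

lemma mono_cong_base: "(\<And>j. j \<in> set l \<Longrightarrow> z j = z' j) \<Longrightarrow> mono z l \<alpha> = mono z' l \<alpha>"
  by (induction l) (simp_all add: mono_Nil mono_Cons)

lemma mono_closed [simp]: "(\<And>j. j \<in> set l \<Longrightarrow> z j \<in> carrier S) \<Longrightarrow> mono z l \<alpha> \<in> carrier S"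
  by (induction l) (simp_all add: mono_Nil mono_Cons)

lemma pow_commute:
  assumes "y \<in> carrier S" "z \<in> carrier S" "y \<otimes> z = z \<otimes> y"
  shows "y \<otimes> z [^] (k :: nat) = z [^] k \<otimes> y"
proof (induction k)
  case (Suc k)
  have "y \<otimes> z [^] Suc k = (y \<otimes> z [^] k) \<otimes> z" using assms by (simp add: m_assoc)
  also have "\<dots> = z [^] k \<otimes> (y \<otimes> z)" using assms by (simp add: Suc m_assoc)
  also have "\<dots> = z [^] Suc k \<otimes> y" using assms by (simp add: m_assoc)
  finally show ?case .
qed (use assms in simp)

lemma mono_commute:
  assumes y: "y \<in> carrier S" and z: "\<And>j. j \<in> set l \<Longrightarrow> z j \<in> carrier S"
    and comm: "\<And>j. j \<in> set l \<Longrightarrow> \<alpha> j = 0 \<or> y \<otimes> z j = z j \<otimes> y"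
  shows "y \<otimes> mono z l \<alpha> = mono z l \<alpha> \<otimes> y"
  using z comm
proof (induction l)
  case (Cons j l)
  have IH: "y \<otimes> mono z l \<alpha> = mono z l \<alpha> \<otimes> y" by (rule Cons.IH) (use Cons.prems in auto)
  have zj: "z j \<in> carrier S" and zl: "mono z l \<alpha> \<in> carrier S" using Cons.prems by auto
  have pow: "y \<otimes> z j [^] \<alpha> j = z j [^] \<alpha> j \<otimes> y"
    using Cons.prems(2)[of j] y zj pow_commute[OF y zj] by auto
  have "y \<otimes> (z j [^] \<alpha> j \<otimes> mono z l \<alpha>) = (y \<otimes> z j [^] \<alpha> j) \<otimes> mono z l \<alpha>"
    using y zj zl by (simp add: m_assoc)
  also have "\<dots> = z j [^] \<alpha> j \<otimes> (y \<otimes> mono z l \<alpha>)"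
    unfolding pow using y zj zl by (simp add: m_assoc)
  also have "\<dots> = z j [^] \<alpha> j \<otimes> mono z l \<alpha> \<otimes> y"
    unfolding IH using y zj zl by (simp add: m_assoc)
  finally show ?case unfolding mono_Cons .
qed (use y in \<open>simp add: mono_Nil\<close>)

lemma mono_cong: "(\<And>j. j \<in> set l \<Longrightarrow> \<alpha> j = \<beta> j) \<Longrightarrow> mono z l \<alpha> = mono z l \<beta>"
  by (induction l) (simp_all add: mono_Nil mono_Cons)

lemma mono_extract:
  assumes z: "\<And>i. i \<in> set l \<Longrightarrow> z i \<in> carrier S"
    and comm: "\<And>i k. i \<in> set l \<Longrightarrow> k \<in> set l \<Longrightarrow> z i \<otimes> z k = z k \<otimes> z i"
    and l: "distinct l" "j \<in> set l"
  shows "mono z l \<alpha> = z j [^] \<alpha> j \<otimes> mono z l (\<alpha>(j := 0))"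
  using assms
proof (induction l)
  case (Cons i l)
  have zi: "z i \<in> carrier S" and zj: "z j \<in> carrier S"
    and zl: "\<And>\<beta>. mono z l \<beta> \<in> carrier S"
    using Cons.prems by auto
  show ?case
  proof (cases "i = j")
    case True
    have "mono z l (\<alpha>(j := 0)) = mono z l \<alpha>"
      using Cons.prems True by (intro mono_cong) auto
    then have eq: "mono z (i # l) (\<alpha>(j := 0)) = mono z l \<alpha>"
      unfolding mono_Cons True fun_upd_same using zl[of \<alpha>] by (simp del: fun_upd_apply)
    show ?thesis unfolding eq by (simp only: mono_Cons True)
  next
    case False
    have IH: "mono z l \<alpha> = z j [^] \<alpha> j \<otimes> mono z l (\<alpha>(j := 0))"
      by (rule Cons.IH) (use Cons.prems False in auto)
    have "z j \<otimes> z i = z i \<otimes> z j" using Cons.prems by auto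
    then have "z j [^] \<alpha> j \<otimes> z i [^] \<alpha> i = z i [^] \<alpha> i \<otimes> z j [^] \<alpha> j"
      using zi zj by (intro pow_commute pow_commute[symmetric] nat_pow_closed) auto
    then have "z i [^] \<alpha> i \<otimes> (z j [^] \<alpha> j \<otimes> mono z l (\<alpha>(j := 0)))
      = z j [^] \<alpha> j \<otimes> (z i [^] \<alpha> i \<otimes> mono z l (\<alpha>(j := 0)))"
      using zi zj zl by (simp add: m_assoc[symmetric])
    then show ?thesis using False unfolding mono_Cons IH by simp
  qed
qed simp

lemma mono_mult:
  assumes z: "\<And>i. i \<in> set l \<Longrightarrow> z i \<in> carrier S"
    and comm: "\<And>i k. i \<in> set l \<Longrightarrow> k \<in> set l \<Longrightarrow> z i \<otimes> z k = z k \<otimes> z i"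
    and l: "distinct l" "j \<in> set l" and "\<alpha> j = 0"
  shows "z j [^] m \<otimes> mono z l \<alpha> = mono z l (\<alpha>(j := m))"
proof -
  have "mono z l (\<alpha>(j := m)) = z j [^] (\<alpha>(j := m)) j \<otimes> mono z l ((\<alpha>(j := m))(j := 0))"
    using z comm l by (rule mono_extract)
  then show ?thesis using \<open>\<alpha> j = 0\<close> by (simp only: fun_upd_same fun_upd_upd fun_upd_idem)
qed

lemma swap_commute:
  assumes "a \<in> carrier S" "b \<in> carrier S" "y \<in> carrier S" "a \<otimes> y = y \<otimes> a" "b \<otimes> y = y \<otimes> b"
  shows "(a \<otimes> b) \<otimes> y = y \<otimes> (a \<otimes> b)"
proof -
  have "(a \<otimes> b) \<otimes> y = a \<otimes> (b \<otimes> y)" using assms by (simp add: m_assoc)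
  also have "\<dots> = (a \<otimes> y) \<otimes> b" unfolding assms(5) using assms(1-3) by (simp add: m_assoc)
  also have "\<dots> = y \<otimes> (a \<otimes> b)" unfolding assms(4) using assms(1-3) by (simp add: m_assoc)
  finally show ?thesis .
qed

text \<open>The Bernstein relations move \<open>A\<close> past a monomial in \<open>Z\<close> and \<open>Z'\<close> without raising the larger of the
  two exponents.\<close>

definition monomials :: "'a \<Rightarrow> 'a \<Rightarrow> nat \<Rightarrow> 'a set" where
  "monomials Z Z' B = {Z [^] p \<otimes> Z' [^] q | p q. p \<le> B \<and> q \<le> B}"

lemma Bernstein_monomial:
  assumes c: "A \<in> carrier S" "E \<in> carrier S" "Z \<in> carrier S" "Z' \<in> carrier S"
    and ZZ: "Z \<otimes> Z' = Z' \<otimes> Z" and EZ: "E \<otimes> Z = Z \<otimes> E" "E \<otimes> Z' = Z' \<otimes> E"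
    and left: "Z' \<otimes> A = A \<otimes> Z \<oplus> E \<otimes> Z'" and right: "A \<otimes> Z' = Z \<otimes> A \<oplus> E \<otimes> Z'"
  shows "\<exists>p\<in>rspan (monomials Z Z' (max a b)).
    A \<otimes> (Z [^] a \<otimes> Z' [^] b) = (Z [^] b \<otimes> Z' [^] a) \<otimes> A \<oplus> E \<otimes> p" (is "?P a b")
proof -
  have sub: "monomials Z Z' B \<subseteq> carrier S" for B using c by (auto simp: monomials_def)
  have monoI: "Z [^] p \<otimes> Z' [^] q \<in> rspan (monomials Z Z' B)" if "p \<le> B" "q \<le> B" for p q B
    using that by (intro rspan_base sub) (auto simp: monomials_def)
  have powZ: "Z' [^] (q :: nat) \<otimes> Z = Z \<otimes> Z' [^] q" for q
    using pow_commute[OF c(3,4) ZZ] by simp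
  have raise: "v \<otimes> Z \<in> rspan (monomials Z Z' (Suc B))" "v \<otimes> Z' \<in> rspan (monomials Z Z' (Suc B))"
    if "v \<in> rspan (monomials Z Z' B)" for v B
  proof -
    have "w \<otimes> Z \<in> rspan (monomials Z Z' (Suc B)) \<and> w \<otimes> Z' \<in> rspan (monomials Z Z' (Suc B))"
      if "w \<in> monomials Z Z' B" for w
    proof -
      obtain p q where w: "w = Z [^] p \<otimes> Z' [^] q" "p \<le> B" "q \<le> B" using \<open>w \<in> _\<close> by (auto simp: monomials_def)
      have "w \<otimes> Z = Z [^] Suc p \<otimes> Z' [^] q" "w \<otimes> Z' = Z [^] p \<otimes> Z' [^] Suc q"
        using c powZ[of q] by (simp_all add: w m_assoc)
      then show ?thesis using w monoI[of "Suc p" "Suc B" q] monoI[of p "Suc B" "Suc q"] by simp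
    qed
    then show "v \<otimes> Z \<in> rspan (monomials Z Z' (Suc B))" "v \<otimes> Z' \<in> rspan (monomials Z Z' (Suc B))"
      using rspan_lin_right[OF sub sub c(3) _ that] rspan_lin_right[OF sub sub c(4) _ that] by blast+
  qed
  have diag: "?P a a" for a
  proof -
    have "A \<otimes> (Z \<otimes> Z') \<oplus> E \<otimes> Z' \<otimes> Z' = (Z' \<otimes> A) \<otimes> Z'" unfolding left using c by (simp add: l_distr m_assoc)
    also have "\<dots> = Z' \<otimes> (Z \<otimes> A \<oplus> E \<otimes> Z')" unfolding right[symmetric] using c by (simp add: m_assoc)
    also have "\<dots> = (Z' \<otimes> Z) \<otimes> A \<oplus> (Z' \<otimes> E) \<otimes> Z'" using c by (simp add: r_distr m_assoc)
    finally have "A \<otimes> (Z \<otimes> Z') = (Z \<otimes> Z') \<otimes> A" unfolding EZ(2)[symmetric] ZZ[symmetric] using c by (simp add: m_assoc)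
    then have "A \<otimes> (Z \<otimes> Z') [^] a = (Z \<otimes> Z') [^] a \<otimes> A" using c by (intro pow_commute) auto
    then have "A \<otimes> (Z [^] a \<otimes> Z' [^] a) = (Z [^] a \<otimes> Z' [^] a) \<otimes> A"
      unfolding pow_mult_distrib[OF ZZ c(3,4)] .
    then show ?thesis using c by (intro bexI[of _ \<zero>] rspan.zero) simp
  qed
  have up: "?P a (Suc b)" if "?P a b" "a \<le> b" for a b
  proof -
    from that obtain p where p: "p \<in> rspan (monomials Z Z' b)"
      and eq: "A \<otimes> (Z [^] a \<otimes> Z' [^] b) = (Z [^] b \<otimes> Z' [^] a) \<otimes> A \<oplus> E \<otimes> p"
      by (auto simp: max_absorb2)
    have pc: "p \<in> carrier S" by (rule rspan_carrier[OF sub p])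
    define M where "M = Z [^] b \<otimes> Z' [^] a"
    have M: "M \<in> carrier S" using c by (simp add: M_def)
    have MZ: "M \<otimes> Z = Z [^] Suc b \<otimes> Z' [^] a" "M \<otimes> Z' = Z [^] b \<otimes> Z' [^] Suc a"
      using c powZ[of a] by (simp_all add: M_def m_assoc)
    have ME: "M \<otimes> E = E \<otimes> M" unfolding M_def
      using c pow_commute[OF c(2,3) EZ(1)] pow_commute[OF c(2,4) EZ(2)] by (intro swap_commute) auto
    have "A \<otimes> (Z [^] a \<otimes> Z' [^] Suc b) = (M \<otimes> A \<oplus> E \<otimes> p) \<otimes> Z'"
      unfolding M_def eq[symmetric] using c by (simp add: m_assoc)
    also have "\<dots> = M \<otimes> (Z \<otimes> A \<oplus> E \<otimes> Z') \<oplus> E \<otimes> (p \<otimes> Z')"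
      unfolding right[symmetric] using c M pc by (simp add: l_distr m_assoc)
    also have "\<dots> = (M \<otimes> Z) \<otimes> A \<oplus> ((M \<otimes> E) \<otimes> Z' \<oplus> E \<otimes> (p \<otimes> Z'))"
      using c M pc by (simp add: r_distr m_assoc a_assoc)
    also have "\<dots> = (M \<otimes> Z) \<otimes> A \<oplus> E \<otimes> (M \<otimes> Z' \<oplus> p \<otimes> Z')"
      unfolding ME using c M pc by (simp add: r_distr m_assoc)
    finally have *: "A \<otimes> (Z [^] a \<otimes> Z' [^] Suc b) = (M \<otimes> Z) \<otimes> A \<oplus> E \<otimes> (M \<otimes> Z' \<oplus> p \<otimes> Z')" .
    have "M \<otimes> Z' \<oplus> p \<otimes> Z' \<in> rspan (monomials Z Z' (max a (Suc b)))"
      unfolding MZ using that(2) raise(2)[OF p] by (intro rspan_add sub monoI) (auto simp: max_absorb2)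
    with * show ?thesis unfolding MZ(1) by blast
  qed
  have down: "?P (Suc a) b" if "?P a b" "b \<le> a" for a b
  proof -
    from that obtain p where p: "p \<in> rspan (monomials Z Z' a)"
      and eq: "A \<otimes> (Z [^] a \<otimes> Z' [^] b) = (Z [^] b \<otimes> Z' [^] a) \<otimes> A \<oplus> E \<otimes> p"
      by (auto simp: max_absorb1)
    have pc: "p \<in> carrier S" by (rule rspan_carrier[OF sub p])
    define M where "M = Z [^] b \<otimes> Z' [^] a"
    have M: "M \<in> carrier S" using c by (simp add: M_def)
    have MZ: "M \<otimes> Z' = Z [^] b \<otimes> Z' [^] Suc a"
      using c by (simp add: M_def m_assoc)
    have ME: "M \<otimes> E = E \<otimes> M" unfolding M_def
      using c pow_commute[OF c(2,3) EZ(1)] pow_commute[OF c(2,4) EZ(2)] by (intro swap_commute) auto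
    have AZ: "A \<otimes> Z = Z' \<otimes> A \<oplus> \<ominus> (E \<otimes> Z')" unfolding left using c by (simp add: a_assoc r_neg)
    have "A \<otimes> (Z [^] Suc a \<otimes> Z' [^] b) = (M \<otimes> A \<oplus> E \<otimes> p) \<otimes> Z"
      unfolding M_def eq[symmetric] using c powZ[of b] by (simp add: m_assoc)
    also have "\<dots> = M \<otimes> (Z' \<otimes> A \<oplus> \<ominus> (E \<otimes> Z')) \<oplus> E \<otimes> (p \<otimes> Z)"
      unfolding AZ[symmetric] using c M pc by (simp add: l_distr m_assoc)
    also have "\<dots> = (M \<otimes> Z') \<otimes> A \<oplus> (\<ominus> ((M \<otimes> E) \<otimes> Z') \<oplus> E \<otimes> (p \<otimes> Z))"
      using c M pc by (simp add: r_distr m_assoc a_assoc r_minus)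
    also have "\<dots> = (M \<otimes> Z') \<otimes> A \<oplus> E \<otimes> (\<ominus> (M \<otimes> Z') \<oplus> p \<otimes> Z)"
      unfolding ME using c M pc by (simp add: r_distr m_assoc r_minus)
    finally have *: "A \<otimes> (Z [^] Suc a \<otimes> Z' [^] b) = (M \<otimes> Z') \<otimes> A \<oplus> E \<otimes> (\<ominus> (M \<otimes> Z') \<oplus> p \<otimes> Z)" .
    have "\<ominus> (M \<otimes> Z') \<oplus> p \<otimes> Z \<in> rspan (monomials Z Z' (max (Suc a) b))"
      unfolding MZ using that(2) raise(1)[OF p] by (intro rspan_add rspan_minus sub monoI) (auto simp: max_absorb1)
    with * show ?thesis unfolding MZ by blast
  qed
  show ?thesis
  proof (cases "a \<le> b")
    case True
    then show ?thesis by (induction b rule: dec_induct) (use diag up in auto)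
  next
    case False
    then have "b \<le> a" by simp
    then show ?thesis by (induction a rule: dec_induct) (use diag down in auto)
  qed
qed

end

text \<open>The relations of the cyclotomic algebra in an arbitrary ring.  Here \<open>he i\<close> is \<open>(q - q\<^sup>-\<^sup>1) e\<^sub>i\<close>, and the
  relation \<open>f\<^sub>1 = 0\<close> enters through its two consequences for \<open>X\<^sub>1\<^sup>d\<close> and \<open>X\<^sub>1\<^sup>-\<^sup>1\<close>.\<close>

locale yh_ring = scalar_ring +
  fixes n d r :: nat and t g he :: "nat \<Rightarrow> 'a" and x xi :: 'a
  assumes n_pos: "1 \<le> n" and r_pos: "1 \<le> r"
    and t_closed [simp]: "\<And>j. j \<in> {1..n} \<Longrightarrow> t j \<in> carrier S"
    and g_closed [simp]: "\<And>i. i \<in> {1..<n} \<Longrightarrow> g i \<in> carrier S"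
    and x_closed [simp]: "x \<in> carrier S" and xi_closed [simp]: "xi \<in> carrier S"
    and he_closed [simp]: "\<And>i. i \<in> {1..<n} \<Longrightarrow> he i \<in> carrier S"
    and gg_commute: "\<And>i j. i \<in> {1..<n} \<Longrightarrow> j \<in> {1..<n} \<Longrightarrow> i + 2 \<le> j \<or> j + 2 \<le> i \<Longrightarrow> g i \<otimes> g j = g j \<otimes> g i"
    and gg_braid: "\<And>i. 1 \<le> i \<Longrightarrow> i + 1 < n \<Longrightarrow> g i \<otimes> g (Suc i) \<otimes> g i = g (Suc i) \<otimes> g i \<otimes> g (Suc i)"
    and tt_commute: "\<And>i j. i \<in> {1..n} \<Longrightarrow> j \<in> {1..n} \<Longrightarrow> t i \<otimes> t j = t j \<otimes> t i"
    and t_ord: "\<And>j. j \<in> {1..n} \<Longrightarrow> t j [^] r = \<one>"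
    and gt: "\<And>i j. i \<in> {1..<n} \<Longrightarrow> j \<in> {1..n} \<Longrightarrow> g i \<otimes> t j = t (transpose i (Suc i) j) \<otimes> g i"
    and gg_quadratic: "\<And>i. i \<in> {1..<n} \<Longrightarrow> g i \<otimes> g i = \<one> \<oplus> he i \<otimes> g i"
    and gx_braid: "1 < n \<Longrightarrow> g 1 \<otimes> x \<otimes> g 1 \<otimes> x = x \<otimes> g 1 \<otimes> x \<otimes> g 1"
    and gx_commute: "\<And>i. i \<in> {1..<n} \<Longrightarrow> 2 \<le> i \<Longrightarrow> g i \<otimes> x = x \<otimes> g i"
    and tx_commute: "\<And>j. j \<in> {1..n} \<Longrightarrow> t j \<otimes> x = x \<otimes> t j"
    and he_g: "\<And>i. i \<in> {1..<n} \<Longrightarrow> he i \<otimes> g i = g i \<otimes> he i"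
    and xi_x: "xi \<otimes> x = \<one>"
    and x_reduce: "x [^] d \<in> rspan ((\<lambda>m. x [^] m) ` {..<d})"
    and xi_reduce: "xi \<in> rspan ((\<lambda>m. x [^] m) ` {..<d})"
begin

inductive_set Tm :: "'a set" where
  one: "\<one> \<in> Tm"
| step: "j \<in> {1..n} \<Longrightarrow> \<tau> \<in> Tm \<Longrightarrow> t j \<otimes> \<tau> \<in> Tm"

lemma Tm_subset: "Tm \<subseteq> carrier S"
proof
  fix \<tau> show "\<tau> \<in> Tm \<Longrightarrow> \<tau> \<in> carrier S" by (induction rule: Tm.induct) auto
qed

lemma Tm_closed [simp]: "\<tau> \<in> Tm \<Longrightarrow> \<tau> \<in> carrier S"
  using Tm_subset by auto

lemma Tm_mult: "\<tau> \<in> Tm \<Longrightarrow> \<tau>' \<in> Tm \<Longrightarrow> \<tau> \<otimes> \<tau>' \<in> Tm"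
  by (induction rule: Tm.induct) (auto simp: m_assoc intro: Tm.intros)

lemma t_Tm: "j \<in> {1..n} \<Longrightarrow> t j \<in> Tm"
  using Tm.step[OF _ Tm.one, of j] by simp

lemma t_pow_Tm: "j \<in> {1..n} \<Longrightarrow> t j [^] (k :: nat) \<in> Tm"
  by (induction k) (simp_all add: Tm.one Tm_mult t_Tm del: atLeastAtMost_iff)

end

locale yh_ring_span = yh_ring +
  assumes he_span: "\<And>i. i \<in> {1..<n} \<Longrightarrow> he i \<in> rspan Tm"
begin

lemma Tm_commute:
  assumes "\<tau> \<in> Tm" "y \<in> carrier S" "\<And>j. j \<in> {1..n} \<Longrightarrow> t j \<otimes> y = y \<otimes> t j"
  shows "\<tau> \<otimes> y = y \<otimes> \<tau>"
  using assms(1)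
proof induction
  case (step j \<tau>)
  have c: "t j \<in> carrier S" "\<tau> \<in> carrier S" using step by auto
  have "t j \<otimes> \<tau> \<otimes> y = t j \<otimes> y \<otimes> \<tau>" using step(3) c assms(2) by (simp add: m_assoc)
  also have "\<dots> = y \<otimes> (t j \<otimes> \<tau>)" unfolding assms(3)[OF step(1)] using c assms(2) by (simp add: m_assoc)
  finally show ?case .
qed (use assms in simp)

lemma he_commute:
  assumes "i \<in> {1..<n}" "y \<in> carrier S" "\<And>j. j \<in> {1..n} \<Longrightarrow> t j \<otimes> y = y \<otimes> t j"
  shows "he i \<otimes> y = y \<otimes> he i"
  using he_span[OF assms(1)]
proof induction
  case (step c \<tau> v)
  have v: "v \<in> carrier S" "\<tau> \<in> carrier S" "sc c \<in> carrier S" using rspan_carrier[OF Tm_subset step(3)] step by auto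
  have \<tau>y: "\<tau> \<otimes> y = y \<otimes> \<tau>" using step(2) assms(2,3) by (rule Tm_commute)
  have "(sc c \<otimes> \<tau> \<oplus> v) \<otimes> y = sc c \<otimes> (\<tau> \<otimes> y) \<oplus> v \<otimes> y"
    using assms(2) v by (simp add: l_distr m_assoc)
  also have "\<dots> = sc c \<otimes> y \<otimes> \<tau> \<oplus> y \<otimes> v"
    unfolding \<tau>y step(4) using assms(2) v by (simp add: m_assoc)
  also have "\<dots> = y \<otimes> (sc c \<otimes> \<tau> \<oplus> v)"
    unfolding sc_central[OF step(1) assms(2), symmetric] using assms(2) v by (simp add: r_distr m_assoc)
  finally show ?case .
qed (use assms in simp)

lemma g_Tm:
  assumes "\<tau> \<in> Tm" "i \<in> {1..<n}"
  shows "\<exists>\<tau>'\<in>Tm. g i \<otimes> \<tau> = \<tau>' \<otimes> g i"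
  using assms(1)
proof induction
  case one
  then show ?case using assms(2) by (intro bexI[of _ \<one>] Tm.one) simp
next
  case (step j \<tau>)
  then obtain \<tau>' where \<tau>': "\<tau>' \<in> Tm" "g i \<otimes> \<tau> = \<tau>' \<otimes> g i" by blast
  let ?j = "transpose i (Suc i) j"
  have j: "?j \<in> {1..n}" using assms(2) step(1) by (auto simp: transpose_def)
  have c: "t j \<in> carrier S" "t ?j \<in> carrier S" "\<tau> \<in> carrier S" "\<tau>' \<in> carrier S" "g i \<in> carrier S"
    using t_closed[OF j] t_closed[OF step(1)] step(2) \<tau>'(1) g_closed[OF assms(2)] by auto
  have "g i \<otimes> (t j \<otimes> \<tau>) = g i \<otimes> t j \<otimes> \<tau>" using c by (simp add: m_assoc)
  also have "\<dots> = t ?j \<otimes> (g i \<otimes> \<tau>)" unfolding gt[OF assms(2) step(1)] using c by (simp add: m_assoc)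
  also have "\<dots> = t ?j \<otimes> \<tau>' \<otimes> g i" unfolding \<tau>'(2) using c by (simp add: m_assoc)
  finally show ?case using Tm.step[OF j \<tau>'(1)] by blast
qed

definition gw :: "nat list \<Rightarrow> 'a" where
  "gw u = foldr (\<lambda>i y. g i \<otimes> y) u \<one>"

lemma gw_Nil [simp]: "gw [] = \<one>" and gw_Cons [simp]: "gw (i # u) = g i \<otimes> gw u"
  by (simp_all add: gw_def)

lemma gw_closed: "set u \<subseteq> {1..<n} \<Longrightarrow> gw u \<in> carrier S"
proof (induction u)
  case (Cons i u)
  then show ?case using g_closed[of i] by simp
qed simp

lemma gw_append: "set u \<subseteq> {1..<n} \<Longrightarrow> set w \<subseteq> {1..<n} \<Longrightarrow> gw (u @ w) = gw u \<otimes> gw w"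
proof (induction u)
  case (Cons i u)
  then show ?case using g_closed[of i] gw_closed[of u] gw_closed[of w] by (simp add: m_assoc)
qed (simp add: gw_closed)

lemma gw_Tm:
  assumes "set u \<subseteq> {1..<n}" "\<tau> \<in> Tm"
  shows "\<exists>\<tau>'\<in>Tm. gw u \<otimes> \<tau> = \<tau>' \<otimes> gw u"
  using assms(1)
proof (induction u)
  case Nil
  then show ?case using assms(2) by (intro bexI[of _ \<tau>]) simp_all
next
  case (Cons i u)
  then have i: "i \<in> {1..<n}" and u: "set u \<subseteq> {1..<n}" by auto
  obtain \<tau>' where \<tau>': "\<tau>' \<in> Tm" "gw u \<otimes> \<tau> = \<tau>' \<otimes> gw u" using Cons.IH[OF u] by blast
  obtain \<tau>'' where \<tau>'': "\<tau>'' \<in> Tm" "g i \<otimes> \<tau>' = \<tau>'' \<otimes> g i" using g_Tm[OF \<tau>'(1) i] by blast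
  have c: "g i \<in> carrier S" "gw u \<in> carrier S" "\<tau> \<in> carrier S" "\<tau>' \<in> carrier S" "\<tau>'' \<in> carrier S"
    using g_closed[OF i] gw_closed[OF u] assms(2) \<tau>'(1) \<tau>''(1) by auto
  have "gw (i # u) \<otimes> \<tau> = g i \<otimes> (gw u \<otimes> \<tau>)" using c by (simp add: m_assoc)
  also have "\<dots> = g i \<otimes> \<tau>' \<otimes> gw u" unfolding \<tau>'(2) using c by (simp add: m_assoc)
  also have "\<dots> = \<tau>'' \<otimes> gw (i # u)" unfolding \<tau>''(2) using c by (simp add: m_assoc)
  finally show ?case using \<tau>''(1) by blast
qed

subsection \<open>The finite part\<close>

definition HW :: "nat \<Rightarrow> 'a set" where
  "HW m = {\<tau> \<otimes> gw u | \<tau> u. \<tau> \<in> Tm \<and> u \<in> normal_words m}"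

lemma HW_I: "\<tau> \<in> Tm \<Longrightarrow> u \<in> normal_words m \<Longrightarrow> \<tau> \<otimes> gw u \<in> HW m"
  unfolding HW_def by blast

lemma HW_E:
  assumes "y \<in> HW m"
  obtains \<tau> u where "y = \<tau> \<otimes> gw u" "\<tau> \<in> Tm" "u \<in> normal_words m"
  using assms unfolding HW_def by blast

lemma normal_words_letters': "m \<le> n \<Longrightarrow> u \<in> normal_words m \<Longrightarrow> set u \<subseteq> {1..<n}"
  using normal_words_letters[of u m] by fastforce

lemma HW_subset: assumes "m \<le> n" shows "HW m \<subseteq> carrier S"
proof
  fix y assume "y \<in> HW m"
  then obtain \<tau> u where "y = \<tau> \<otimes> gw u" "\<tau> \<in> Tm" "u \<in> normal_words m" by (rule HW_E)
  then show "y \<in> carrier S" using gw_closed[OF normal_words_letters'[OF assms, of u]] by simp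
qed

lemma gw_HW: "m \<le> n \<Longrightarrow> u \<in> normal_words m \<Longrightarrow> gw u \<in> rspan (HW m)"
  using rspan_base[OF HW_subset HW_I[OF Tm.one], of m u] gw_closed[OF normal_words_letters'[of m u]] by simp

lemma block_HW:
  assumes m: "Suc m \<le> n" and j: "j \<in> {1..Suc m}" and v: "v \<in> rspan (HW m)"
  shows "gw [j..<Suc m] \<otimes> v \<in> rspan (HW (Suc m))"
proof (rule rspan_lin[OF _ HW_subset[OF m] _ _ v])
  have b: "set [j..<Suc m] \<subseteq> {1..<n}" using j m by auto
  then show gb: "gw [j..<Suc m] \<in> carrier S" by (rule gw_closed)
  show "HW m \<subseteq> carrier S" using m by (intro HW_subset) simp
  fix y assume "y \<in> HW m"
  then obtain \<tau> u where y: "y = \<tau> \<otimes> gw u" and \<tau>: "\<tau> \<in> Tm" and u: "u \<in> normal_words m" by (rule HW_E)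
  have lu: "set u \<subseteq> {1..<n}" using normal_words_letters'[of m u] u m by simp
  obtain \<tau>' where \<tau>': "\<tau>' \<in> Tm" "gw [j..<Suc m] \<otimes> \<tau> = \<tau>' \<otimes> gw [j..<Suc m]" using gw_Tm[OF b \<tau>] by blast
  note c = Tm_closed[OF \<tau>] Tm_closed[OF \<tau>'(1)] gb gw_closed[OF lu]
  have "gw [j..<Suc m] \<otimes> y = gw [j..<Suc m] \<otimes> \<tau> \<otimes> gw u"
    unfolding y using c by (simp only: m_assoc)
  also have "\<dots> = \<tau>' \<otimes> gw ([j..<Suc m] @ u)"
    unfolding \<tau>'(2) gw_append[OF b lu] using c by (simp only: m_assoc)
  also have "\<dots> \<in> HW (Suc m)" using u j by (intro HW_I[OF \<tau>'(1)]) auto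
  finally show "gw [j..<Suc m] \<otimes> y \<in> rspan (HW (Suc m))" by (intro rspan_base HW_subset m)
qed

lemma T_HW:
  assumes m: "m \<le> n" and \<tau>: "\<tau> \<in> rspan Tm" and v: "v \<in> rspan (HW m)"
  shows "\<tau> \<otimes> v \<in> rspan (HW m)"
proof (rule rspan_lin_right[OF Tm_subset HW_subset[OF m] _ _ \<tau>])
  show "v \<in> carrier S" using rspan_carrier[OF HW_subset[OF m] v] .
  fix \<tau>1 assume \<tau>1: "\<tau>1 \<in> Tm"
  show "\<tau>1 \<otimes> v \<in> rspan (HW m)"
  proof (rule rspan_lin[OF HW_subset[OF m] HW_subset[OF m] Tm_closed[OF \<tau>1] _ v])
    fix y assume "y \<in> HW m"
    then obtain \<tau>2 u where y: "y = \<tau>2 \<otimes> gw u" and \<tau>2: "\<tau>2 \<in> Tm" and u: "u \<in> normal_words m" by (rule HW_E)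
    have "\<tau>1 \<otimes> y = (\<tau>1 \<otimes> \<tau>2) \<otimes> gw u"
      using y \<tau>1 \<tau>2 gw_closed[OF normal_words_letters'[OF m u]] by (simp add: m_assoc)
    also have "\<dots> \<in> HW m" by (rule HW_I[OF Tm_mult[OF \<tau>1 \<tau>2] u])
    finally show "\<tau>1 \<otimes> y \<in> rspan (HW m)" by (intro rspan_base HW_subset m)
  qed
qed

lemma g_block_far:
  assumes "i \<in> {1..<n}" "set u \<subseteq> {1..<n}" "\<And>k. k \<in> set u \<Longrightarrow> i + 2 \<le> k \<or> k + 2 \<le> i"
  shows "g i \<otimes> gw u = gw u \<otimes> g i"
  using assms(2,3)
proof (induction u)
  case Nil
  then show ?case using g_closed[OF assms(1)] by simp
next
  case (Cons k u)
  have IH: "g i \<otimes> gw u = gw u \<otimes> g i" by (rule Cons.IH) (use Cons.prems in auto)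
  have k: "k \<in> {1..<n}" and u: "set u \<subseteq> {1..<n}" using Cons.prems by auto
  have ik: "g i \<otimes> g k = g k \<otimes> g i" using Cons.prems(2)[of k] by (intro gg_commute assms(1) k) simp
  note c = g_closed[OF assms(1)] g_closed[OF k] gw_closed[OF u]
  have "g i \<otimes> gw (k # u) = g i \<otimes> g k \<otimes> gw u" using c by (simp add: m_assoc)
  also have "\<dots> = g k \<otimes> (g i \<otimes> gw u)" unfolding ik using c by (simp add: m_assoc)
  also have "\<dots> = gw (k # u) \<otimes> g i" unfolding IH using c by (simp add: m_assoc)
  finally show ?case .
qed

lemma g_block_shift:
  assumes "1 \<le> j" "j \<le> i" "Suc i < m" "m \<le> n"
  shows "g (Suc i) \<otimes> gw [j..<m] = gw [j..<m] \<otimes> g i"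
  using assms(2,1)
proof (induction j rule: inc_induct)
  case base
  have split: "[i..<m] = i # Suc i # [Suc (Suc i)..<m]" using assms by (simp add: upt_conv_Cons)
  let ?u = "[Suc (Suc i)..<m]"
  have ii: "i \<in> {1..<n}" "Suc i \<in> {1..<n}" "set ?u \<subseteq> {1..<n}" using assms base by auto
  note c = g_closed[OF ii(1)] g_closed[OF ii(2)] gw_closed[OF ii(3)]
  have far: "g i \<otimes> gw ?u = gw ?u \<otimes> g i" by (rule g_block_far[OF ii(1,3)]) auto
  have braid: "g i \<otimes> g (Suc i) \<otimes> g i = g (Suc i) \<otimes> g i \<otimes> g (Suc i)"
    using gg_braid[of i] assms base by simp
  have "g (Suc i) \<otimes> gw [i..<m] = (g (Suc i) \<otimes> g i \<otimes> g (Suc i)) \<otimes> gw ?u"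
    unfolding split using c by (simp add: m_assoc)
  also have "\<dots> = g i \<otimes> g (Suc i) \<otimes> (g i \<otimes> gw ?u)" unfolding braid[symmetric] using c by (simp add: m_assoc)
  also have "\<dots> = gw [i..<m] \<otimes> g i" unfolding far split using c by (simp add: m_assoc)
  finally show ?case .
next
  case (step k)
  have split: "[k..<m] = k # [Suc k..<m]" using step assms by (simp add: upt_conv_Cons)
  have ii: "k \<in> {1..<n}" "i \<in> {1..<n}" "Suc i \<in> {1..<n}" "set [Suc k..<m] \<subseteq> {1..<n}" using assms step by auto
  note c = g_closed[OF ii(1)] g_closed[OF ii(2)] g_closed[OF ii(3)] gw_closed[OF ii(4)]
  have comm: "g (Suc i) \<otimes> g k = g k \<otimes> g (Suc i)" using step by (intro gg_commute ii) auto
  have IH: "g (Suc i) \<otimes> gw [Suc k..<m] = gw [Suc k..<m] \<otimes> g i" using step by simp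
  have "g (Suc i) \<otimes> gw [k..<m] = g (Suc i) \<otimes> g k \<otimes> gw [Suc k..<m]" unfolding split using c by (simp add: m_assoc)
  also have "\<dots> = g k \<otimes> (g (Suc i) \<otimes> gw [Suc k..<m])" unfolding comm using c by (simp add: m_assoc)
  also have "\<dots> = gw [k..<m] \<otimes> g i" unfolding IH split using c by (simp add: m_assoc)
  finally show ?case .
qed

text \<open>Let \<open>s\<^sub>j \<cdots> s\<^sub>m\<close> be the first block of the word.  Multiplication by \<open>g\<^sub>i\<close> extends the block if \<open>i = j - 1\<close>,
  shortens it or reproduces it if \<open>i = j\<close>, commutes with it if \<open>i < j - 1\<close>, and passes through it as
  \<open>g\<^sub>i\<^sub>-\<^sub>1\<close> if \<open>i > j\<close>.\<close>

lemma g_normal_word: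
  assumes "m \<le> n" "i \<in> {1..<m}" "u \<in> normal_words m"
  shows "g i \<otimes> gw u \<in> rspan (HW m)"
  using assms
proof (induction m arbitrary: i u)
  case (Suc m)
  from Suc.prems(3) obtain j w where u: "u = [j..<Suc m] @ w" and j: "j \<in> {1..Suc m}" and w: "w \<in> normal_words m"
    unfolding normal_words.simps by blast
  have m: "Suc m \<le> n" "m \<le> n" using Suc.prems by auto
  have b: "set [k..<Suc m] \<subseteq> {1..<n}" if "1 \<le> k" for k using m that by auto
  have lw: "set w \<subseteq> {1..<n}" by (rule normal_words_letters'[OF m(2) w])
  have i: "i \<in> {1..<n}" "i \<le> m" using Suc.prems by auto
  have lj: "set [j..<Suc m] \<subseteq> {1..<n}" "set [Suc j..<Suc m] \<subseteq> {1..<n}" using b j by auto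
  note c = g_closed[OF i(1)] gw_closed[OF lw] gw_closed[OF lj(1)] gw_closed[OF lj(2)]
  have gwu: "gw u = gw [j..<Suc m] \<otimes> gw w" unfolding u by (rule gw_append[OF lj(1) lw])
  consider "Suc i = j" | "i = j" | "Suc i < j" | "j < i" by linarith
  then show ?case
  proof cases
    case 1
    have "[i..<Suc m] = i # [j..<Suc m]" using 1 i by (simp add: upt_conv_Cons[of i "Suc m"] del: upt_Suc)
    then have "gw [i..<Suc m] = g i \<otimes> gw [j..<Suc m]" by (simp only: gw_Cons)
    then have "g i \<otimes> gw u = gw [i..<Suc m] \<otimes> gw w" unfolding gwu using c by (simp only: m_assoc)
    also have "\<dots> \<in> rspan (HW (Suc m))" using i by (intro block_HW gw_HW m w) auto
    finally show ?thesis .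
  next
    case 2
    have "[j..<Suc m] = j # [Suc j..<Suc m]" using 2 i by (simp add: upt_conv_Cons[of j "Suc m"] del: upt_Suc)
    then have split: "gw [j..<Suc m] = g j \<otimes> gw [Suc j..<Suc m]" by (simp only: gw_Cons)
    have j': "j \<in> {1..<n}" using 2 i by simp
    have c': "g j \<in> carrier S" "he j \<in> carrier S" using g_closed[OF j'] he_closed[OF j'] by auto
    have "g i \<otimes> gw u = (g j \<otimes> g j) \<otimes> (gw [Suc j..<Suc m] \<otimes> gw w)"
      unfolding gwu split 2 using c c' by (simp only: m_assoc m_closed)
    also have "\<dots> = gw [Suc j..<Suc m] \<otimes> gw w \<oplus> he j \<otimes> gw u"
      unfolding gwu gg_quadratic[OF j'] split using c c' by (simp add: l_distr m_assoc del: upt_Suc)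
    also have "\<dots> \<in> rspan (HW (Suc m))"
      using 2 i Suc.prems by (intro rspan_add HW_subset m block_HW gw_HW w T_HW he_span j') auto
    finally show ?thesis .
  next
    case 3
    have "g i \<otimes> gw [j..<Suc m] = gw [j..<Suc m] \<otimes> g i"
      by (rule g_block_far[OF i(1) lj(1)]) (use 3 in auto)
    then have "g i \<otimes> gw u = gw [j..<Suc m] \<otimes> (g i \<otimes> gw w)"
      unfolding gwu using c by (simp only: m_assoc[symmetric] m_closed)
    also have "\<dots> \<in> rspan (HW (Suc m))"
      using 3 i j by (intro block_HW m j Suc.IH w) auto
    finally show ?thesis .
  next
    case 4
    then obtain k where k: "i = Suc k" "j \<le> k" by (cases i) auto
    have gk: "g k \<in> carrier S" using k i j g_closed[of k] by auto
    have "g i \<otimes> gw [j..<Suc m] = gw [j..<Suc m] \<otimes> g k"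
      unfolding k(1) by (rule g_block_shift) (use k j i m in auto)
    then have "g i \<otimes> gw u = gw [j..<Suc m] \<otimes> (g k \<otimes> gw w)"
      unfolding gwu using c gk by (simp only: m_assoc[symmetric] m_closed)
    also have "\<dots> \<in> rspan (HW (Suc m))"
      using k i j by (intro block_HW m j Suc.IH w) auto
    finally show ?thesis .
  qed
qed simp

subsection \<open>The Jucys-Murphy elements\<close>

fun XY :: "nat \<Rightarrow> 'a" where
  "XY 0 = \<one>"
| "XY (Suc 0) = x"
| "XY (Suc (Suc i)) = g (Suc i) \<otimes> XY (Suc i) \<otimes> g (Suc i)"

lemma XY_Suc: "1 \<le> i \<Longrightarrow> XY (Suc i) = g i \<otimes> XY i \<otimes> g i"
  by (cases i) simp_all

lemma XY_closed: "i \<le> n \<Longrightarrow> XY i \<in> carrier S"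
proof (induction i rule: XY.induct)
  case (3 i)
  then show ?case using g_closed[of "Suc i"] by simp
qed simp_all

lemma t_XY:
  assumes "1 \<le> i" "i \<le> n" "j \<in> {1..n}"
  shows "t j \<otimes> XY i = XY i \<otimes> t j"
  using assms
proof (induction i arbitrary: j rule: dec_induct)
  case base
  then show ?case by (simp add: tx_commute)
next
  case (step i)
  have i: "i \<in> {1..<n}" using step by auto
  let ?j = "transpose i (Suc i) j"
  have j: "?j \<in> {1..n}" using i step.prems(2) by (auto simp: transpose_def)
  have gt1: "g i \<otimes> t j = t ?j \<otimes> g i" by (rule gt[OF i step.prems(2)])
  have gt2: "g i \<otimes> t ?j = t j \<otimes> g i" using gt[OF i j] by simp
  have IH: "t ?j \<otimes> XY i = XY i \<otimes> t ?j" using i j by (intro step.IH) auto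
  have X: "XY (Suc i) = g i \<otimes> XY i \<otimes> g i" using i by (intro XY_Suc) simp
  have c: "g i \<in> carrier S" "t j \<in> carrier S" "t ?j \<in> carrier S" "XY i \<in> carrier S"
    using i step.prems(2) j XY_closed[of i] by auto
  have "t j \<otimes> XY (Suc i) = (t j \<otimes> g i) \<otimes> (XY i \<otimes> g i)" unfolding X using c by (simp only: m_assoc m_closed)
  also have "\<dots> = g i \<otimes> ((t ?j \<otimes> XY i) \<otimes> g i)" unfolding gt2[symmetric] using c by (simp only: m_assoc m_closed)
  also have "\<dots> = g i \<otimes> XY i \<otimes> (t ?j \<otimes> g i)" unfolding IH using c by (simp only: m_assoc m_closed)
  also have "\<dots> = XY (Suc i) \<otimes> t j" unfolding gt1[symmetric] X using c by (simp only: m_assoc m_closed)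
  finally show ?case .
qed

lemma g_XY_above:
  assumes "1 \<le> j" "j < i" "i < n"
  shows "g i \<otimes> XY j = XY j \<otimes> g i"
  using assms(1,2)
proof (induction j rule: dec_induct)
  case base
  then show ?case using gx_commute[of i] assms by simp
next
  case (step j)
  have ij: "i \<in> {1..<n}" "j \<in> {1..<n}" using step assms by auto
  have X: "XY (Suc j) = g j \<otimes> XY j \<otimes> g j" using step by (intro XY_Suc) simp
  have c: "g i \<in> carrier S" "g j \<in> carrier S" "XY j \<in> carrier S" using ij XY_closed[of j] by auto
  have comm: "g j \<otimes> g i = g i \<otimes> g j" using step by (intro gg_commute ij) auto
  have "XY j \<otimes> g i = g i \<otimes> XY j" using step by simp
  then show ?case unfolding X
    by (intro swap_commute[symmetric] swap_commute m_closed c comm)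
qed

text \<open>With \<open>y = X\<^sub>i\<close> this is the reason why \<open>g\<^sub>i\<close> commutes with \<open>X\<^sub>i\<^sub>+\<^sub>2\<close>.\<close>

lemma braid_conjugate:
  assumes c: "a \<in> carrier S" "b \<in> carrier S" "y \<in> carrier S"
    and braid: "a \<otimes> b \<otimes> a = b \<otimes> a \<otimes> b" and comm: "b \<otimes> y = y \<otimes> b"
  shows "a \<otimes> (b \<otimes> (a \<otimes> y \<otimes> a) \<otimes> b) = b \<otimes> (a \<otimes> y \<otimes> a) \<otimes> b \<otimes> a"
proof -
  have "a \<otimes> (b \<otimes> (a \<otimes> y \<otimes> a) \<otimes> b) = (a \<otimes> b \<otimes> a) \<otimes> y \<otimes> (a \<otimes> b)"
    using c by (simp only: m_assoc m_closed)
  also have "\<dots> = b \<otimes> a \<otimes> (b \<otimes> y) \<otimes> (a \<otimes> b)" unfolding braid using c by (simp only: m_assoc m_closed)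
  also have "\<dots> = b \<otimes> a \<otimes> y \<otimes> (b \<otimes> a \<otimes> b)" unfolding comm using c by (simp only: m_assoc m_closed)
  also have "\<dots> = b \<otimes> (a \<otimes> y \<otimes> a) \<otimes> b \<otimes> a" unfolding braid[symmetric] using c by (simp only: m_assoc m_closed)
  finally show ?thesis .
qed

lemma g_XY_below:
  assumes "1 \<le> i" "i + 2 \<le> j" "j \<le> n"
  shows "g i \<otimes> XY j = XY j \<otimes> g i"
  using assms(2,3)
proof (induction j rule: dec_induct)
  case base
  have i: "i \<in> {1..<n}" "Suc i \<in> {1..<n}" using assms base by auto
  have "XY (i + 2) = g (Suc i) \<otimes> (g i \<otimes> XY i \<otimes> g i) \<otimes> g (Suc i)"
    using XY_Suc[of "Suc i"] XY_Suc[of i] assms(1) by simp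
  moreover have "g (Suc i) \<otimes> XY i = XY i \<otimes> g (Suc i)" using i by (intro g_XY_above) auto
  ultimately show ?case
    using braid_conjugate[of "g i" "g (Suc i)" "XY i"] gg_braid[of i] i XY_closed[of i] by simp
next
  case (step j)
  have ij: "i \<in> {1..<n}" "j \<in> {1..<n}" using step assms by auto
  have X: "XY (Suc j) = g j \<otimes> XY j \<otimes> g j" using step by (intro XY_Suc) simp
  have c: "g i \<in> carrier S" "g j \<in> carrier S" "XY j \<in> carrier S" using ij XY_closed[of j] by auto
  have comm: "g j \<otimes> g i = g i \<otimes> g j" using step by (intro gg_commute ij) auto
  have "XY j \<otimes> g i = g i \<otimes> XY j" using step by simp
  then show ?case unfolding X
    by (intro swap_commute[symmetric] swap_commute m_closed c comm)
qed

lemma x_XY: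
  assumes "1 \<le> j" "j \<le> n"
  shows "x \<otimes> XY j = XY j \<otimes> x"
  using assms
proof (induction j rule: dec_induct)
  case (step j)
  have j: "j \<in> {1..<n}" using step by auto
  have X: "XY (Suc j) = g j \<otimes> XY j \<otimes> g j" using step by (intro XY_Suc) simp
  have c: "g j \<in> carrier S" "XY j \<in> carrier S" using j XY_closed[of j] by auto
  show ?case
  proof (cases "j = 1")
    case True
    have c1: "g 1 \<in> carrier S" and X1: "XY (Suc j) = g 1 \<otimes> x \<otimes> g 1" using c X True by simp_all
    have "x \<otimes> (g 1 \<otimes> x \<otimes> g 1) = x \<otimes> g 1 \<otimes> x \<otimes> g 1" using c1 by (simp only: m_assoc m_closed x_closed)
    also have "\<dots> = g 1 \<otimes> x \<otimes> g 1 \<otimes> x" using gx_braid j True by (intro gx_braid[symmetric]) simp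
    finally show ?thesis unfolding X1 .
  next
    case False
    have comm: "g j \<otimes> x = x \<otimes> g j" using False j by (intro gx_commute) auto
    have "XY j \<otimes> x = x \<otimes> XY j" using step by simp
    then show ?thesis unfolding X
      by (intro swap_commute[symmetric] swap_commute m_closed c comm x_closed)
  qed
qed simp

lemma XY_commute:
  assumes "1 \<le> i" "i \<le> n" "1 \<le> j" "j \<le> n"
  shows "XY i \<otimes> XY j = XY j \<otimes> XY i"
proof -
  have *: "XY i \<otimes> XY j = XY j \<otimes> XY i" if "1 \<le> i" "i < j" "j \<le> n" for i j
    using that(1,2)
  proof (induction i rule: dec_induct)
    case base
    then show ?case using x_XY[of j] that by simp
  next
    case (step i)
    have X: "XY (Suc i) = g i \<otimes> XY i \<otimes> g i" using step by (intro XY_Suc) simp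
    have c: "g i \<in> carrier S" "XY i \<in> carrier S" "XY j \<in> carrier S" using step that XY_closed[of i] XY_closed[of j] by auto
    have "g i \<otimes> XY j = XY j \<otimes> g i" using step that by (intro g_XY_below) auto
    moreover have "XY i \<otimes> XY j = XY j \<otimes> XY i" using step by simp
    ultimately show ?case unfolding X by (intro swap_commute m_closed c)
  qed
  show ?thesis
  proof (cases i j rule: linorder_cases)
    case less
    then show ?thesis using *[of i j] assms by blast
  next
    case greater
    then show ?thesis using *[of j i] assms by (metis (no_types))
  qed simp
qed

lemma he_XY: "i \<in> {1..<n} \<Longrightarrow> 1 \<le> j \<Longrightarrow> j \<le> n \<Longrightarrow> he i \<otimes> XY j = XY j \<otimes> he i"
  by (intro he_commute XY_closed t_XY) auto

text \<open>Both Bernstein relations follow from \<open>X\<^sub>i\<^sub>+\<^sub>1 = g\<^sub>i X\<^sub>i g\<^sub>i\<close> and the quadratic relation, because \<open>e\<^sub>i\<close> commutes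
  with \<open>g\<^sub>i\<close> and with the variables.\<close>

lemma Bernstein_left:
  assumes i: "i \<in> {1..<n}"
  shows "XY (Suc i) \<otimes> g i = g i \<otimes> XY i \<oplus> he i \<otimes> XY (Suc i)"
proof -
  have X: "XY (Suc i) = g i \<otimes> XY i \<otimes> g i" using i by (intro XY_Suc) simp
  have c: "g i \<in> carrier S" "he i \<in> carrier S" "XY i \<in> carrier S" using i XY_closed[of i] by auto
  have eX: "he i \<otimes> XY i = XY i \<otimes> he i" using i by (intro he_XY) auto
  have "XY (Suc i) \<otimes> g i = g i \<otimes> XY i \<otimes> (\<one> \<oplus> he i \<otimes> g i)"
    unfolding gg_quadratic[OF i, symmetric] X using c by (simp add: m_assoc)
  also have "\<dots> = g i \<otimes> XY i \<oplus> g i \<otimes> (XY i \<otimes> he i) \<otimes> g i" using c by (simp add: r_distr m_assoc)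
  also have "\<dots> = g i \<otimes> XY i \<oplus> (g i \<otimes> he i) \<otimes> XY i \<otimes> g i" unfolding eX[symmetric] using c by (simp add: m_assoc)
  also have "\<dots> = g i \<otimes> XY i \<oplus> he i \<otimes> XY (Suc i)" unfolding he_g[OF i, symmetric] X using c by (simp add: m_assoc)
  finally show ?thesis .
qed

lemma Bernstein_right:
  assumes i: "i \<in> {1..<n}"
  shows "g i \<otimes> XY (Suc i) = XY i \<otimes> g i \<oplus> he i \<otimes> XY (Suc i)"
proof -
  have X: "XY (Suc i) = g i \<otimes> XY i \<otimes> g i" using i by (intro XY_Suc) simp
  have c: "g i \<in> carrier S" "he i \<in> carrier S" "XY i \<in> carrier S" using i XY_closed[of i] by auto
  have "g i \<otimes> XY (Suc i) = (\<one> \<oplus> he i \<otimes> g i) \<otimes> (XY i \<otimes> g i)"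
    unfolding gg_quadratic[OF i, symmetric] X using c by (simp add: m_assoc)
  then show ?thesis unfolding X using c by (simp add: l_distr m_assoc)
qed

subsection \<open>Standard monomials span\<close>

definition xmon :: "(nat \<Rightarrow> nat) \<Rightarrow> 'a" where "xmon = mono XY [1..<Suc n]"

lemma XY_list:
  "j \<in> set [1..<Suc n] \<Longrightarrow> XY j \<in> carrier S"
  "i \<in> set [1..<Suc n] \<Longrightarrow> j \<in> set [1..<Suc n] \<Longrightarrow> XY i \<otimes> XY j = XY j \<otimes> XY i"
  using XY_closed[of j] XY_commute[of i j] by (auto simp del: upt_Suc)

lemma xmon_closed [simp]: "xmon \<alpha> \<in> carrier S"
  unfolding xmon_def by (rule mono_closed[OF XY_list(1)])

lemma xmon_split:
  assumes "j \<in> {1..n}" "\<alpha> j = 0"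
  shows "XY j [^] m \<otimes> xmon \<alpha> = xmon (\<alpha>(j := m))"
  unfolding xmon_def by (rule mono_mult[OF XY_list]) (use assms in \<open>auto simp del: upt_Suc\<close>)

lemma Tm_xmon: "\<tau> \<in> Tm \<Longrightarrow> \<tau> \<otimes> xmon \<alpha> = xmon \<alpha> \<otimes> \<tau>"
proof (erule Tm_commute)
  fix j assume "j \<in> {1..n}"
  then show "t j \<otimes> xmon \<alpha> = xmon \<alpha> \<otimes> t j"
    unfolding xmon_def by (intro mono_commute XY_list(1) t_closed disjI2 t_XY) auto
qed simp

definition NB :: "'a set" where
  "NB = {xmon \<alpha> \<otimes> w | \<alpha> w. (\<forall>j\<in>{1..n}. \<alpha> j < d) \<and> w \<in> HW n}"

lemma HW_closed: "w \<in> HW n \<Longrightarrow> w \<in> carrier S"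
  using HW_subset[of n] by auto

lemma NB_subset: "NB \<subseteq> carrier S"
  by (auto simp: NB_def HW_closed)

lemma NB_I: "(\<And>j. j \<in> {1..n} \<Longrightarrow> \<alpha> j < d) \<Longrightarrow> w \<in> HW n \<Longrightarrow> xmon \<alpha> \<otimes> w \<in> rspan NB"
  by (intro rspan_base NB_subset) (unfold NB_def, blast)

lemma NB_I':
  assumes "\<And>j. j \<in> {1..n} \<Longrightarrow> \<alpha> j < d" "w \<in> rspan (HW n)"
  shows "xmon \<alpha> \<otimes> w \<in> rspan NB"
  by (rule rspan_lin[OF HW_subset NB_subset xmon_closed NB_I assms(2)]) (use assms(1) in auto)

lemma T_NB:
  assumes \<tau>: "\<tau> \<in> rspan Tm" and v: "v \<in> rspan NB"
  shows "\<tau> \<otimes> v \<in> rspan NB"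
proof (rule rspan_lin_right[OF Tm_subset NB_subset rspan_carrier[OF NB_subset v] _ \<tau>])
  fix \<tau>1 assume \<tau>1: "\<tau>1 \<in> Tm"
  show "\<tau>1 \<otimes> v \<in> rspan NB"
  proof (rule rspan_lin[OF NB_subset NB_subset Tm_closed[OF \<tau>1] _ v])
    fix y assume "y \<in> NB"
    then obtain \<alpha> w where y: "y = xmon \<alpha> \<otimes> w" and \<alpha>: "\<And>j. j \<in> {1..n} \<Longrightarrow> \<alpha> j < d" and w: "w \<in> HW n"
      unfolding NB_def by blast
    have "\<tau>1 \<otimes> y = (\<tau>1 \<otimes> xmon \<alpha>) \<otimes> w" using y \<tau>1 HW_closed[OF w] by (simp add: m_assoc)
    also have "\<dots> = xmon \<alpha> \<otimes> (\<tau>1 \<otimes> w)" unfolding Tm_xmon[OF \<tau>1] using \<tau>1 HW_closed[OF w] by (simp add: m_assoc)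
    also have "\<dots> \<in> rspan NB"
      by (intro NB_I' \<alpha> T_HW rspan_base Tm_subset HW_subset \<tau>1 w) auto
    finally show "\<tau>1 \<otimes> y \<in> rspan NB" .
  qed
qed

lemma g_HW:
  assumes i: "i \<in> {1..<n}" and w: "w \<in> HW n"
  shows "g i \<otimes> w \<in> rspan (HW n)"
proof -
  obtain \<tau> u where w: "w = \<tau> \<otimes> gw u" "\<tau> \<in> Tm" "u \<in> normal_words n" using w by (rule HW_E)
  obtain \<tau>' where \<tau>': "\<tau>' \<in> Tm" "g i \<otimes> \<tau> = \<tau>' \<otimes> g i" using g_Tm[OF w(2) i] by blast
  have c: "g i \<in> carrier S" "\<tau> \<in> carrier S" "\<tau>' \<in> carrier S" "gw u \<in> carrier S"
    using i w \<tau>' gw_closed[OF normal_words_letters'[OF order.refl w(3)]] by auto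
  have "g i \<otimes> w = (g i \<otimes> \<tau>) \<otimes> gw u" unfolding w(1) using c by (simp add: m_assoc)
  also have "\<dots> = \<tau>' \<otimes> (g i \<otimes> gw u)" unfolding \<tau>'(2) using c by (simp add: m_assoc)
  also have "\<dots> \<in> rspan (HW n)"
    by (intro T_HW g_normal_word rspan_base Tm_subset \<tau>' i w) auto
  finally show ?thesis .
qed

text \<open>\<open>g\<^sub>i\<close> commutes with all variables except \<open>X\<^sub>i\<close> and \<open>X\<^sub>i\<^sub>+\<^sub>1\<close>, and moving it past these two keeps the
  exponents below \<open>d\<close>.\<close>

lemma g_NB:
  assumes i: "i \<in> {1..<n}" and v: "v \<in> rspan NB"
  shows "g i \<otimes> v \<in> rspan NB"
proof (rule rspan_lin[OF NB_subset NB_subset g_closed[OF i] _ v])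
  fix y assume "y \<in> NB"
  then obtain \<alpha> w where y: "y = xmon \<alpha> \<otimes> w" and \<alpha>: "\<And>j. j \<in> {1..n} \<Longrightarrow> \<alpha> j < d" and w: "w \<in> HW n"
    unfolding NB_def by blast
  have ij: "i \<in> {1..n}" "Suc i \<in> {1..n}" using i by auto
  let ?Z = "XY i" and ?Z' = "XY (Suc i)"
  define a b where "a = \<alpha> i" and "b = \<alpha> (Suc i)"
  define \<alpha>0 where "\<alpha>0 = \<alpha>(i := 0, Suc i := 0)"
  have c: "g i \<in> carrier S" "he i \<in> carrier S" "?Z \<in> carrier S" "?Z' \<in> carrier S" "w \<in> carrier S" "xmon \<alpha>0 \<in> carrier S"
    using i XY_closed[of i] XY_closed[of "Suc i"] HW_closed[OF w] by auto
  have split: "?Z [^] p \<otimes> ?Z' [^] q \<otimes> xmon \<alpha>0 = xmon (\<alpha>0(Suc i := q, i := p))" for p q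
  proof -
    have "?Z' [^] q \<otimes> xmon \<alpha>0 = xmon (\<alpha>0(Suc i := q))" by (rule xmon_split[OF ij(2)]) (simp add: \<alpha>0_def)
    moreover have "?Z [^] p \<otimes> xmon (\<alpha>0(Suc i := q)) = xmon (\<alpha>0(Suc i := q, i := p))"
      by (rule xmon_split[OF ij(1)]) (simp add: \<alpha>0_def)
    ultimately show ?thesis using c by (simp add: m_assoc)
  qed
  have bound: "(\<alpha>0(Suc i := q, i := p)) j < d" if "p \<le> max a b" "q \<le> max a b" "j \<in> {1..n}" for p q j
    using that \<alpha>[OF ij(1)] \<alpha>[OF ij(2)] \<alpha>[OF that(3)] by (auto simp: \<alpha>0_def a_def b_def)
  have "\<alpha>0(Suc i := b, i := a) = \<alpha>" by (auto simp: \<alpha>0_def a_def b_def)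
  then have ya: "y = ?Z [^] a \<otimes> ?Z' [^] b \<otimes> xmon \<alpha>0 \<otimes> w" unfolding split y by simp
  have gM: "g i \<otimes> xmon \<alpha>0 = xmon \<alpha>0 \<otimes> g i" unfolding xmon_def
  proof (rule mono_commute[OF c(1) XY_list(1)])
    fix j assume j: "j \<in> set [1..<Suc n]"
    consider "j = i \<or> j = Suc i" | "j < i" | "i + 2 \<le> j" by linarith
    then show "\<alpha>0 j = 0 \<or> g i \<otimes> XY j = XY j \<otimes> g i"
    proof cases
      case 2
      then show ?thesis using i j by (intro disjI2 g_XY_above) auto
    next
      case 3
      then show ?thesis using i j by (intro disjI2 g_XY_below) auto
    qed (auto simp: \<alpha>0_def)
  qed
  obtain p where p: "p \<in> rspan (monomials ?Z ?Z' (max a b))"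
    and eq: "g i \<otimes> (?Z [^] a \<otimes> ?Z' [^] b) = (?Z [^] b \<otimes> ?Z' [^] a) \<otimes> g i \<oplus> he i \<otimes> p"
    using Bernstein_monomial[OF c(1-4) XY_commute he_XY[OF i] he_XY[OF i] Bernstein_left[OF i] Bernstein_right[OF i], of a b] ij
    by auto
  have msub: "monomials ?Z ?Z' (max a b) \<subseteq> carrier S" using c by (auto simp: monomials_def)
  have pc: "p \<in> carrier S" by (rule rspan_carrier[OF msub p])
  have "g i \<otimes> y = (g i \<otimes> (?Z [^] a \<otimes> ?Z' [^] b)) \<otimes> (xmon \<alpha>0 \<otimes> w)" unfolding ya using c by (simp add: m_assoc)
  also have "\<dots> = ?Z [^] b \<otimes> ?Z' [^] a \<otimes> (g i \<otimes> xmon \<alpha>0) \<otimes> w \<oplus> he i \<otimes> (p \<otimes> (xmon \<alpha>0 \<otimes> w))"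
    unfolding eq using c pc by (simp add: l_distr m_assoc)
  also have "\<dots> = (?Z [^] b \<otimes> ?Z' [^] a \<otimes> xmon \<alpha>0) \<otimes> (g i \<otimes> w) \<oplus> he i \<otimes> (p \<otimes> (xmon \<alpha>0 \<otimes> w))"
    unfolding gM using c pc by (simp add: m_assoc)
  also have "\<dots> \<in> rspan NB"
  proof (rule rspan_add[OF NB_subset])
    show "?Z [^] b \<otimes> ?Z' [^] a \<otimes> xmon \<alpha>0 \<otimes> (g i \<otimes> w) \<in> rspan NB"
      unfolding split by (rule NB_I'[OF bound g_HW[OF i w]]) auto
    have "p \<otimes> (xmon \<alpha>0 \<otimes> w) \<in> rspan NB"
    proof (rule rspan_lin_right[OF msub NB_subset _ _ p])
      fix m assume "m \<in> monomials ?Z ?Z' (max a b)"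
      then obtain k l where m: "m = ?Z [^] k \<otimes> ?Z' [^] l" "k \<le> max a b" "l \<le> max a b" unfolding monomials_def by blast
      have "m \<otimes> (xmon \<alpha>0 \<otimes> w) = (?Z [^] k \<otimes> ?Z' [^] l \<otimes> xmon \<alpha>0) \<otimes> w" unfolding m(1) using c by (simp add: m_assoc)
      then show "m \<otimes> (xmon \<alpha>0 \<otimes> w) \<in> rspan NB" unfolding split by (simp only: NB_I[where \<alpha> = "\<alpha>0(Suc i := l, i := k)", OF bound[OF m(2,3)] w])
    qed (use c in simp)
    then show "he i \<otimes> (p \<otimes> (xmon \<alpha>0 \<otimes> w)) \<in> rspan NB" by (rule T_NB[OF he_span[OF i]])
  qed
  finally show "g i \<otimes> y \<in> rspan NB" .
qed

lemma x_pow_NB: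
  assumes \<alpha>: "\<And>j. j \<in> {1..n} \<Longrightarrow> \<alpha> j < d" "\<alpha> 1 = 0" and w: "w \<in> HW n"
    and y: "y \<in> rspan ((\<lambda>m. x [^] m) ` {..<d})"
  shows "y \<otimes> (xmon \<alpha> \<otimes> w) \<in> rspan NB"
proof (rule rspan_lin_right[OF _ NB_subset _ _ y])
  fix z assume "z \<in> (\<lambda>m. x [^] m) ` {..<d}"
  then obtain m where z: "z = x [^] m" "m < d" by auto
  have "x [^] m \<otimes> (xmon \<alpha> \<otimes> w) = (XY 1 [^] m \<otimes> xmon \<alpha>) \<otimes> w" using HW_closed[OF w] by (simp add: m_assoc)
  also have "XY 1 [^] m \<otimes> xmon \<alpha> = xmon (\<alpha>(1 := m))" using n_pos \<alpha>(2) by (intro xmon_split) auto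
  also have "xmon (\<alpha>(1 := m)) \<otimes> w \<in> rspan NB" using \<alpha>(1) z(2) w by (intro NB_I) auto
  finally show "z \<otimes> (xmon \<alpha> \<otimes> w) \<in> rspan NB" unfolding z(1) .
qed (use HW_closed[OF w] in auto)

text \<open>Since \<open>X\<^sub>1\<close> is the first variable of a monomial, only a power of \<open>X\<^sub>1\<close> has to be reduced.\<close>

lemma x_NB:
  assumes v: "v \<in> rspan NB"
  shows "x \<otimes> v \<in> rspan NB" "xi \<otimes> v \<in> rspan NB"
proof -
  have "x \<otimes> y \<in> rspan NB \<and> xi \<otimes> y \<in> rspan NB" if "y \<in> NB" for y
  proof -
    from that obtain \<alpha> w where y: "y = xmon \<alpha> \<otimes> w" and \<alpha>: "\<And>j. j \<in> {1..n} \<Longrightarrow> \<alpha> j < d" and w: "w \<in> HW n"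
      unfolding NB_def by blast
    define a where "a = \<alpha> 1"
    let ?\<alpha> = "\<alpha>(1 := 0)"
    have ad: "a < d" using \<alpha>[of 1] n_pos by (simp add: a_def)
    have \<alpha>0: "\<And>j. j \<in> {1..n} \<Longrightarrow> ?\<alpha> j < d" "?\<alpha> 1 = 0" using \<alpha> ad by auto
    have reduce: "z \<otimes> (xmon ?\<alpha> \<otimes> w) \<in> rspan NB" if "z \<in> rspan ((\<lambda>m. x [^] m) ` {..<d})" for z
      by (rule x_pow_NB) (use \<alpha>0 w that in auto)
    have xsub: "(\<lambda>m. x [^] m) ` {..<d} \<subseteq> carrier S" by auto
    have low: "x [^] m \<in> rspan ((\<lambda>m. x [^] m) ` {..<d})" if "m \<le> d" for m
      using that x_reduce rspan_base[OF xsub, of "x [^] m"] by (cases "m = d") auto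
    have "xmon \<alpha> = XY 1 [^] a \<otimes> xmon ?\<alpha>"
      using xmon_split[of 1 ?\<alpha> a] n_pos by (simp add: a_def)
    then have ya: "y = x [^] a \<otimes> (xmon ?\<alpha> \<otimes> w)" using y HW_closed[OF w] by (simp add: m_assoc)
    have wc: "xmon ?\<alpha> \<otimes> w \<in> carrier S" using HW_closed[OF w] by simp
    have "x \<otimes> y = x [^] Suc a \<otimes> (xmon ?\<alpha> \<otimes> w)"
      unfolding ya nat_pow_Suc2[OF x_closed] using wc by (simp only: m_assoc x_closed nat_pow_closed)
    then have 1: "x \<otimes> y \<in> rspan NB" using reduce[OF low[of "Suc a"]] ad by simp
    have 2: "xi \<otimes> y \<in> rspan NB"
    proof (cases a)
      case 0
      then show ?thesis using reduce[OF xi_reduce] wc by (simp add: ya)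
    next
      case (Suc k)
      have "xi \<otimes> y = (xi \<otimes> x) \<otimes> x [^] k \<otimes> (xmon ?\<alpha> \<otimes> w)"
        unfolding ya Suc nat_pow_Suc2[OF x_closed] using wc by (simp only: m_assoc x_closed xi_closed nat_pow_closed m_closed)
      then have "xi \<otimes> y = x [^] k \<otimes> (xmon ?\<alpha> \<otimes> w)" using wc by (simp add: xi_x)
      then show ?thesis using reduce[OF low[of k]] ad Suc by simp
    qed
    show ?thesis using 1 2 ..
  qed
  then show "x \<otimes> v \<in> rspan NB" "xi \<otimes> v \<in> rspan NB"
    using rspan_lin[OF NB_subset NB_subset x_closed _ v] rspan_lin[OF NB_subset NB_subset xi_closed _ v] by blast+
qed

lemma Nil_normal_words: "[] \<in> normal_words m"
proof (induction m)
  case (Suc m)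
  have "[] = [Suc m..<Suc m] @ []" by simp
  then show ?case using Suc unfolding normal_words.simps by fastforce
qed simp

lemma one_NB: "1 \<le> d \<Longrightarrow> \<one> \<in> rspan NB"
proof -
  assume d: "1 \<le> d"
  have "mono z l (\<lambda>_. 0) = \<one>" for z l by (induction l) (simp_all add: mono_Nil mono_Cons)
  then have "xmon (\<lambda>_. 0) \<otimes> (\<one> \<otimes> gw []) = \<one>" by (simp add: xmon_def)
  moreover have "xmon (\<lambda>_. 0) \<otimes> (\<one> \<otimes> gw []) \<in> rspan NB"
    using d by (intro NB_I HW_I Tm.one Nil_normal_words) auto
  ultimately show ?thesis by simp
qed

definition tmon :: "(nat \<Rightarrow> nat) \<Rightarrow> 'a" where "tmon = mono t [1..<Suc n]"

lemma tmon_closed [simp]: "tmon \<beta> \<in> carrier S"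
  unfolding tmon_def by (rule mono_closed) auto

lemma t_pow_mod: "j \<in> {1..n} \<Longrightarrow> t j [^] (k mod r) = t j [^] k"
proof -
  assume j: "j \<in> {1..n}"
  then have c: "t j \<in> carrier S" by simp
  have "t j [^] k = t j [^] (r * (k div r) + k mod r)" by simp
  also have "\<dots> = (t j [^] r) [^] (k div r) \<otimes> t j [^] (k mod r)"
    using c by (simp only: nat_pow_mult[symmetric] nat_pow_pow)
  finally show ?thesis using c by (simp add: t_ord[OF j])
qed

lemma Tm_tmon:
  assumes "\<tau> \<in> Tm"
  shows "\<exists>\<beta>\<in>{1..n} \<rightarrow>\<^sub>E {..<r}. \<tau> = tmon \<beta>"
  using assms
proof induction
  case one
  have "mono t l (\<lambda>j. if j \<in> A then 0 else undefined) = \<one>" if "set l \<subseteq> A" for l A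
    using that by (induction l) (simp_all add: mono_Nil mono_Cons)
  from this[of "[1..<Suc n]" "{1..n}"] have "tmon (\<lambda>j\<in>{1..n}. 0) = \<one>"
    by (simp add: tmon_def restrict_def atLeastLessThanSuc_atLeastAtMost del: upt_Suc)
  moreover have "(\<lambda>j\<in>{1..n}. 0) \<in> {1..n} \<rightarrow>\<^sub>E {..<r}" using r_pos by auto
  ultimately show ?case by metis
next
  case (step j \<tau>)
  then obtain \<beta> where \<beta>: "\<beta> \<in> {1..n} \<rightarrow>\<^sub>E {..<r}" and \<tau>: "\<tau> = tmon \<beta>" by blast
  note j = step(1)
  have tl: "\<And>i. i \<in> set [1..<Suc n] \<Longrightarrow> t i \<in> carrier S"
    "\<And>i k. i \<in> set [1..<Suc n] \<Longrightarrow> k \<in> set [1..<Suc n] \<Longrightarrow> t i \<otimes> t k = t k \<otimes> t i"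
    by (auto intro: tt_commute)
  have jl: "distinct [1..<Suc n]" "j \<in> set [1..<Suc n]" using j by auto
  let ?\<beta> = "\<beta>(j := Suc (\<beta> j) mod r)"
  have z: "(\<beta>(j := 0)) j = 0" by simp
  have tc: "t j \<in> carrier S" using j by simp
  have M: "mono t [1..<Suc n] (\<beta>(j := 0)) \<in> carrier S" using tl(1) by (rule mono_closed)
  have "t j \<otimes> \<tau> = t j \<otimes> (t j [^] \<beta> j \<otimes> mono t [1..<Suc n] (\<beta>(j := 0)))"
    unfolding \<tau> tmon_def using mono_extract[where z = t, OF tl jl, of \<beta>] by simp
  also have "\<dots> = t j [^] Suc (\<beta> j) \<otimes> mono t [1..<Suc n] (\<beta>(j := 0))"
    unfolding nat_pow_Suc2[OF tc] using tc M by (simp only: m_assoc nat_pow_closed)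
  also have "\<dots> = t j [^] (Suc (\<beta> j) mod r) \<otimes> mono t [1..<Suc n] (\<beta>(j := 0))" by (simp only: t_pow_mod[OF j])
  also have "\<dots> = tmon ?\<beta>"
    unfolding tmon_def using mono_mult[where z = t and \<alpha> = "\<beta>(j := 0)" and m = "Suc (\<beta> j) mod r", OF tl jl z] by simp
  finally have "t j \<otimes> \<tau> = tmon ?\<beta>" .
  moreover have "?\<beta> \<in> {1..n} \<rightarrow>\<^sub>E {..<r}" using \<beta> j r_pos by (auto simp: PiE_iff extensional_def)
  ultimately show ?case by blast
qed

definition standard :: "'a set" where
  "standard = {xmon \<alpha> \<otimes> tmon \<beta> \<otimes> gw u | \<alpha> \<beta> u.
     \<alpha> \<in> {1..n} \<rightarrow>\<^sub>E {..<d} \<and> \<beta> \<in> {1..n} \<rightarrow>\<^sub>E {..<r} \<and> u \<in> normal_words n}"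

lemma NB_standard: "NB \<subseteq> standard"
proof
  fix y assume "y \<in> NB"
  then obtain \<alpha> w where y: "y = xmon \<alpha> \<otimes> w" and \<alpha>: "\<And>j. j \<in> {1..n} \<Longrightarrow> \<alpha> j < d" and w: "w \<in> HW n"
    unfolding NB_def by blast
  obtain \<tau> u where w: "w = \<tau> \<otimes> gw u" "\<tau> \<in> Tm" "u \<in> normal_words n" using w by (rule HW_E)
  obtain \<beta> where \<beta>: "\<beta> \<in> {1..n} \<rightarrow>\<^sub>E {..<r}" "\<tau> = tmon \<beta>" using Tm_tmon[OF w(2)] by blast
  have "xmon \<alpha> = xmon (restrict \<alpha> {1..n})" unfolding xmon_def by (rule mono_cong) auto
  then have "y = xmon (restrict \<alpha> {1..n}) \<otimes> tmon \<beta> \<otimes> gw u"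
    unfolding y w(1) \<beta>(2) using gw_closed[OF normal_words_letters'[OF order.refl w(3)]] by (simp add: m_assoc)
  moreover have "restrict \<alpha> {1..n} \<in> {1..n} \<rightarrow>\<^sub>E {..<d}" using \<alpha> by auto
  ultimately show "y \<in> standard" unfolding standard_def using \<beta>(1) w(3) by blast
qed

lemma NB_rspan_standard: "v \<in> rspan NB \<Longrightarrow> v \<in> rspan standard"
proof (induction rule: rspan.induct)
  case (step c w v)
  then show ?case using NB_standard by (intro rspan.step) auto
qed (rule rspan.zero)

end


section \<open>Algebras by generators and relations\<close>

subsection \<open>Quotient algebras\<close>

lemma quotient_algebra_fields [simp]:
  "carrier (quotient_algebra A J) = carrier (A Quot J)"
  "mult (quotient_algebra A J) = mult (A Quot J)"
  "one (quotient_algebra A J) = one (A Quot J)"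
  "zero (quotient_algebra A J) = zero (A Quot J)"
  "add (quotient_algebra A J) = add (A Quot J)"
  "smult (quotient_algebra A J) = (\<lambda>c C. \<Union>x\<in>C. J +>\<^bsub>A\<^esub> (c \<odot>\<^bsub>A\<^esub> x))"
  by (simp_all add: quotient_algebra_def ring.defs module.defs)

lemma ring_cong:
  assumes R: "ring R" and eq: "carrier S = carrier R" "mult S = mult R" "one S = one R" "zero S = zero R" "add S = add R"
  shows "ring S"
proof -
  interpret R: ring R by fact
  show ?thesis
  proof (rule ringI)
    show "abelian_group S"
    proof (rule abelian_groupI)
      fix x assume "x \<in> carrier S"
      then show "\<exists>y\<in>carrier S. y \<oplus>\<^bsub>S\<^esub> x = \<zero>\<^bsub>S\<^esub>"
        unfolding eq by (intro bexI[of _ "\<ominus>\<^bsub>R\<^esub> x"]) (auto simp: R.l_neg)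
    qed (simp_all add: eq R.a_ac)
    show "monoid S" by (rule monoidI) (simp_all add: eq R.m_assoc)
  qed (simp_all add: eq R.l_distr R.r_distr)
qed

lemma ideal_cong:
  assumes K: "ideal K R" and eq: "carrier S = carrier R" "mult S = mult R" "one S = one R" "zero S = zero R" "add S = add R"
  shows "ideal K S"
proof -
  interpret K: ideal K R by fact
  have inv: "inv\<^bsub>add_monoid S\<^esub> x = inv\<^bsub>add_monoid R\<^esub> x" for x by (simp add: m_inv_def eq)
  have "subgroup K (add_monoid S)"
    using subgroup.subset[OF K.a_subgroup] subgroup.m_closed[OF K.a_subgroup]
      subgroup.one_closed[OF K.a_subgroup] subgroup.m_inv_closed[OF K.a_subgroup]
    by (intro subgroup.intro) (unfold inv, simp_all add: eq)
  then show ?thesis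
    by (intro idealI ring_cong[OF K.ring_axioms eq]) (auto simp: eq K.I_l_closed K.I_r_closed)
qed

locale quotient_alg =
  fixes A :: "('c, 'a) module" and J :: "'a set"
  assumes ring_A: "ring A" and ideal_J: "ideal J A"
begin

interpretation A: ring A by (rule ring_A)
interpretation J: ideal J A by (rule ideal_J)

abbreviation "B \<equiv> quotient_algebra A J"
abbreviation "q p \<equiv> J +>\<^bsub>A\<^esub> p"

lemma ring_B: "ring B"
  by (rule ring_cong[OF J.quotient_is_ring]) simp_all

lemma q_hom: "(\<lambda>p. q p) \<in> ring_hom A B"
  using J.rcos_ring_hom by (simp add: ring_hom_def)

lemma carrier_B: "carrier B = (\<lambda>p. q p) ` carrier A"
  by (auto simp: FactRing_def A_RCOSETS_def')

lemma q_zero: "p \<in> carrier A \<Longrightarrow> q p = \<zero>\<^bsub>B\<^esub> \<longleftrightarrow> p \<in> J"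
  using A.a_rcos_zero[OF ideal_J, of p] J.rcos_const_imp_mem[of p] by (auto simp: FactRing_def)

lemma q_eq: "p \<in> carrier A \<Longrightarrow> p' \<in> carrier A \<Longrightarrow> q p = q p' \<longleftrightarrow> p \<ominus>\<^bsub>A\<^esub> p' \<in> J"
  using A.quotient_eq_iff_same_a_r_cos[OF ideal_J] by simp

lemma ideal_image: "ideal K A \<Longrightarrow> ideal ((\<lambda>p. q p) ` K) B"
  by (rule ideal_cong[OF A.ring_ideal_imp_quot_ideal[OF ideal_J]]) simp_all

lemma smult_q:
  assumes c: "\<And>p. p \<in> carrier A \<Longrightarrow> c \<odot>\<^bsub>A\<^esub> p \<in> carrier A"
    "\<And>p p'. p \<in> carrier A \<Longrightarrow> p' \<in> carrier A \<Longrightarrow> c \<odot>\<^bsub>A\<^esub> (p \<oplus>\<^bsub>A\<^esub> p') = c \<odot>\<^bsub>A\<^esub> p \<oplus>\<^bsub>A\<^esub> c \<odot>\<^bsub>A\<^esub> p'"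
    "\<And>p. p \<in> J \<Longrightarrow> c \<odot>\<^bsub>A\<^esub> p \<in> J"
    and p: "p \<in> carrier A"
  shows "c \<odot>\<^bsub>B\<^esub> q p = q (c \<odot>\<^bsub>A\<^esub> p)"
proof -
  have "q (c \<odot>\<^bsub>A\<^esub> x) = q (c \<odot>\<^bsub>A\<^esub> p)" if "x \<in> q p" for x
  proof -
    from that obtain j where j: "j \<in> J" "x = j \<oplus>\<^bsub>A\<^esub> p" by (auto simp: a_r_coset_def')
    have jc: "j \<in> carrier A" using j(1) by (rule J.Icarr)
    have "q (c \<odot>\<^bsub>A\<^esub> x) = (J +>\<^bsub>A\<^esub> (c \<odot>\<^bsub>A\<^esub> j)) +>\<^bsub>A\<^esub> (c \<odot>\<^bsub>A\<^esub> p)"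
      unfolding j(2) c(2)[OF jc p] using c(1)[OF jc] c(1)[OF p] J.a_subset by (simp add: A.a_coset_add_assoc)
    then show ?thesis using A.a_rcos_zero[OF ideal_J c(3)[OF j(1)]] by simp
  qed
  note const = this
  have "(\<Union>x\<in>q p. q (c \<odot>\<^bsub>A\<^esub> x)) = (\<Union>x\<in>q p. q (c \<odot>\<^bsub>A\<^esub> p))"
    by (rule SUP_cong[OF refl const])
  also have "\<dots> = q (c \<odot>\<^bsub>A\<^esub> p)" using J.a_rcos_self[OF p] by blast
  finally show ?thesis by simp
qed

end

subsection \<open>Subrings of a ring type\<close>

lemma ring_of_closed:
  fixes A :: "('r::ring_1, 'm) ring_scheme"
  assumes eq: "mult A = (*)" "one A = 1" "zero A = 0" "add A = (+)"
    and closed: "1 \<in> carrier A" "\<And>p p'. p \<in> carrier A \<Longrightarrow> p' \<in> carrier A \<Longrightarrow> p + p' \<in> carrier A"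
    "\<And>p p'. p \<in> carrier A \<Longrightarrow> p' \<in> carrier A \<Longrightarrow> p * p' \<in> carrier A" "\<And>p. p \<in> carrier A \<Longrightarrow> - p \<in> carrier A"
  shows "ring A"
proof -
  have zero: "0 \<in> carrier A" using closed(2)[OF closed(1) closed(4)[OF closed(1)]] by simp
  show ?thesis
  proof (rule ringI)
    show "abelian_group A"
    proof (rule abelian_groupI)
      fix x assume "x \<in> carrier A"
      then show "\<exists>y\<in>carrier A. y \<oplus>\<^bsub>A\<^esub> x = \<zero>\<^bsub>A\<^esub>"
        unfolding eq by (intro bexI[of _ "- x"] closed) simp
    qed (simp_all add: eq closed zero algebra_simps)
    show "monoid A" by (rule monoidI) (simp_all add: eq closed mult.assoc)
  qed (simp_all add: eq algebra_simps)
qed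

lemma a_inv_of_closed:
  fixes A :: "('r::ring_1, 'm) ring_scheme"
  assumes "ring A" and eq: "zero A = 0" "add A = (+)" and "p \<in> carrier A" "- p \<in> carrier A"
  shows "\<ominus>\<^bsub>A\<^esub> p = - p"
proof -
  interpret ring A by fact
  show ?thesis using minus_equality[of "- p" p] assms by (simp add: eq)
qed

text \<open>Carrier sets of the ground ring and of the free algebra have this common form.\<close>

definition polys :: "'c::ring_1 set \<Rightarrow> 'k set \<Rightarrow> ('k::monoid_add \<Rightarrow>\<^sub>0 'c) set" where
  "polys C M = {p. (\<forall>k. Poly_Mapping.lookup p k \<in> C) \<and> Poly_Mapping.keys p \<subseteq> M}"

locale coeff_closed =
  fixes C :: "'c::comm_ring_1 set" and M :: "'k::monoid_add set"
  assumes C_one: "1 \<in> C" and C_add: "\<And>a b. a \<in> C \<Longrightarrow> b \<in> C \<Longrightarrow> a + b \<in> C"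
    and C_mult: "\<And>a b. a \<in> C \<Longrightarrow> b \<in> C \<Longrightarrow> a * b \<in> C" and C_minus: "\<And>a. a \<in> C \<Longrightarrow> - a \<in> C"
    and M_zero: "0 \<in> M" and M_add: "\<And>k l. k \<in> M \<Longrightarrow> l \<in> M \<Longrightarrow> k + l \<in> M"
begin

lemma C_zero: "0 \<in> C" using C_add[OF C_one C_minus[OF C_one]] by simp

lemma polys_single: "c \<in> C \<Longrightarrow> k \<in> M \<Longrightarrow> Poly_Mapping.single k c \<in> polys C M"
  by (auto simp: polys_def lookup_single when_def C_zero)

lemma polys_zero: "0 \<in> polys C M" by (simp add: polys_def C_zero)

lemma polys_one: "1 \<in> polys C M"
  using polys_single[OF C_one M_zero] by simp

lemma polys_add: "p \<in> polys C M \<Longrightarrow> p' \<in> polys C M \<Longrightarrow> p + p' \<in> polys C M"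
  using keys_add[of p p'] by (auto simp: polys_def lookup_add C_add)

lemma polys_minus: "p \<in> polys C M \<Longrightarrow> - p \<in> polys C M"
  by (auto simp: polys_def C_minus)

lemma polys_diff: "p \<in> polys C M \<Longrightarrow> p' \<in> polys C M \<Longrightarrow> p - p' \<in> polys C M"
  using polys_add[of p "- p'"] polys_minus by simp

lemma polys_sum: "(\<And>i. i \<in> I \<Longrightarrow> h i \<in> polys C M) \<Longrightarrow> (\<Sum>i\<in>I. h i) \<in> polys C M"
  by (induction I rule: infinite_finite_induct) (auto intro: polys_zero polys_add)

lemma sum_single: "p = (\<Sum>k\<in>Poly_Mapping.keys p. Poly_Mapping.single k (Poly_Mapping.lookup p k))"
  by (rule poly_mapping_eqI) (simp add: lookup_sum lookup_single when_def in_keys_iff)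

lemma polys_mult:
  assumes "p \<in> polys C M" "p' \<in> polys C M"
  shows "p * p' \<in> polys C M"
proof -
  have "p * p' = (\<Sum>k\<in>Poly_Mapping.keys p. \<Sum>l\<in>Poly_Mapping.keys p'.
      Poly_Mapping.single (k + l) (Poly_Mapping.lookup p k * Poly_Mapping.lookup p' l))"
    by (subst sum_single[of p], subst sum_single[of p']) (simp add: sum_product mult_single)
  also have "\<dots> \<in> polys C M"
    using assms by (intro polys_sum polys_single C_mult M_add) (auto simp: polys_def)
  finally show ?thesis .
qed

lemma polys_power: "p \<in> polys C M \<Longrightarrow> p ^ k \<in> polys C M"
  by (induction k) (auto intro: polys_one polys_mult)

lemma polys_prod_list: "(\<And>p. p \<in> set ps \<Longrightarrow> p \<in> polys C M) \<Longrightarrow> prod_list ps \<in> polys C M"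
  by (induction ps) (auto intro: polys_one polys_mult)

end

subsection \<open>The ground ring\<close>

lemma ring_ring_on_UNIV: "ring (ring_on (UNIV :: 'r::ring_1 set))"
  by (rule ring_of_closed) (simp_all add: ring_on_def)

lemma coeff_ring_closed:
  "1 \<in> coeff_ring r" "a \<in> coeff_ring r \<Longrightarrow> b \<in> coeff_ring r \<Longrightarrow> a + b \<in> coeff_ring r"
  "a \<in> coeff_ring r \<Longrightarrow> b \<in> coeff_ring r \<Longrightarrow> a * b \<in> coeff_ring r"
  "a \<in> coeff_ring r \<Longrightarrow> - a \<in> coeff_ring r"
  "1 / of_nat r \<in> coeff_ring r"
proof -
  let ?H = "{1 / of_nat r, exp (2 * of_real pi * \<i> / of_nat r)} :: complex set"
  have neg: "\<ominus>\<^bsub>ring_on UNIV\<^esub> a = - a" for a :: complex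
    using ring_ring_on_UNIV by (rule a_inv_of_closed) (simp_all add: ring_on_def)
  show "1 \<in> coeff_ring r" "1 / of_nat r \<in> coeff_ring r"
    using generate_ring.one[of "ring_on UNIV" ?H] generate_ring.incl[of "1 / of_nat r" ?H "ring_on UNIV"]
    by (simp_all add: coeff_ring_def ring_on_def)
  assume a: "a \<in> coeff_ring r"
  show "- a \<in> coeff_ring r"
    using generate_ring.a_inv[of a "ring_on UNIV" ?H] a by (simp add: coeff_ring_def neg)
  assume b: "b \<in> coeff_ring r"
  show "a + b \<in> coeff_ring r" "a * b \<in> coeff_ring r"
    using generate_ring.eng_add[of a "ring_on UNIV" ?H b] generate_ring.eng_mult[of a "ring_on UNIV" ?H b] a b
    by (simp_all add: coeff_ring_def ring_on_def)
qed

definition ground_monomials :: "nat \<Rightarrow> (indet \<Rightarrow>\<^sub>0 int) set" where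
  "ground_monomials d = {m. Poly_Mapping.keys m \<subseteq> insert Q (V ` {1..d})}"

lemma coeff_closed_ground: "coeff_closed (coeff_ring r) (ground_monomials d)"
proof
  fix k l assume "k \<in> ground_monomials d" "l \<in> ground_monomials d"
  then show "k + l \<in> ground_monomials d"
    using keys_add[of k l] by (auto simp: ground_monomials_def)
qed (simp_all add: coeff_ring_closed ground_monomials_def)

interpretation ground: coeff_closed "coeff_ring r" "ground_monomials d" for r d
  by (rule coeff_closed_ground)

lemma carrier_ground_ring: "carrier (ground_ring r d) = polys (coeff_ring r) (ground_monomials d)"
  by (auto simp: ground_ring_def ring_on_def polys_def ground_monomials_def)

abbreviation ground :: "nat \<Rightarrow> nat \<Rightarrow> laurent set" where
  "ground r d \<equiv> polys (coeff_ring r) (ground_monomials d)"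

lemma ground_constants:
  "lconst (1 / of_nat r) \<in> ground r d" "lvar Q k \<in> ground r d"
  "i \<in> {1..d} \<Longrightarrow> lvar (V i) k \<in> ground r d"
  unfolding lconst_def lvar_def
  by (intro ground.polys_single coeff_ring_closed; auto simp: ground_monomials_def)+

lemma hq_ground: "hq \<in> ground r d"
  unfolding hq_def by (intro ground.polys_diff ground_constants)

subsection \<open>The coefficients of the cyclotomic polynomial\<close>

text \<open>The coefficients of the monic polynomial with the given list of roots.\<close>

fun root_coeff :: "'c::comm_ring_1 list \<Rightarrow> nat \<Rightarrow> 'c" where
  "root_coeff [] m = (if m = 0 then 1 else 0)"
| "root_coeff (v # vs) m = (case m of 0 \<Rightarrow> 0 | Suc k \<Rightarrow> root_coeff vs k) - v * root_coeff vs m"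

lemma root_coeff_top: "root_coeff vs (length vs) = 1" "m > length vs \<Longrightarrow> root_coeff vs m = 0"
  by (induction vs arbitrary: m) (auto split: nat.split)

lemma root_coeff_zero: "root_coeff vs 0 = (\<Prod>v\<leftarrow>vs. - v)"
  by (induction vs) auto

lemma root_product:
  fixes y :: "('g, 'c::comm_ring_1) ncpoly"
  shows "(\<Prod>v\<leftarrow>vs. y - scalar v) = (\<Sum>m\<le>length vs. scalar (root_coeff vs m) * y ^ m)"
proof (induction vs)
  case (Cons v vs)
  let ?c = "root_coeff vs" and ?N = "length vs"
  have sc: "scalar (a - b :: 'c) = (scalar a - scalar b :: ('g, 'c) ncpoly)" "scalar (a * b :: 'c) = (scalar a * scalar b :: ('g, 'c) ncpoly)"
    "scalar (0::'c) = (0 :: ('g, 'c) ncpoly)" for a b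
    by (simp_all add: scalar_def single_diff mult_single)
  have comm: "y * (scalar a * z) = scalar a * (y * z)" for a :: 'c and z
    by (simp add: mult.assoc[symmetric] scalar_commute[of a y])
  have "(\<Prod>v\<leftarrow>v # vs. y - scalar v) = y * (\<Sum>m\<le>?N. scalar (?c m) * y ^ m) - scalar v * (\<Sum>m\<le>?N. scalar (?c m) * y ^ m)"
    by (simp add: Cons.IH left_diff_distrib)
  also have "y * (\<Sum>m\<le>?N. scalar (?c m) * y ^ m) = (\<Sum>m\<le>Suc ?N. scalar (case m of 0 \<Rightarrow> 0 | Suc k \<Rightarrow> ?c k) * y ^ m)"
    unfolding sum.atMost_Suc_shift by (simp add: sc sum_distrib_left comm)
  also have "scalar v * (\<Sum>m\<le>?N. scalar (?c m) * y ^ m) = (\<Sum>m\<le>Suc ?N. scalar (v * ?c m) * y ^ m)"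
    by (simp add: root_coeff_top sc sum_distrib_left mult.assoc)
  finally show ?case
    by (simp add: sum_subtractf[symmetric] sc left_diff_distrib del: sum.atMost_Suc)
qed (simp add: scalar_def)

definition cyc_coeff :: "nat \<Rightarrow> nat \<Rightarrow> laurent" where
  "cyc_coeff d = root_coeff (map (\<lambda>k. lvar (V k) 1) [1..<d + 1])"

text \<open>The inverse of the constant coefficient, up to sign the product of the \<open>v\<^sub>i\<^sup>-\<^sup>1\<close>.\<close>

definition cyc_inv :: "nat \<Rightarrow> laurent" where
  "cyc_inv d = (\<Prod>k\<leftarrow>[1..<d + 1]. - lvar (V k) (- 1))"

lemma f1_expand: "f1 d = (\<Sum>m\<le>d. scalar (cyc_coeff d m) * gen X1 ^ m)"
  unfolding f1_def cyc_coeff_def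
  using root_product[of "gen X1" "map (\<lambda>k. lvar (V k) 1) [1..<d + 1]"] by (simp add: comp_def del: upt_Suc)

lemma cyc_coeff_top: "cyc_coeff d d = 1"
  using root_coeff_top(1)[of "map (\<lambda>k. lvar (V k) 1) [1..<d + 1]"] by (simp add: cyc_coeff_def del: upt_Suc)

lemma cyc_inv: "cyc_inv d * cyc_coeff d 0 = 1"
proof -
  have one: "lvar x (- 1) * lvar x 1 = 1" for x
    by (simp add: lvar_def mult_single flip: single_add)
  have "(\<Prod>k\<leftarrow>ks. - lvar (V k) (- 1)) * (\<Prod>k\<leftarrow>ks. - lvar (V k) 1) = 1" for ks
  proof (induction ks)
    case (Cons k ks)
    have "(\<Prod>k\<leftarrow>k # ks. - lvar (V k) (- 1)) * (\<Prod>k\<leftarrow>k # ks. - lvar (V k) 1)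
      = (lvar (V k) (- 1) * lvar (V k) 1) * ((\<Prod>k\<leftarrow>ks. - lvar (V k) (- 1)) * (\<Prod>k\<leftarrow>ks. - lvar (V k) 1))"
      by (simp add: mult_ac)
    then show ?case unfolding one Cons.IH by simp
  qed simp
  then show ?thesis by (simp add: cyc_inv_def cyc_coeff_def root_coeff_zero comp_def del: upt_Suc)
qed

lemma cyc_inv_ground: "cyc_inv d \<in> ground r d"
  unfolding cyc_inv_def by (rule ground.polys_prod_list) (auto intro!: ground.polys_minus ground_constants)

lemma cyc_coeff_ground: "cyc_coeff d m \<in> ground r d"
proof -
  have *: "root_coeff vs m \<in> ground r d" if "set vs \<subseteq> ground r d" for vs m
    using that
    by (induction vs arbitrary: m)
      (auto intro!: ground.polys_zero ground.polys_one ground.polys_diff ground.polys_minus ground.polys_mult split: nat.split)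
  show ?thesis unfolding cyc_coeff_def by (rule *) (auto intro!: ground_constants)
qed


section \<open>The cyclotomic Yokonuma-Hecke algebra\<close>

definition monomial_index :: "nat \<Rightarrow> nat \<Rightarrow> nat \<Rightarrow> ((nat \<Rightarrow> nat) \<times> (nat \<Rightarrow> nat) \<times> (nat \<Rightarrow> nat)) set" where
  "monomial_index r n d = ({1..n} \<rightarrow>\<^sub>E {..<d}) \<times> ({1..n} \<rightarrow>\<^sub>E {..<r}) \<times> {w. w permutes {1..n}}"

lemma finite_monomial_index: "finite (monomial_index r n d)"
  unfolding monomial_index_def by (intro finite_cartesian_product finite_PiE finite_permutations) auto

definition monomial_of :: "nat \<Rightarrow> ((nat \<Rightarrow> nat) \<Rightarrow> nat list) \<Rightarrow> (nat \<Rightarrow> nat) \<times> (nat \<Rightarrow> nat) \<times> (nat \<Rightarrow> nat) \<Rightarrow> yh_free" where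
  "monomial_of n word = (\<lambda>(\<alpha>, \<beta>, w). X_mon n \<alpha> * t_mon n \<beta> * prod_list (map gg (word w)))"

text \<open>Normal words and arbitrarily chosen reduced words are both families of this kind, and the
  representations see only the permutation of an ascending word.\<close>

definition word_choice :: "nat \<Rightarrow> ((nat \<Rightarrow> nat) \<Rightarrow> nat list) \<Rightarrow> bool" where
  "word_choice n word \<longleftrightarrow> (\<forall>w. w permutes {1..n} \<longrightarrow>
     set (word w) \<subseteq> {1..<n} \<and> perm_of_word (word w) = w \<and> ascending (word w))"

lemma word_choiceD:
  assumes "word_choice n word" "w permutes {1..n}"
  shows "set (word w) \<subseteq> {1..<n}" "perm_of_word (word w) = w" "ascending (word w)"
  using assms by (auto simp: word_choice_def)

definition normal_word :: "nat \<Rightarrow> (nat \<Rightarrow> nat) \<Rightarrow> nat list" where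
  "normal_word n w = (SOME u. u \<in> normal_words n \<and> perm_of_word u = w)"

lemma normal_word:
  assumes "w permutes {1..n}"
  shows "normal_word n w \<in> normal_words n" "perm_of_word (normal_word n w) = w"
proof -
  have "\<exists>u. u \<in> normal_words n \<and> perm_of_word u = w" using normal_words_surj[OF assms] by blast
  then show "normal_word n w \<in> normal_words n" "perm_of_word (normal_word n w) = w"
    using someI_ex unfolding normal_word_def by (metis (mono_tags, lifting))+
qed

lemma normal_word_unique: "u \<in> normal_words n \<Longrightarrow> normal_word n (perm_of_word u) = u"
  using normal_word[OF perm_of_word_permutes[OF normal_words_letters]] normal_words_inj
  by (metis inj_onD)

lemma word_choice_normal: "word_choice n (normal_word n)"
  unfolding word_choice_def
  using normal_word normal_words_letters normal_words_ascending by blast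

definition reduced_word :: "nat \<Rightarrow> (nat \<Rightarrow> nat) \<Rightarrow> nat list" where
  "reduced_word n w = (SOME is. reduced_expression n is w)"

lemma word_choice_reduced: "word_choice n (reduced_word n)"
  unfolding word_choice_def
proof (intro allI impI)
  fix w assume "w permutes {1..n}"
  from reduced_expression_exists[OF this] have "reduced_expression n (reduced_word n w) w"
    unfolding reduced_word_def by (rule someI_ex)
  then show "set (reduced_word n w) \<subseteq> {1..<n} \<and> perm_of_word (reduced_word n w) = w \<and> ascending (reduced_word n w)"
    using reduced_expression_ascending by (auto simp: reduced_expression_def)
qed

lemma monomial_of_reduced: "monomial_of n (reduced_word n) (\<alpha>, \<beta>, w) = X_mon n \<alpha> * t_mon n \<beta> * g_perm n w"
  by (simp add: monomial_of_def g_perm_def reduced_word_def)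

locale yh_params =
  fixes r n d :: nat
  assumes r: "1 \<le> r" and n: "1 \<le> n" and d: "1 \<le> d"
begin

subsection \<open>Linear independence in the representations\<close>

abbreviation colouring :: "(nat \<Rightarrow> nat) \<Rightarrow> bool" where
  "colouring col \<equiv> \<forall>j. col j < r"

definition rep :: "(nat \<Rightarrow> nat) \<Rightarrow> yh_free \<Rightarrow> yvec \<Rightarrow> yvec" where
  "rep col = rho (yh_module.act col d (cyc_coeff d) (cyc_inv d) r)"

lemma yh_module: "colouring col \<Longrightarrow> yh_module col d (cyc_coeff d) (cyc_inv d) r"
  by standard (use r d in \<open>auto simp: cyc_coeff_top cyc_inv\<close>)

lemma rep_monomial:
  assumes col: "colouring col" and word: "word_choice n word" and i: "(\<alpha>, \<beta>, w) \<in> monomial_index r n d"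
  shows "rep col (monomial_of n word (\<alpha>, \<beta>, w)) (bv 1 (\<lambda>_. 0))
    = lconst (\<Prod>j=1..n. (zeta r ^ \<beta> j) ^ col (w j)) *\<^sub>v
      bv (word_perm (word w)) (\<lambda>j. if 1 \<le> j \<and> j \<le> n then \<alpha> j else 0)"
proof -
  interpret yh_module col d "cyc_coeff d" "cyc_inv d" r by (rule yh_module[OF col])
  have w: "w permutes {1..n}" and \<alpha>: "\<And>j. 1 \<le> j \<Longrightarrow> j \<le> n \<Longrightarrow> \<alpha> j < d"
    using i by (auto simp: monomial_index_def PiE_iff)
  have "tchar j (word_perm (word w)) ^ \<beta> j = lconst ((zeta r ^ \<beta> j) ^ col (w j))" for j
    by (simp add: tchar_def apply_word_perm word_choiceD[OF word w] power_mult[symmetric] mult.commute flip: lconst_power)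
  moreover have "R (X_mon n \<alpha> * t_mon n \<beta> * prod_list (map gg (word w))) (bv 1 (\<lambda>_. 0))
    = (\<Prod>j=1..n. tchar j (word_perm (word w)) ^ \<beta> j) *\<^sub>v
      bv (word_perm (word w)) (\<lambda>j. if 1 \<le> j \<and> j \<le> n then \<alpha> j else 0)"
    using \<alpha> word_choiceD(3)[OF word w] by (rule R_standard)
  ultimately show ?thesis by (simp add: rep_def monomial_of_def lconst_prod)
qed

text \<open>The permutation and the exponents of the variables can be read off from the basis vector, and the
  colourings of the labels run through all characters of the \<open>t\<close>'s.\<close>

lemma monomials_independent:
  assumes word: "word_choice n word"
    and zero: "\<And>col. colouring col \<Longrightarrow>
      (\<Sum>i\<in>monomial_index r n d. C i *\<^sub>v rep col (monomial_of n word i) (bv 1 (\<lambda>_. 0))) = 0"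
    and i: "i \<in> monomial_index r n d"
  shows "C i = 0"
proof -
  let ?I = "monomial_index r n d" and ?A = "{1..n} \<rightarrow>\<^sub>E {..<d}" and ?B = "{1..n} \<rightarrow>\<^sub>E {..<r}"
  let ?P = "{w. w permutes {1..n}}"
  obtain \<alpha>0 \<beta>0 w0 where i0: "i = (\<alpha>0, \<beta>0, w0)" by (cases i) auto
  have \<alpha>0: "\<alpha>0 \<in> ?A" and \<beta>0: "\<beta>0 \<in> ?B" and w0: "w0 \<in> ?P" using i by (auto simp: i0 monomial_index_def)
  define ext where "ext \<alpha> = (\<lambda>j. if 1 \<le> j \<and> j \<le> n then \<alpha> j else 0)" for \<alpha> :: "nat \<Rightarrow> nat"
  have ext_inj: "\<alpha> = \<alpha>0" if "\<alpha> \<in> ?A" "ext \<alpha> = ext \<alpha>0" for \<alpha>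
    using that(1) \<alpha>0
  proof (rule PiE_ext)
    fix j assume "j \<in> {1..n}"
    then show "\<alpha> j = \<alpha>0 j" using fun_cong[OF that(2), of j] by (simp add: ext_def)
  qed
  have word_inj: "w = w0" if "w \<in> ?P" "word_perm (word w) = word_perm (word w0)" for w
  proof -
    have "perm_of_word (word w) j = perm_of_word (word w0) j" for j
      using that(2) by (simp only: apply_word_perm[symmetric])
    then have "perm_of_word (word w) = perm_of_word (word w0)" by (rule HOL.ext)
    then show ?thesis using word_choiceD(2)[OF word, of w] word_choiceD(2)[OF word, of w0] that(1) w0 by simp
  qed
  have "C (\<alpha>0, \<beta>0, w0) = 0"
  proof (rule characters_independent[where C = "\<lambda>\<beta>. C (\<alpha>0, \<beta>, w0)", OF r _ \<beta>0])
    fix c assume c: "c \<in> ?B"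
    define col where "col k = (if k \<in> {1..n} then c (inv_into UNIV w0 k) else 0)" for k
    have w0': "w0 permutes {1..n}" using w0 by simp
    have "inv_into UNIV w0 k \<in> {1..n}" if "k \<in> {1..n}" for k
      using permutes_in_image[OF permutes_inv[OF w0'], of k] that by blast
    then have col: "colouring col" using c r by (auto simp: col_def PiE_iff)
    have colw: "col (w0 j) = c j" if "j \<in> {1..n}" for j
      using that permutes_in_image[OF w0', of j] permutes_inverses(2)[OF w0', of j] by (simp add: col_def)
    let ?T = "\<lambda>\<alpha> \<beta> w. C (\<alpha>, \<beta>, w) * lconst (\<Prod>j=1..n. (zeta r ^ \<beta> j) ^ col (w j))"
    have "0 = (\<Sum>i\<in>?I. Poly_Mapping.lookup (C i *\<^sub>v rep col (monomial_of n word i) (bv 1 (\<lambda>_. 0))) (word_perm (word w0), ext \<alpha>0))"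
      by (simp only: lookup_sum[symmetric] zero[OF col] lookup_zero)
    also have "\<dots> = (\<Sum>(\<alpha>, \<beta>, w)\<in>?I. if \<alpha> = \<alpha>0 \<and> w = w0 then ?T \<alpha> \<beta> w else 0)"
    proof (rule sum.cong[OF refl])
      fix i assume iI: "i \<in> ?I"
      obtain \<alpha> \<beta> w where i: "i = (\<alpha>, \<beta>, w)" by (cases i) auto
      have "\<alpha> \<in> ?A" "w \<in> ?P" using iI by (auto simp: i monomial_index_def)
      then have "word_perm (word w) = word_perm (word w0) \<and> ext \<alpha> = ext \<alpha>0 \<longleftrightarrow> \<alpha> = \<alpha>0 \<and> w = w0"
        using ext_inj word_inj by blast
      then show "Poly_Mapping.lookup (C i *\<^sub>v rep col (monomial_of n word i) (bv 1 (\<lambda>_. 0))) (word_perm (word w0), ext \<alpha>0)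
        = (case i of (\<alpha>, \<beta>, w) \<Rightarrow> if \<alpha> = \<alpha>0 \<and> w = w0 then ?T \<alpha> \<beta> w else 0)"
        unfolding i rep_monomial[OF col word iI[unfolded i], folded ext_def]
        by (simp add: lookup_single when_def)
    qed
    also have "\<dots> = (\<Sum>\<alpha>\<in>?A. \<Sum>\<beta>\<in>?B. \<Sum>w\<in>?P. if \<alpha> = \<alpha>0 \<and> w = w0 then ?T \<alpha> \<beta> w else 0)"
      unfolding monomial_index_def by (simp add: sum.cartesian_product)
    also have "\<dots> = (\<Sum>\<alpha>\<in>?A. \<Sum>\<beta>\<in>?B. if \<alpha> = \<alpha>0 then ?T \<alpha> \<beta> w0 else 0)"
    proof (intro sum.cong refl)
      fix \<alpha> \<beta>
      have "(\<Sum>w\<in>?P. if \<alpha> = \<alpha>0 \<and> w = w0 then ?T \<alpha> \<beta> w else 0) = (\<Sum>w\<in>?P. if w = w0 then (if \<alpha> = \<alpha>0 then ?T \<alpha> \<beta> w else 0) else 0)"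
        by (intro sum.cong refl) auto
      also have "\<dots> = (if \<alpha> = \<alpha>0 then ?T \<alpha> \<beta> w0 else 0)"
        using w0 finite_permutations[of "{1..n}"] by (subst sum.delta) auto
      finally show "(\<Sum>w\<in>?P. if \<alpha> = \<alpha>0 \<and> w = w0 then ?T \<alpha> \<beta> w else 0) = (if \<alpha> = \<alpha>0 then ?T \<alpha> \<beta> w0 else 0)" .
    qed
    also have "\<dots> = (\<Sum>\<alpha>\<in>?A. if \<alpha> = \<alpha>0 then (\<Sum>\<beta>\<in>?B. ?T \<alpha> \<beta> w0) else 0)"
      by (intro sum.cong refl) auto
    also have "\<dots> = (\<Sum>\<beta>\<in>?B. ?T \<alpha>0 \<beta> w0)"
      using \<alpha>0 finite_PiE[of "{1..n}" "\<lambda>_. {..<d}"] by (subst sum.delta) auto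
    also have "\<dots> = (\<Sum>\<beta>\<in>?B. C (\<alpha>0, \<beta>, w0) * lconst (\<Prod>j=1..n. (zeta r ^ \<beta> j) ^ c j))"
      by (intro sum.cong refl arg_cong2[where f = "(*)"] arg_cong[where f = lconst] prod.cong) (simp add: colw)
    finally show "(\<Sum>\<beta>\<in>?B. C (\<alpha>0, \<beta>, w0) * lconst (\<Prod>j=1..n. (zeta r ^ \<beta> j) ^ c j)) = 0" ..
  qed
  then show ?thesis by (simp add: i0)
qed

subsection \<open>The canonical projection\<close>

definition gen_words :: "yh_gen fmonoid set" where
  "gen_words = {u. set (letters u) \<subseteq> yh_gens n}"

abbreviation K :: "laurent set" where "K \<equiv> ground r d"

abbreviation F :: "yh_free set" where "F \<equiv> polys K gen_words"

lemma coeff_closed_free: "coeff_closed K gen_words"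
  by standard
    (auto simp: gen_words_def zero_fmonoid_def plus_fmonoid_def
      intro: ground.polys_one ground.polys_add ground.polys_mult ground.polys_minus)

sublocale free: coeff_closed K gen_words
  by (rule coeff_closed_free)

abbreviation A :: "(laurent, yh_free) module" where "A \<equiv> yh_free_alg r n d"

lemma A_fields [simp]:
  "carrier A = F" "mult A = (*)" "one A = 1" "zero A = 0" "add A = (+)" "c \<odot>\<^bsub>A\<^esub> p = scalar c * p"
  by (auto simp: yh_free_alg_def free_algebra_def carrier_ground_ring polys_def gen_words_def)

lemma ring_A: "ring A"
  by (rule ring_of_closed)
    (simp_all add: free.polys_one free.polys_add free.polys_mult free.polys_minus)

lemma A_minus: "p \<in> F \<Longrightarrow> \<ominus>\<^bsub>A\<^esub> p = - p"
  by (rule a_inv_of_closed[OF ring_A]) (simp_all add: free.polys_minus)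

lemma A_diff: "p \<in> F \<Longrightarrow> p' \<in> F \<Longrightarrow> p \<ominus>\<^bsub>A\<^esub> p' = p - p'"
  by (simp add: a_minus_def A_minus)

lemma scalar_F: "c \<in> K \<Longrightarrow> scalar c \<in> F"
  unfolding scalar_def by (rule free.polys_single[OF _ free.M_zero])

lemma gen_F: "x \<in> yh_gens n \<Longrightarrow> gen x \<in> F"
  unfolding gen_def by (rule free.polys_single[OF free.C_one]) (simp add: gen_words_def)

lemma tt_F: "j \<in> {1..n} \<Longrightarrow> tt j \<in> F" and gg_F: "i \<in> {1..<n} \<Longrightarrow> gg i \<in> F"
  and X1_F: "gen X1 \<in> F" and X1_inv_F: "gen X1_inv \<in> F"
  by (auto intro!: gen_F simp: yh_gens_def)

lemmas F_closed = free.polys_one free.polys_add free.polys_mult free.polys_minus free.polys_diff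
  free.polys_power free.polys_sum free.polys_prod_list scalar_F tt_F gg_F X1_F X1_inv_F

lemma ee_F: "i \<in> {1..<n} \<Longrightarrow> ee r i \<in> F"
  unfolding ee_def by (intro F_closed ground_constants) auto

lemma yh_rel_F: "(p, q) \<in> yh_rel r n \<Longrightarrow> p \<in> F \<and> q \<in> F"
proof (induction rule: yh_rel.induct)
  case (g_t i j)
  then have "transpose i (i + 1) j \<in> {1..n}" by (auto simp: transpose_def)
  with g_t show ?case by (auto intro!: F_closed)
next
  case (g_quadratic i)
  then show ?case using ee_F[of i] hq_ground by (auto intro!: F_closed simp flip: hq_def)
qed (auto intro!: F_closed)

lemma XX_F: "i \<le> n \<Longrightarrow> XX i \<in> F"
proof (induction i rule: XX.induct)
  case (3 i)
  then have "gg (Suc i) \<in> F" by (intro gg_F) auto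
  with 3 show ?case by (auto intro!: F_closed)
qed (auto intro: F_closed)

lemma gg_word_F: "set u \<subseteq> {1..<n} \<Longrightarrow> prod_list (map gg u) \<in> F"
  by (rule free.polys_prod_list) (use gg_F in fastforce)

lemma monomial_of_F: 
  assumes "word_choice n word" "i \<in> monomial_index r n d"
  shows "monomial_of n word i \<in> F"
proof -
  obtain \<alpha> \<beta> w where i: "i = (\<alpha>, \<beta>, w)" by (cases i) auto
  have "w permutes {1..n}" using assms(2) by (simp add: i monomial_index_def)
  note word = word_choiceD(1)[OF assms(1) this]
  show ?thesis unfolding i monomial_of_def X_mon_def t_mon_def prod.case
    using word by (intro free.polys_mult free.polys_prod_list) (auto intro!: XX_F F_closed)
qed

lemma f1_F: "f1 d \<in> F"
  unfolding f1_expand by (intro F_closed cyc_coeff_ground)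

definition rel_gens :: "yh_free set" where "rel_gens = (\<lambda>(p, q). p - q) ` yh_rel r n"

lemma rel_gens_F: "rel_gens \<subseteq> F"
  unfolding rel_gens_def using yh_rel_F by (auto intro!: F_closed)

lemma ideal_rel: "ideal (yh_ideal r n d) A"
proof -
  interpret A: ring A by (rule ring_A)
  show ?thesis unfolding yh_ideal_def rel_gens_def[symmetric]
    by (rule A.genideal_ideal) (simp add: rel_gens_F)
qed

sublocale aff: quotient_alg A "yh_ideal r n d"
  by (rule quotient_alg.intro[OF ring_A ideal_rel])

lemma ideal_cyc: "ideal (cyclotomic_ideal r n d) (affine_YH r n d)"
proof -
  interpret B: ring "affine_YH r n d" unfolding affine_YH_def by (rule aff.ring_B)
  have "to_affine r n d (f1 d) \<in> carrier (affine_YH r n d)"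
    unfolding affine_YH_def aff.carrier_B to_affine_def using f1_F by simp
  then show ?thesis unfolding cyclotomic_ideal_def by (intro B.genideal_ideal) simp
qed

sublocale cyc: quotient_alg "affine_YH r n d" "cyclotomic_ideal r n d"
  using aff.ring_B ideal_cyc by (intro quotient_alg.intro) (simp_all only: affine_YH_def)

abbreviation Y :: "(laurent, yh_free set set) module" where "Y \<equiv> cyclotomic_YH r n d"

definition proj :: "yh_free \<Rightarrow> yh_free set set" where
  "proj p = to_cyclotomic r n d (to_affine r n d p)"

lemma ring_Y: "ring Y"
  unfolding cyclotomic_YH_def by (rule cyc.ring_B)

lemma to_affine_hom: "to_affine r n d \<in> ring_hom A (affine_YH r n d)"
  using aff.q_hom unfolding affine_YH_def to_affine_def by simp

lemma to_cyclotomic_hom: "to_cyclotomic r n d \<in> ring_hom (affine_YH r n d) Y"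
  using cyc.q_hom unfolding cyclotomic_YH_def to_cyclotomic_def by simp

lemma proj_hom: "proj \<in> ring_hom A Y"
  using ring_hom_trans[OF to_affine_hom to_cyclotomic_hom]
  by (simp add: proj_def[abs_def] comp_def)

lemma proj_closed: "p \<in> F \<Longrightarrow> proj p \<in> carrier Y"
  and proj_mult: "p \<in> F \<Longrightarrow> p' \<in> F \<Longrightarrow> proj (p * p') = proj p \<otimes>\<^bsub>Y\<^esub> proj p'"
  and proj_add: "p \<in> F \<Longrightarrow> p' \<in> F \<Longrightarrow> proj (p + p') = proj p \<oplus>\<^bsub>Y\<^esub> proj p'"
  and proj_one: "proj 1 = \<one>\<^bsub>Y\<^esub>"
  using ring_hom_closed[OF proj_hom] ring_hom_mult[OF proj_hom] ring_hom_add[OF proj_hom] ring_hom_one[OF proj_hom]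
  by simp_all

lemma proj_surj: "carrier Y = proj ` F"
proof -
  have "carrier Y = to_cyclotomic r n d ` carrier (affine_YH r n d)"
    unfolding cyclotomic_YH_def to_cyclotomic_def by (rule cyc.carrier_B)
  also have "carrier (affine_YH r n d) = to_affine r n d ` F"
    unfolding affine_YH_def to_affine_def aff.carrier_B by simp
  finally show ?thesis by (simp add: image_image proj_def)
qed

lemma proj_zero: "proj 0 = \<zero>\<^bsub>Y\<^esub>"
proof -
  interpret Y: ring Y by (rule ring_Y)
  have "proj 0 \<oplus>\<^bsub>Y\<^esub> proj 0 = proj 0" using proj_add[of 0 0] by (simp add: free.polys_zero)
  then show ?thesis using proj_closed[OF free.polys_zero] by (metis Y.add.r_cancel_one)
qed

lemma proj_minus: "p \<in> F \<Longrightarrow> proj (- p) = \<ominus>\<^bsub>Y\<^esub> proj p"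
proof -
  interpret Y: ring Y by (rule ring_Y)
  assume p: "p \<in> F"
  have "proj (- p) \<oplus>\<^bsub>Y\<^esub> proj p = \<zero>\<^bsub>Y\<^esub>"
    using proj_add[OF free.polys_minus[OF p] p] proj_zero by simp
  then show ?thesis using p by (intro Y.minus_equality[symmetric] proj_closed free.polys_minus) 
qed

lemma proj_power: "p \<in> F \<Longrightarrow> proj (p ^ k) = proj p [^]\<^bsub>Y\<^esub> k"
proof (induction k)
  case (Suc k)
  interpret Y: ring Y by (rule ring_Y)
  have "proj (p ^ Suc k) = proj (p ^ k * p)" by (simp only: power_Suc2)
  then show ?case using Suc by (simp add: proj_mult free.polys_power)
qed (simp add: proj_one)

lemma proj_eq_iff: "p \<in> F \<Longrightarrow> p' \<in> F \<Longrightarrow> proj p = proj p' \<longleftrightarrow> proj (p - p') = \<zero>\<^bsub>Y\<^esub>"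
proof -
  interpret Y: ring Y by (rule ring_Y)
  assume p: "p \<in> F" "p' \<in> F"
  have "proj (p - p') = proj p \<ominus>\<^bsub>Y\<^esub> proj p'"
    using proj_add[OF p(1) free.polys_minus[OF p(2)]] p by (simp add: proj_minus a_minus_def)
  then show ?thesis using p proj_closed by simp
qed

lemma to_affine_rel:
  assumes "(p, q) \<in> yh_rel r n"
  shows "to_affine r n d p = to_affine r n d q"
proof -
  interpret A: ring A by (rule ring_A)
  have F: "p \<in> F" "q \<in> F" using yh_rel_F[OF assms] by auto
  have "p - q \<in> rel_gens" using assms by (force simp: rel_gens_def)
  then have "p - q \<in> yh_ideal r n d"
    using A.genideal_self[of rel_gens] rel_gens_F unfolding yh_ideal_def rel_gens_def[symmetric] by auto
  then show ?thesis unfolding to_affine_def using F by (subst aff.q_eq) (simp_all add: A_diff)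
qed

lemma proj_rel: "(p, q) \<in> yh_rel r n \<Longrightarrow> proj p = proj q"
  by (simp add: proj_def to_affine_rel)

lemma proj_f1: "proj (f1 d) = \<zero>\<^bsub>Y\<^esub>"
proof -
  interpret B: ring "affine_YH r n d" unfolding affine_YH_def by (rule aff.ring_B)
  have c: "to_affine r n d (f1 d) \<in> carrier (affine_YH r n d)"
    using ring_hom_closed[OF to_affine_hom] f1_F by simp
  then have "to_affine r n d (f1 d) \<in> cyclotomic_ideal r n d"
    unfolding cyclotomic_ideal_def by (rule B.genideal_self')
  then show ?thesis using cyc.q_zero[OF c] unfolding proj_def to_cyclotomic_def cyclotomic_YH_def by simp
qed

text \<open>The kernel of the projection is the smallest ideal that contains the relations and \<open>f\<^sub>1\<close>, although it
  arises in two steps.\<close>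

lemma proj_kernel:
  assumes N: "ideal N A" and rel: "rel_gens \<subseteq> N" and f: "f1 d \<in> N" and p: "p \<in> F" "proj p = \<zero>\<^bsub>Y\<^esub>"
  shows "p \<in> N"
proof -
  interpret A: ring A by (rule ring_A)
  interpret N: ideal N A by (rule N)
  interpret B: ring "affine_YH r n d" unfolding affine_YH_def by (rule aff.ring_B)
  have sub: "yh_ideal r n d \<subseteq> N"
    unfolding yh_ideal_def rel_gens_def[symmetric] by (rule A.genideal_minimal[OF N rel])
  have "ideal (to_affine r n d ` N) (affine_YH r n d)"
    using aff.ideal_image[OF N] unfolding affine_YH_def to_affine_def by simp
  then have sub': "cyclotomic_ideal r n d \<subseteq> to_affine r n d ` N"
    unfolding cyclotomic_ideal_def by (rule B.genideal_minimal) (use f in simp)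
  have "to_affine r n d p \<in> cyclotomic_ideal r n d"
    using p cyc.q_zero[of "to_affine r n d p"] ring_hom_closed[OF to_affine_hom, of p]
    unfolding proj_def to_cyclotomic_def cyclotomic_YH_def by simp
  then obtain k where k: "k \<in> N" "to_affine r n d p = to_affine r n d k" using sub' by auto
  have kF: "k \<in> F" using N.Icarr[OF k(1)] by simp
  have "p \<ominus>\<^bsub>A\<^esub> k \<in> yh_ideal r n d" using aff.q_eq[of p k] k(2) p kF unfolding to_affine_def by simp
  then have "p - k \<in> N" using sub p kF by (auto simp: A_diff)
  from N.a_closed[OF this k(1)] show ?thesis by simp
qed

lemma smult_Y:
  assumes c: "c \<in> K" and p: "p \<in> F"
  shows "c \<odot>\<^bsub>Y\<^esub> proj p = proj (scalar c * p)"
proof -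
  interpret I: ideal "yh_ideal r n d" A by (rule ideal_rel)
  interpret J: ideal "cyclotomic_ideal r n d" "affine_YH r n d" by (rule ideal_cyc)
  have sc: "scalar c \<in> F" by (rule scalar_F[OF c])
  have aff: "c \<odot>\<^bsub>affine_YH r n d\<^esub> to_affine r n d p = to_affine r n d (scalar c * p)" if "p \<in> F" for p
    unfolding affine_YH_def to_affine_def
    using aff.smult_q[of c p] that sc I.I_l_closed[of _ "scalar c"] by (simp add: F_closed distrib_left)
  have aff': "c \<odot>\<^bsub>affine_YH r n d\<^esub> y = to_affine r n d (scalar c) \<otimes>\<^bsub>affine_YH r n d\<^esub> y"
    if "y \<in> carrier (affine_YH r n d)" for y
  proof -
    from that obtain p where "p \<in> F" "y = to_affine r n d p"
      unfolding affine_YH_def to_affine_def aff.carrier_B by auto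
    then show ?thesis using aff ring_hom_mult[OF to_affine_hom, of "scalar c" p] sc by simp
  qed
  have scB: "to_affine r n d (scalar c) \<in> carrier (affine_YH r n d)"
    using ring_hom_closed[OF to_affine_hom] sc by simp
  have pB: "to_affine r n d p \<in> carrier (affine_YH r n d)"
    using ring_hom_closed[OF to_affine_hom] p by simp
  have "c \<odot>\<^bsub>Y\<^esub> proj p = to_cyclotomic r n d (c \<odot>\<^bsub>affine_YH r n d\<^esub> to_affine r n d p)"
    unfolding cyclotomic_YH_def to_cyclotomic_def proj_def
  proof (rule cyc.smult_q)
    fix y assume "y \<in> cyclotomic_ideal r n d"
    then show "c \<odot>\<^bsub>affine_YH r n d\<^esub> y \<in> cyclotomic_ideal r n d"
      using J.I_l_closed[OF _ scB] J.Icarr aff' by simp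
  qed (use aff' scB pB in \<open>simp_all add: J.r_distr\<close>)
  then show ?thesis unfolding aff[OF p] proj_def .
qed

subsection \<open>The representations factor through the projection\<close>

text \<open>The representations are considered on the vectors with exponents below \<open>d\<close>, where they satisfy
  all relations.\<close>

lemma rep_proj_zero:
  assumes col: "colouring col" and p: "p \<in> F" "proj p = \<zero>\<^bsub>Y\<^esub>"
  shows "rep col p (bv 1 (\<lambda>_. 0)) = 0"
proof -
  interpret M: yh_module col d "cyc_coeff d" "cyc_inv d" r by (rule yh_module[OF col])
  interpret A: ring A by (rule ring_A)
  let ?N = "{p \<in> F. \<forall>v\<in>M.valid n. M.R p v = 0}"
  have valid: "M.R p v \<in> M.valid n" if "p \<in> F" "v \<in> M.valid n" for p v
    by (rule M.R_valid[OF _ that(2)]) (use that(1) in \<open>auto simp: polys_def gen_words_def\<close>)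
  have N: "ideal ?N A"
  proof (rule idealI[OF ring_A])
    show "subgroup ?N (add_monoid A)"
    proof (rule A.add.subgroupI)
      show "?N \<noteq> {}" using free.polys_zero by (auto simp: M.R_left)
    qed (auto simp: A_minus F_closed M.R_left)
  qed (auto simp: F_closed M.R_mult M.R_lin valid)
  have rel: "rel_gens \<subseteq> ?N"
  proof
    fix q assume "q \<in> rel_gens"
    then obtain a b where ab: "(a, b) \<in> yh_rel r n" "q = a - b" by (auto simp: rel_gens_def)
    then show "q \<in> ?N"
      using rel_gens_F \<open>q \<in> rel_gens\<close> M.R_relation[OF ab(1) n] by (auto simp: M.R_left)
  qed
  have "M.R (f1 d) v = 0" if "v \<in> M.valid n" for v
    using M.Xt_annihilated[of v "{1..n}" 1] that n
    by (simp add: f1_expand M.R_left M.R_mult M.R_power M.valid_def)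
  then have "f1 d \<in> ?N" using f1_F by simp
  from proj_kernel[OF N rel this p] have "p \<in> ?N" .
  moreover have "bv 1 (\<lambda>_. 0) \<in> M.valid n"
    unfolding M.valid_def using d by (intro M.bv_boxed) auto
  ultimately show ?thesis by (simp add: rep_def)
qed

lemma rep_lin:
  assumes "colouring col"
  shows "rep col (p + p') v = rep col p v + rep col p' v" "rep col (p - p') v = rep col p v - rep col p' v"
    "rep col (scalar c * p) v = c *\<^sub>v rep col p v" "rep col (\<Sum>i\<in>I. h i) v = (\<Sum>i\<in>I. rep col (h i) v)"
proof -
  interpret M: yh_module col d "cyc_coeff d" "cyc_inv d" r by (rule yh_module[OF assms])
  show "rep col (p + p') v = rep col p v + rep col p' v" "rep col (p - p') v = rep col p v - rep col p' v"
    "rep col (scalar c * p) v = c *\<^sub>v rep col p v" "rep col (\<Sum>i\<in>I. h i) v = (\<Sum>i\<in>I. rep col (h i) v)"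
    unfolding rep_def by (simp_all add: M.R_left scalar_mult_eq)
qed

lemma combination_zero:
  assumes word: "word_choice n word" and C: "\<And>i. i \<in> monomial_index r n d \<Longrightarrow> C i \<in> K"
    and zero: "proj (\<Sum>i\<in>monomial_index r n d. scalar (C i) * monomial_of n word i) = \<zero>\<^bsub>Y\<^esub>"
    and i: "i \<in> monomial_index r n d"
  shows "C i = 0"
proof (rule monomials_independent[OF word _ i])
  fix col assume col: "colouring col"
  have "(\<Sum>i\<in>monomial_index r n d. scalar (C i) * monomial_of n word i) \<in> F"
    using monomial_of_F[OF word] C by (intro F_closed) auto
  from rep_proj_zero[OF col this zero]
  show "(\<Sum>i\<in>monomial_index r n d. C i *\<^sub>v rep col (monomial_of n word i) (bv 1 (\<lambda>_. 0))) = 0"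
    by (simp add: rep_lin[OF col])
qed

subsection \<open>Spanning\<close>

abbreviation sc :: "laurent \<Rightarrow> yh_free set set" where "sc c \<equiv> proj (scalar c)"

lemma scalar_ring_Y: "scalar_ring Y K sc"
proof -
  interpret Y: ring Y by (rule ring_Y)
  show ?thesis
  proof
    show "- 1 \<in> K" by (intro ground.polys_minus ground.polys_one)
    have "scalar (- 1) = (- 1 :: yh_free)" by (simp add: scalar_def single_uminus)
    then show "sc (- 1) = \<ominus>\<^bsub>Y\<^esub> \<one>\<^bsub>Y\<^esub>" by (simp add: proj_minus proj_one free.polys_one)
    show "sc 1 = \<one>\<^bsub>Y\<^esub>" by (simp add: scalar_def proj_one)
  next
    fix a b assume "a \<in> K" "b \<in> K"
    moreover have "scalar (a * b) = (scalar a * scalar b :: yh_free)" by (simp add: scalar_def mult_single)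
    ultimately show "sc (a * b) = sc a \<otimes>\<^bsub>Y\<^esub> sc b" by (simp add: proj_mult scalar_F)
  next
    fix a y assume a: "a \<in> K" and "y \<in> carrier Y"
    then obtain p where p: "p \<in> F" "y = proj p" unfolding proj_surj by auto
    then show "y \<otimes>\<^bsub>Y\<^esub> sc a = sc a \<otimes>\<^bsub>Y\<^esub> y"
      using a by (simp add: proj_mult[symmetric] scalar_F scalar_commute[of a p])
  qed (auto intro: ground.polys_one ground.polys_mult proj_closed scalar_F)
qed

sublocale S: scalar_ring Y K sc by (rule scalar_ring_Y)

lemma proj_sum_rspan:
  assumes "\<And>i. i \<in> I \<Longrightarrow> c i \<in> K" "\<And>i. i \<in> I \<Longrightarrow> h i \<in> F" "\<And>i. i \<in> I \<Longrightarrow> proj (h i) \<in> W"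
  shows "proj (\<Sum>i\<in>I. scalar (c i) * h i) \<in> S.rspan W"
  using assms
proof (induction I rule: infinite_finite_induct)
  case (insert i I)
  have F: "scalar (c i) \<in> F" "h i \<in> F" "(\<Sum>i\<in>I. scalar (c i) * h i) \<in> F"
    using insert.prems by (auto intro!: F_closed)
  have "proj (\<Sum>i\<in>insert i I. scalar (c i) * h i) = sc (c i) \<otimes>\<^bsub>Y\<^esub> proj (h i) \<oplus>\<^bsub>Y\<^esub> proj (\<Sum>i\<in>I. scalar (c i) * h i)"
    using F insert.hyps by (simp add: proj_add proj_mult free.polys_mult)
  also have "\<dots> \<in> S.rspan W" using insert by (intro S.rspan.step) auto
  finally show ?case .
qed (auto simp: proj_zero intro: S.rspan.zero)

lemma proj_sum_cong:
  assumes "\<And>i. i \<in> I \<Longrightarrow> h i \<in> F" "\<And>i. i \<in> I \<Longrightarrow> h' i \<in> F" "\<And>i. i \<in> I \<Longrightarrow> proj (h i) = proj (h' i)"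
  shows "proj (\<Sum>i\<in>I. h i) = proj (\<Sum>i\<in>I. h' i)"
  using assms
proof (induction I rule: infinite_finite_induct)
  case (insert i I)
  have "(\<Sum>i\<in>I. h i) \<in> F" "(\<Sum>i\<in>I. h' i) \<in> F" using insert.prems by (auto intro!: F_closed)
  then show ?case using insert by (simp add: proj_add)
qed auto

lemma pow_intertwine:
  assumes "y \<in> carrier Y" "a \<in> carrier Y" "b \<in> carrier Y" "y \<otimes>\<^bsub>Y\<^esub> a = b \<otimes>\<^bsub>Y\<^esub> y"
  shows "y \<otimes>\<^bsub>Y\<^esub> a [^]\<^bsub>Y\<^esub> (k :: nat) = b [^]\<^bsub>Y\<^esub> k \<otimes>\<^bsub>Y\<^esub> y"
proof (induction k)
  case (Suc k)
  have "y \<otimes>\<^bsub>Y\<^esub> a [^]\<^bsub>Y\<^esub> Suc k = (y \<otimes>\<^bsub>Y\<^esub> a [^]\<^bsub>Y\<^esub> k) \<otimes>\<^bsub>Y\<^esub> a" using assms by (simp add: S.m_assoc)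
  also have "\<dots> = b [^]\<^bsub>Y\<^esub> k \<otimes>\<^bsub>Y\<^esub> (y \<otimes>\<^bsub>Y\<^esub> a)" unfolding Suc using assms by (simp add: S.m_assoc)
  also have "\<dots> = b [^]\<^bsub>Y\<^esub> Suc k \<otimes>\<^bsub>Y\<^esub> y" unfolding assms(4) using assms(1-3) by (simp add: S.m_assoc)
  finally show ?case .
qed (use assms in simp)

abbreviation tY where "tY j \<equiv> proj (tt j)"
abbreviation gY where "gY i \<equiv> proj (gg i)"
abbreviation xY where "xY \<equiv> proj (gen X1)"
abbreviation xiY where "xiY \<equiv> proj (gen X1_inv)"
abbreviation heY where "heY i \<equiv> proj (scalar hq * ee r i)"

lemma rel_mult:
  "(p * q, p' * q') \<in> yh_rel r n \<Longrightarrow> p \<in> F \<Longrightarrow> q \<in> F \<Longrightarrow> p' \<in> F \<Longrightarrow> q' \<in> F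
    \<Longrightarrow> proj p \<otimes>\<^bsub>Y\<^esub> proj q = proj p' \<otimes>\<^bsub>Y\<^esub> proj q'"
  using proj_rel[of "p * q" "p' * q'"] by (simp add: proj_mult)

lemma tY_order: "j \<in> {1..n} \<Longrightarrow> tY j [^]\<^bsub>Y\<^esub> r = \<one>\<^bsub>Y\<^esub>"
  using proj_rel[OF yh_rel.t_order[of j n r]] by (simp add: proj_power proj_one tt_F)

lemma tY_commute: "i \<in> {1..n} \<Longrightarrow> j \<in> {1..n} \<Longrightarrow> tY i \<otimes>\<^bsub>Y\<^esub> tY j = tY j \<otimes>\<^bsub>Y\<^esub> tY i"
  by (intro rel_mult yh_rel.t_comm tt_F)

lemma gY_tY:
  assumes "i \<in> {1..<n}" "j \<in> {1..n}"
  shows "gY i \<otimes>\<^bsub>Y\<^esub> tY j = tY (transpose i (Suc i) j) \<otimes>\<^bsub>Y\<^esub> gY i"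
proof -
  have "transpose i (Suc i) j \<in> {1..n}" using assms by (auto simp: transpose_def)
  then show ?thesis using assms yh_rel.g_t[OF assms, of r] by (intro rel_mult tt_F gg_F) simp_all
qed

lemma scalar_left_commute: "p * (scalar c * q) = scalar c * (p * q :: yh_free)"
  by (simp only: mult.assoc[symmetric] scalar_commute[of c p])

text \<open>Moving \<open>g\<^sub>i\<close> through \<open>e\<^sub>i\<close> exchanges \<open>t\<^sub>i\<close> and \<open>t\<^sub>i\<^sub>+\<^sub>1\<close>.  The substitution \<open>s \<mapsto> r - s\<close> undoes this up to the
  end terms \<open>t\<^sub>i\<^sup>r\<close> and \<open>t\<^sub>i\<^sub>+\<^sub>1\<^sup>r\<close>, which are both \<open>1\<close>.\<close>

lemma ee_gg:
  assumes i: "i \<in> {1..<n}"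
  shows "proj (gg i * ee r i) = proj (ee r i * gg i)"
proof -
  have ij: "i \<in> {1..n}" "Suc i \<in> {1..n}" using i by auto
  let ?a = "tt i" and ?b = "tt (Suc i)"
  define P where "P s = ?a ^ s * ?b ^ (r - s)" for s
  define P' where "P' s = ?b ^ s * ?a ^ (r - s)" for s
  have F: "?a \<in> F" "?b \<in> F" "gg i \<in> F" using i ij by (auto intro: tt_F gg_F)
  have PF: "P s \<in> F" "P' s \<in> F" for s unfolding P_def P'_def using F by (auto intro!: F_closed)
  note c = proj_closed[OF F(1)] proj_closed[OF F(2)] proj_closed[OF F(3)]
  have ga: "gY i \<otimes>\<^bsub>Y\<^esub> tY i [^]\<^bsub>Y\<^esub> k = tY (Suc i) [^]\<^bsub>Y\<^esub> k \<otimes>\<^bsub>Y\<^esub> gY i" for k :: nat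
    using gY_tY[OF i ij(1)] c by (intro pow_intertwine) simp_all
  have gb: "gY i \<otimes>\<^bsub>Y\<^esub> tY (Suc i) [^]\<^bsub>Y\<^esub> k = tY i [^]\<^bsub>Y\<^esub> k \<otimes>\<^bsub>Y\<^esub> gY i" for k :: nat
    using gY_tY[OF i ij(2)] c by (intro pow_intertwine) simp_all
  have gP: "proj (gg i * P s) = proj (P' s * gg i)" for s
  proof -
    have "proj (gg i * P s) = gY i \<otimes>\<^bsub>Y\<^esub> tY i [^]\<^bsub>Y\<^esub> s \<otimes>\<^bsub>Y\<^esub> tY (Suc i) [^]\<^bsub>Y\<^esub> (r - s)"
      unfolding P_def using F c by (simp add: proj_mult proj_power F_closed S.m_assoc)
    also have "\<dots> = tY (Suc i) [^]\<^bsub>Y\<^esub> s \<otimes>\<^bsub>Y\<^esub> (gY i \<otimes>\<^bsub>Y\<^esub> tY (Suc i) [^]\<^bsub>Y\<^esub> (r - s))"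
      unfolding ga using c by (simp add: S.m_assoc)
    also have "\<dots> = proj (P' s * gg i)"
      unfolding gb P'_def using F c by (simp add: proj_mult proj_power F_closed S.m_assoc)
    finally show ?thesis .
  qed
  have flip: "proj (P' s) = proj (P (r - s))" if "s \<le> r" for s
  proof -
    have "proj (P' s) = tY (Suc i) [^]\<^bsub>Y\<^esub> s \<otimes>\<^bsub>Y\<^esub> tY i [^]\<^bsub>Y\<^esub> (r - s)"
      unfolding P'_def using F by (simp add: proj_mult proj_power F_closed)
    also have "\<dots> = tY i [^]\<^bsub>Y\<^esub> (r - s) \<otimes>\<^bsub>Y\<^esub> tY (Suc i) [^]\<^bsub>Y\<^esub> s"
      using c tY_commute[OF ij] by (intro pow_intertwine pow_intertwine[symmetric]) simp_all
    also have "\<dots> = proj (P (r - s))"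
      unfolding P_def using F that by (simp add: proj_mult proj_power F_closed)
    finally show ?thesis .
  qed
  have ends: "proj (P 0) = proj (P r)"
    unfolding P_def using F tY_order[OF ij(1)] tY_order[OF ij(2)] by (simp add: proj_power)
  have "proj (\<Sum>s<r. P' s) = proj (\<Sum>s<r. P (r - s))"
    using PF flip by (intro proj_sum_cong) auto
  also have "(\<Sum>s<r. P (r - s)) = (\<Sum>s<r. P (Suc s))"
    by (rule sum.reindex_bij_witness[where i = "\<lambda>s. r - Suc s" and j = "\<lambda>s. r - Suc s"]) (auto simp: Suc_diff_Suc)
  also have "proj (\<Sum>s<r. P (Suc s)) = proj (\<Sum>s<r. P s)"
  proof -
    have "P 0 + (\<Sum>s<r. P (Suc s)) = (\<Sum>s<r. P s) + P r"
      by (simp add: sum.lessThan_Suc_shift[symmetric])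
    then have "proj (P 0) \<oplus>\<^bsub>Y\<^esub> proj (\<Sum>s<r. P (Suc s)) = proj (\<Sum>s<r. P s) \<oplus>\<^bsub>Y\<^esub> proj (P r)"
      using PF by (simp add: proj_add[symmetric] free.polys_sum)
    then have "proj (P r) \<oplus>\<^bsub>Y\<^esub> proj (\<Sum>s<r. P (Suc s)) = proj (P r) \<oplus>\<^bsub>Y\<^esub> proj (\<Sum>s<r. P s)"
      using PF ends by (simp add: S.a_comm proj_closed free.polys_sum)
    then show ?thesis using PF by (simp add: proj_closed free.polys_sum)
  qed
  finally have PP: "proj (\<Sum>s<r. P' s) = proj (\<Sum>s<r. P s)" .
  have sF: "(\<Sum>s<r. P s) \<in> F" "(\<Sum>s<r. P' s) \<in> F" using PF by (auto intro!: F_closed)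
  have "proj (gg i * (\<Sum>s<r. P s)) = proj ((\<Sum>s<r. P' s) * gg i)"
    unfolding sum_distrib_left sum_distrib_right by (intro proj_sum_cong free.polys_mult PF F gP)
  also have "\<dots> = proj ((\<Sum>s<r. P s) * gg i)" using PP sF F by (simp add: proj_mult)
  finally have *: "proj (gg i * (\<Sum>s<r. P s)) = proj ((\<Sum>s<r. P s) * gg i)" .
  let ?c = "scalar (lconst (1 / of_nat r)) :: yh_free"
  have cF: "?c \<in> F" by (intro scalar_F ground_constants)
  have ee: "ee r i = ?c * (\<Sum>s<r. P s)" by (simp add: ee_def P_def)
  have "proj (gg i * ee r i) = proj (?c * (gg i * (\<Sum>s<r. P s)))"
    unfolding ee by (simp only: scalar_left_commute)
  also have "\<dots> = proj (?c * ((\<Sum>s<r. P s) * gg i))"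
    using * cF sF F by (simp add: proj_mult F_closed)
  finally show ?thesis unfolding ee by (simp add: mult.assoc)
qed

lemma f_reduce: "proj (gen X1 ^ d) = proj (\<Sum>m<d. scalar (- cyc_coeff d m) * gen X1 ^ m)"
proof -
  have neg: "scalar (- c) = (- scalar c :: yh_free)" for c :: laurent by (simp add: scalar_def single_uminus)
  have "f1 d = (\<Sum>m<d. scalar (cyc_coeff d m) * gen X1 ^ m) + gen X1 ^ d"
    by (simp add: f1_expand lessThan_Suc_atMost[symmetric] cyc_coeff_top) (simp add: scalar_def)
  then have "gen X1 ^ d = f1 d + (\<Sum>m<d. scalar (- cyc_coeff d m) * gen X1 ^ m)"
    by (simp add: neg sum_negf)
  moreover have "(\<Sum>m<d. scalar (- cyc_coeff d m) * gen X1 ^ m) \<in> F"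
    by (intro F_closed ground.polys_minus cyc_coeff_ground)
  ultimately show ?thesis using f1_F proj_closed by (simp add: proj_add proj_f1)
qed

text \<open>Multiply \<open>f\<^sub>1 = 0\<close> by \<open>X\<^sub>1\<^sup>-\<^sup>1\<close> and by the inverse of its constant coefficient.\<close>

lemma X1_inv_reduce:
  "proj (gen X1_inv) = proj (\<Sum>m<d. scalar (- cyc_inv d * cyc_coeff d (Suc m)) * gen X1 ^ m)"
proof -
  have sc: "scalar (a * b) = (scalar a * scalar b :: yh_free)" "scalar (- a) = (- scalar a :: yh_free)" for a b :: laurent
    by (simp_all add: scalar_def single_uminus mult_single)
  let ?x = "gen X1 :: yh_free" and ?xi = "gen X1_inv :: yh_free"
  let ?c = "cyc_coeff d"
  have F: "?x \<in> F" "?xi \<in> F" "f1 d \<in> F" using X1_F X1_inv_F f1_F by auto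
  have inv: "proj ?xi \<otimes>\<^bsub>Y\<^esub> proj ?x = \<one>\<^bsub>Y\<^esub>"
    using proj_rel[OF yh_rel.X_inv_left] F by (simp add: proj_mult proj_one)
  have step: "proj (scalar (?c (Suc m)) * (?xi * ?x ^ Suc m)) = proj (scalar (?c (Suc m)) * ?x ^ m)" for m
  proof -
    have "proj (?xi * ?x ^ Suc m) = (proj ?xi \<otimes>\<^bsub>Y\<^esub> proj ?x) \<otimes>\<^bsub>Y\<^esub> proj (?x ^ m)"
      using F by (simp add: proj_mult F_closed proj_closed S.m_assoc)
    also have "\<dots> = proj (?x ^ m)" unfolding inv using F by (simp add: proj_closed F_closed)
    finally show ?thesis using F by (simp only: proj_mult F_closed cyc_coeff_ground)
  qed
  have split: "?xi * f1 d = scalar (?c 0) * ?xi + (\<Sum>m<d. scalar (?c (Suc m)) * (?xi * ?x ^ Suc m))"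
  proof -
    show ?thesis
      unfolding f1_expand lessThan_Suc_atMost[symmetric] sum.lessThan_Suc_shift
      by (simp add: sum_distrib_left distrib_left scalar_left_commute scalar_commute[of _ ?xi, symmetric] del: power_Suc)
  qed
  have A: "scalar (?c 0) * ?xi \<in> F" "(\<Sum>m<d. scalar (?c (Suc m)) * ?x ^ m) \<in> F"
    "(\<Sum>m<d. scalar (?c (Suc m)) * (?xi * ?x ^ Suc m)) \<in> F"
    by (intro F_closed cyc_coeff_ground)+
  have "\<zero>\<^bsub>Y\<^esub> = proj (?xi * f1 d)" using F by (simp add: proj_mult proj_f1 proj_closed)
  also have "\<dots> = proj (scalar (?c 0) * ?xi) \<oplus>\<^bsub>Y\<^esub> proj (\<Sum>m<d. scalar (?c (Suc m)) * (?xi * ?x ^ Suc m))"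
    unfolding split using A by (simp only: proj_add)
  also have "proj (\<Sum>m<d. scalar (?c (Suc m)) * (?xi * ?x ^ Suc m)) = proj (\<Sum>m<d. scalar (?c (Suc m)) * ?x ^ m)"
    by (intro proj_sum_cong step F_closed cyc_coeff_ground)
  also have "proj (scalar (?c 0) * ?xi) \<oplus>\<^bsub>Y\<^esub> proj (\<Sum>m<d. scalar (?c (Suc m)) * ?x ^ m)
    = proj (scalar (?c 0) * ?xi + (\<Sum>m<d. scalar (?c (Suc m)) * ?x ^ m))"
    using A by (simp only: proj_add)
  finally have zero: "proj (scalar (?c 0) * ?xi + (\<Sum>m<d. scalar (?c (Suc m)) * ?x ^ m)) = \<zero>\<^bsub>Y\<^esub>" ..
  let ?i = "scalar (cyc_inv d) :: yh_free"
  have iF: "?i \<in> F" by (intro scalar_F cyc_inv_ground)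
  have "?i * (scalar (?c 0) * ?xi) = ?xi"
    using cyc_inv[of d] by (simp add: mult.assoc[symmetric] sc(1)[symmetric]) (simp add: scalar_def)
  then have eq: "?i * (scalar (?c 0) * ?xi + (\<Sum>m<d. scalar (?c (Suc m)) * ?x ^ m))
    = ?xi - (\<Sum>m<d. scalar (- cyc_inv d * ?c (Suc m)) * ?x ^ m)"
    by (simp add: distrib_left sum_distrib_left sc sum_negf mult.assoc)
  have "proj (?i * (scalar (?c 0) * ?xi + (\<Sum>m<d. scalar (?c (Suc m)) * ?x ^ m))) = \<zero>\<^bsub>Y\<^esub>"
    using iF A zero by (simp add: proj_mult F_closed proj_closed)
  then have "proj (?xi - (\<Sum>m<d. scalar (- cyc_inv d * ?c (Suc m)) * ?x ^ m)) = \<zero>\<^bsub>Y\<^esub>" unfolding eq .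
  moreover have "(\<Sum>m<d. scalar (- cyc_inv d * ?c (Suc m)) * ?x ^ m) \<in> F"
    by (intro F_closed ground.polys_mult ground.polys_minus cyc_inv_ground cyc_coeff_ground)
  ultimately show ?thesis using F(2) by (simp add: proj_eq_iff)
qed

lemma yh_ring_Y: "yh_ring Y K sc n d r tY gY heY xY xiY"
proof
  have heF: "scalar hq * ee r i \<in> F" if "i \<in> {1..<n}" for i
    using that by (intro F_closed hq_ground ee_F)
  show "1 \<le> n" "1 \<le> r" by (fact n, fact r)
  show "\<And>j. j \<in> {1..n} \<Longrightarrow> tY j \<in> carrier Y" "\<And>i. i \<in> {1..<n} \<Longrightarrow> gY i \<in> carrier Y"
    "xY \<in> carrier Y" "xiY \<in> carrier Y" "\<And>i. i \<in> {1..<n} \<Longrightarrow> heY i \<in> carrier Y"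
    by (intro proj_closed tt_F gg_F X1_F X1_inv_F heF; assumption)+
  show "gY i \<otimes>\<^bsub>Y\<^esub> gY j = gY j \<otimes>\<^bsub>Y\<^esub> gY i" if "i \<in> {1..<n}" "j \<in> {1..<n}" "i + 2 \<le> j \<or> j + 2 \<le> i" for i j
    by (intro rel_mult yh_rel.g_comm gg_F that)
  show "gY i \<otimes>\<^bsub>Y\<^esub> gY (Suc i) \<otimes>\<^bsub>Y\<^esub> gY i = gY (Suc i) \<otimes>\<^bsub>Y\<^esub> gY i \<otimes>\<^bsub>Y\<^esub> gY (Suc i)" if "1 \<le> i" "i + 1 < n" for i
  proof -
    have i: "i \<in> {1..<n}" "i + 1 \<in> {1..<n}" using that by auto
    have "gg i \<in> F" "gg (i + 1) \<in> F" using i by (auto intro: gg_F)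
    then show ?thesis using proj_rel[OF yh_rel.g_braid[OF i]] by (simp add: proj_mult F_closed)
  qed
  show "tY i \<otimes>\<^bsub>Y\<^esub> tY j = tY j \<otimes>\<^bsub>Y\<^esub> tY i" if "i \<in> {1..n}" "j \<in> {1..n}" for i j
    by (intro tY_commute that)
  show "tY j [^]\<^bsub>Y\<^esub> r = \<one>\<^bsub>Y\<^esub>" if "j \<in> {1..n}" for j by (rule tY_order[OF that])
  show "gY i \<otimes>\<^bsub>Y\<^esub> tY j = tY (transpose i (Suc i) j) \<otimes>\<^bsub>Y\<^esub> gY i" if "i \<in> {1..<n}" "j \<in> {1..n}" for i j
    by (rule gY_tY[OF that])
  show "gY i \<otimes>\<^bsub>Y\<^esub> gY i = \<one>\<^bsub>Y\<^esub> \<oplus>\<^bsub>Y\<^esub> heY i \<otimes>\<^bsub>Y\<^esub> gY i" if i: "i \<in> {1..<n}" for i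
  proof -
    have gF: "gg i \<in> F" by (rule gg_F[OF i])
    have "proj (gg i * gg i) = proj (1 + scalar hq * ee r i * gg i)"
      using proj_rel[OF yh_rel.g_quadratic[OF i, of r]] by (simp add: power2_eq_square hq_def)
    then show ?thesis using gF heF[OF i] by (simp add: proj_mult proj_add proj_one free.polys_one free.polys_mult)
  qed
  show "gY 1 \<otimes>\<^bsub>Y\<^esub> xY \<otimes>\<^bsub>Y\<^esub> gY 1 \<otimes>\<^bsub>Y\<^esub> xY = xY \<otimes>\<^bsub>Y\<^esub> gY 1 \<otimes>\<^bsub>Y\<^esub> xY \<otimes>\<^bsub>Y\<^esub> gY 1" if "1 < n"
  proof -
    have "1 \<in> {1..<n}" using that by auto
    then show ?thesis using proj_rel[OF yh_rel.g_X_braid[where r = r and n = n]] gg_F[of 1] X1_F by (simp add: proj_mult F_closed)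
  qed
  show "gY i \<otimes>\<^bsub>Y\<^esub> xY = xY \<otimes>\<^bsub>Y\<^esub> gY i" if "i \<in> {1..<n}" "2 \<le> i" for i
    by (intro rel_mult yh_rel.g_X_comm gg_F X1_F that)
  show "tY j \<otimes>\<^bsub>Y\<^esub> xY = xY \<otimes>\<^bsub>Y\<^esub> tY j" if "j \<in> {1..n}" for j
    by (intro rel_mult yh_rel.t_X_comm tt_F X1_F that)
  show "heY i \<otimes>\<^bsub>Y\<^esub> gY i = gY i \<otimes>\<^bsub>Y\<^esub> heY i" if i: "i \<in> {1..<n}" for i
  proof -
    have F: "gg i \<in> F" "ee r i \<in> F" "scalar hq \<in> F" using gg_F[OF i] ee_F[OF i] scalar_F[OF hq_ground] by auto
    have "gg i * (scalar hq * ee r i) = scalar hq * (gg i * ee r i)"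
      by (rule scalar_left_commute)
    then have "gY i \<otimes>\<^bsub>Y\<^esub> heY i = sc hq \<otimes>\<^bsub>Y\<^esub> proj (gg i * ee r i)"
      using F by (simp only: proj_mult[symmetric] free.polys_mult)
    also have "\<dots> = heY i \<otimes>\<^bsub>Y\<^esub> gY i"
      unfolding ee_gg[OF i] using F by (simp only: proj_mult[symmetric] free.polys_mult mult.assoc)
    finally show ?thesis ..
  qed
  show "xiY \<otimes>\<^bsub>Y\<^esub> xY = \<one>\<^bsub>Y\<^esub>"
    using proj_rel[OF yh_rel.X_inv_left] X1_F X1_inv_F by (simp add: proj_mult proj_one)
  have pow: "proj (gen X1 ^ m) = xY [^]\<^bsub>Y\<^esub> m" for m by (rule proj_power[OF X1_F])
  show "xY [^]\<^bsub>Y\<^esub> d \<in> S.rspan ((\<lambda>m. xY [^]\<^bsub>Y\<^esub> m) ` {..<d})"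
    unfolding pow[symmetric] f_reduce
    by (intro proj_sum_rspan F_closed ground.polys_minus cyc_coeff_ground) auto
  show "xiY \<in> S.rspan ((\<lambda>m. xY [^]\<^bsub>Y\<^esub> m) ` {..<d})"
    unfolding X1_inv_reduce pow[symmetric]
    by (intro proj_sum_rspan F_closed ground.polys_minus ground.polys_mult cyc_inv_ground cyc_coeff_ground) auto
qed

sublocale yh: yh_ring Y K sc n d r tY gY heY xY xiY by (rule yh_ring_Y)

lemma yh_ring_span_Y: "yh_ring_span Y K sc n d r tY gY heY xY xiY"
proof
  fix i assume i: "i \<in> {1..<n}"
  then have ij: "i \<in> {1..n}" "Suc i \<in> {1..n}" by auto
  have F: "tt i \<in> F" "tt (Suc i) \<in> F" using ij by (auto intro: tt_F)
  have "scalar hq * ee r i = (\<Sum>s<r. scalar (hq * lconst (1 / of_nat r)) * (tt i ^ s * tt (Suc i) ^ (r - s)))"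
  proof -
    have "scalar (a * b) = (scalar a * scalar b :: yh_free)" for a b :: laurent by (simp add: scalar_def mult_single)
    then show ?thesis by (simp add: ee_def sum_distrib_left mult.assoc)
  qed
  also have "proj \<dots> \<in> S.rspan yh.Tm"
  proof (intro proj_sum_rspan)
    fix s
    have "proj (tt i ^ s * tt (Suc i) ^ (r - s)) = tY i [^]\<^bsub>Y\<^esub> s \<otimes>\<^bsub>Y\<^esub> tY (Suc i) [^]\<^bsub>Y\<^esub> (r - s)"
      using F by (simp add: proj_mult proj_power F_closed)
    then show "proj (tt i ^ s * tt (Suc i) ^ (r - s)) \<in> yh.Tm"
      using yh.Tm_mult yh.t_pow_Tm ij by simp
  qed (auto intro!: ground.polys_mult hq_ground ground_constants F_closed F)
  finally show "heY i \<in> S.rspan yh.Tm" .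
qed

sublocale yh: yh_ring_span Y K sc n d r tY gY heY xY xiY by (rule yh_ring_span_Y)

lemma proj_rspan_NB:
  assumes "p \<in> F"
  shows "proj p \<in> S.rspan yh.NB"
proof -
  have word: "proj (Poly_Mapping.single (Word w) 1) \<in> S.rspan yh.NB" if "set w \<subseteq> yh_gens n" for w
    using that
  proof (induction w)
    case Nil
    have "Poly_Mapping.single (Word []) 1 = (1 :: yh_free)" by (simp only: zero_fmonoid_def[symmetric] single_one)
    then show ?case using yh.one_NB[OF d] by (simp only: proj_one)
  next
    case (Cons x w)
    have x: "x \<in> yh_gens n" and w: "set w \<subseteq> yh_gens n" using Cons.prems by auto
    have IH: "proj (Poly_Mapping.single (Word w) 1) \<in> S.rspan yh.NB" by (rule Cons.IH[OF w])
    have "Poly_Mapping.single (Word (x # w)) 1 = (gen x * Poly_Mapping.single (Word w) 1 :: yh_free)"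
      by (simp add: gen_def mult_single plus_fmonoid_def)
    moreover have "Poly_Mapping.single (Word w) 1 \<in> F"
      by (rule free.polys_single[OF free.C_one]) (use w in \<open>simp add: gen_words_def\<close>)
    ultimately have eq: "proj (Poly_Mapping.single (Word (x # w)) 1) = proj (gen x) \<otimes>\<^bsub>Y\<^esub> proj (Poly_Mapping.single (Word w) 1)"
      using gen_F[OF x] by (simp add: proj_mult)
    consider j where "x = T j" "j \<in> {1..n}" | i where "x = G i" "i \<in> {1..<n}" | "x = X1" | "x = X1_inv"
      using x by (auto simp: yh_gens_def)
    then show ?case unfolding eq
    proof cases
      case 1
      then show "proj (gen x) \<otimes>\<^bsub>Y\<^esub> proj (Poly_Mapping.single (Word w) 1) \<in> S.rspan yh.NB"
        using yh.T_NB[OF S.rspan_base[OF yh.Tm_subset yh.t_Tm] IH] by simp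
    next
      case 2
      then show "proj (gen x) \<otimes>\<^bsub>Y\<^esub> proj (Poly_Mapping.single (Word w) 1) \<in> S.rspan yh.NB"
        using yh.g_NB[OF _ IH] by simp
    qed (simp_all add: yh.x_NB IH)
  qed
  have "p = (\<Sum>u\<in>Poly_Mapping.keys p. scalar (Poly_Mapping.lookup p u) * Poly_Mapping.single u 1)"
    by (subst free.sum_single[of p]) (simp add: scalar_def mult_single)
  moreover have "proj (\<Sum>u\<in>Poly_Mapping.keys p. scalar (Poly_Mapping.lookup p u) * Poly_Mapping.single u 1)
    \<in> S.rspan (S.rspan yh.NB)"
  proof (rule proj_sum_rspan)
    fix u assume "u \<in> Poly_Mapping.keys p"
    then have u: "u \<in> gen_words" "Poly_Mapping.lookup p u \<in> K" using assms by (auto simp: polys_def)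
    then show "Poly_Mapping.lookup p u \<in> K" "Poly_Mapping.single u 1 \<in> F" by (auto intro: free.polys_single free.C_one)
    show "proj (Poly_Mapping.single u 1) \<in> S.rspan yh.NB"
      using word[of "letters u"] u(1) by (simp add: gen_words_def)
  qed
  ultimately have "proj p \<in> S.rspan (S.rspan yh.NB)" by simp
  then show ?thesis
  proof induction
    case (step c w v)
    then show ?case by (intro S.rspan_add S.rspan_scale yh.NB_subset)
  qed (rule S.rspan.zero)
qed

lemma proj_mono:
  assumes "\<And>j. j \<in> set l \<Longrightarrow> h j \<in> F"
  shows "S.mono (\<lambda>j. proj (h j)) l \<alpha> = proj (\<Prod>j\<leftarrow>l. h j ^ \<alpha> j)"
  using assms
proof (induction l)
  case (Cons j l)
  have "(\<Prod>j\<leftarrow>l. h j ^ \<alpha> j) \<in> F" using Cons.prems by (intro free.polys_prod_list) (auto intro!: F_closed)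
  then show ?case using Cons by (simp add: S.mono_Cons proj_mult proj_power free.polys_power)
qed (simp add: S.mono_Nil proj_one)

lemma XY_proj: "i \<le> n \<Longrightarrow> yh.XY i = proj (XX i)"
proof (induction i rule: XX.induct)
  case (3 i)
  have "gg (Suc i) \<in> F" "XX (Suc i) \<in> F" using 3 by (auto intro!: gg_F XX_F)
  then show ?case using 3 by (simp add: proj_mult F_closed)
qed (simp_all add: proj_one)

lemma gw_proj: "set u \<subseteq> {1..<n} \<Longrightarrow> yh.gw u = proj (prod_list (map gg u))"
proof (induction u)
  case (Cons i u)
  have "gg i \<in> F" "prod_list (map gg u) \<in> F"
    using Cons.prems gg_F[of i] gg_word_F[of u] by auto
  then show ?case using Cons by (simp add: proj_mult)
qed (simp add: proj_one)

lemma standard_proj: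
  assumes "y \<in> yh.standard"
  shows "\<exists>i\<in>monomial_index r n d. y = proj (monomial_of n (normal_word n) i)"
proof -
  from assms obtain \<alpha> \<beta> u where y: "y = yh.xmon \<alpha> \<otimes>\<^bsub>Y\<^esub> yh.tmon \<beta> \<otimes>\<^bsub>Y\<^esub> yh.gw u"
    and \<alpha>: "\<alpha> \<in> {1..n} \<rightarrow>\<^sub>E {..<d}" and \<beta>: "\<beta> \<in> {1..n} \<rightarrow>\<^sub>E {..<r}" and u: "u \<in> normal_words n"
    unfolding yh.standard_def by blast
  have lu: "set u \<subseteq> {1..<n}" by (rule normal_words_letters[OF u])
  have XF: "X_mon n \<alpha> \<in> F" "t_mon n \<beta> \<in> F" "prod_list (map gg u) \<in> F"
    unfolding X_mon_def t_mon_def using gg_word_F[OF lu]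
    by (auto intro!: free.polys_prod_list F_closed XX_F simp del: upt_Suc)
  have "yh.xmon \<alpha> = S.mono (\<lambda>j. proj (XX j)) [1..<Suc n] \<alpha>"
    unfolding yh.xmon_def by (rule S.mono_cong_base) (auto simp: XY_proj simp del: upt_Suc)
  also have "\<dots> = proj (X_mon n \<alpha>)"
    unfolding X_mon_def by (subst proj_mono) (auto intro: XX_F simp del: upt_Suc)
  finally have "yh.xmon \<alpha> = proj (X_mon n \<alpha>)" .
  moreover have "yh.tmon \<beta> = proj (t_mon n \<beta>)"
    unfolding yh.tmon_def t_mon_def by (subst proj_mono) (auto intro: tt_F simp del: upt_Suc)
  ultimately have "y = proj (X_mon n \<alpha> * t_mon n \<beta> * prod_list (map gg u))"
    unfolding y gw_proj[OF lu] using XF by (simp add: proj_mult F_closed)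
  also have "X_mon n \<alpha> * t_mon n \<beta> * prod_list (map gg u) = monomial_of n (normal_word n) (\<alpha>, \<beta>, perm_of_word u)"
    by (simp add: monomial_of_def normal_word_unique[OF u])
  finally have "y = proj (monomial_of n (normal_word n) (\<alpha>, \<beta>, perm_of_word u))" .
  moreover have "(\<alpha>, \<beta>, perm_of_word u) \<in> monomial_index r n d"
    using \<alpha> \<beta> perm_of_word_permutes[OF lu] by (simp add: monomial_index_def)
  ultimately show ?thesis by blast
qed

lemma spanning:
  assumes "p \<in> F"
  shows "\<exists>C. (\<forall>i\<in>monomial_index r n d. C i \<in> K) \<and>
    proj p = proj (\<Sum>i\<in>monomial_index r n d. scalar (C i) * monomial_of n (normal_word n) i)"
proof -
  let ?I = "monomial_index r n d" and ?b = "monomial_of n (normal_word n)"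
  have bF: "?b i \<in> F" if "i \<in> ?I" for i by (rule monomial_of_F[OF word_choice_normal that])
  have "\<exists>C. (\<forall>i\<in>?I. C i \<in> K) \<and> v = proj (\<Sum>i\<in>?I. scalar (C i) * ?b i)" if "v \<in> S.rspan yh.standard" for v
    using that
  proof induction
    case zero
    show ?case
      by (rule exI[of _ "\<lambda>_. 0"]) (simp add: scalar_def proj_zero ground.polys_zero)
  next
    case (step c w v)
    then obtain C where C: "\<forall>i\<in>?I. C i \<in> K" "v = proj (\<Sum>i\<in>?I. scalar (C i) * ?b i)" by blast
    obtain j where j: "j \<in> ?I" "w = proj (?b j)" using standard_proj[OF step(2)] by blast
    let ?C = "\<lambda>i. (if i = j then c else 0) + C i"
    have sF: "(\<Sum>i\<in>?I. scalar (C i) * ?b i) \<in> F" using C bF by (auto intro!: F_closed)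
    have sc: "scalar (a + b) = (scalar a + scalar b :: yh_free)" "scalar 0 = (0 :: yh_free)" for a b :: laurent
      by (simp_all add: scalar_def single_add)
    have "(\<Sum>i\<in>?I. scalar (?C i) * ?b i) = (\<Sum>i\<in>?I. (if i = j then scalar c * ?b i else 0) + scalar (C i) * ?b i)"
      by (intro sum.cong refl) (simp add: sc distrib_right)
    also have "\<dots> = scalar c * ?b j + (\<Sum>i\<in>?I. scalar (C i) * ?b i)"
      using j(1) finite_monomial_index by (simp add: sum.distrib)
    finally have "proj (\<Sum>i\<in>?I. scalar (?C i) * ?b i) = proj (scalar c * ?b j) \<oplus>\<^bsub>Y\<^esub> v"
      using sF bF[OF j(1)] step(1) unfolding C(2) by (simp only: proj_add free.polys_mult scalar_F)
    then have "sc c \<otimes>\<^bsub>Y\<^esub> w \<oplus>\<^bsub>Y\<^esub> v = proj (\<Sum>i\<in>?I. scalar (?C i) * ?b i)"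
      using bF[OF j(1)] step(1) unfolding j(2) by (simp only: proj_mult scalar_F)
    moreover have "\<forall>i\<in>?I. ?C i \<in> K" using C(1) step(1) by (auto intro!: ground.polys_add ground.polys_zero)
    ultimately show ?case by (intro exI[of _ ?C] conjI)
  qed
  then show ?thesis using yh.NB_rspan_standard[OF proj_rspan_NB[OF assms]] by blast
qed

text \<open>Jointly the representations are faithful: an element is a combination of standard monomials for
  the normal words, and its values determine the coefficients.\<close>

lemma proj_zero_if_rep_zero:
  assumes p: "p \<in> F" and rep: "\<And>col. colouring col \<Longrightarrow> rep col p (bv 1 (\<lambda>_. 0)) = 0"
  shows "proj p = \<zero>\<^bsub>Y\<^esub>"
proof -
  let ?I = "monomial_index r n d" and ?b = "monomial_of n (normal_word n)"
  obtain C where C: "\<And>i. i \<in> ?I \<Longrightarrow> C i \<in> K" and eq: "proj p = proj (\<Sum>i\<in>?I. scalar (C i) * ?b i)"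
    using spanning[OF p] by blast
  have sF: "(\<Sum>i\<in>?I. scalar (C i) * ?b i) \<in> F"
    using C monomial_of_F[OF word_choice_normal] by (auto intro!: F_closed)
  have "C i = 0" if "i \<in> ?I" for i
  proof (rule monomials_independent[OF word_choice_normal _ that])
    fix col assume col: "colouring col"
    have "rep col (p - (\<Sum>i\<in>?I. scalar (C i) * ?b i)) (bv 1 (\<lambda>_. 0)) = 0"
      using p sF eq by (intro rep_proj_zero col free.polys_diff) (simp_all add: proj_eq_iff[symmetric])
    then show "(\<Sum>i\<in>?I. C i *\<^sub>v rep col (?b i) (bv 1 (\<lambda>_. 0))) = 0"
      by (simp add: rep_lin[OF col] rep[OF col])
  qed
  then show ?thesis unfolding eq by (simp add: scalar_def proj_zero)
qed

text \<open>By faithfulness, \<open>g\<^sub>w\<close> is the same element for all ascending words of \<open>w\<close>, in particular for all reduced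
  expressions.\<close>

lemma monomial_word_independent:
  assumes "word_choice n word" "word_choice n word'" and i: "i \<in> monomial_index r n d"
  shows "proj (monomial_of n word i) = proj (monomial_of n word' i)"
proof -
  obtain \<alpha> \<beta> w where i': "i = (\<alpha>, \<beta>, w)" by (cases i) auto
  have w: "w permutes {1..n}" using i by (simp add: i' monomial_index_def)
  have "word_perm (word w) = word_perm (word' w)"
    by (rule perm_eqI) (simp add: apply_word_perm word_choiceD(2)[OF assms(1) w] word_choiceD(2)[OF assms(2) w])
  then have "rep col (monomial_of n word i - monomial_of n word' i) (bv 1 (\<lambda>_. 0)) = 0" if "colouring col" for col
    using rep_monomial[OF that assms(1) i[unfolded i']] rep_monomial[OF that assms(2) i[unfolded i']]
    by (simp add: rep_lin[OF that] i')
  then show ?thesis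
    using monomial_of_F assms by (simp add: proj_eq_iff proj_zero_if_rep_zero free.polys_diff)
qed

lemma proj_combination:
  assumes "finite I" "\<And>i. i \<in> I \<Longrightarrow> c i \<in> K" "\<And>i. i \<in> I \<Longrightarrow> h i \<in> F"
  shows "(\<Oplus>\<^bsub>Y\<^esub>i\<in>I. c i \<odot>\<^bsub>Y\<^esub> proj (h i)) = proj (\<Sum>i\<in>I. scalar (c i) * h i)"
  using assms
proof (induction I)
  case (insert i I)
  have F: "scalar (c i) * h i \<in> F" "(\<Sum>i\<in>I. scalar (c i) * h i) \<in> F"
    using insert.prems by (auto intro!: F_closed)
  have closed: "c j \<odot>\<^bsub>Y\<^esub> proj (h j) \<in> carrier Y" if "j \<in> insert i I" for j
    using insert.prems that by (subst smult_Y) (auto intro!: proj_closed F_closed)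
  have "(\<Oplus>\<^bsub>Y\<^esub>i\<in>insert i I. c i \<odot>\<^bsub>Y\<^esub> proj (h i)) = c i \<odot>\<^bsub>Y\<^esub> proj (h i) \<oplus>\<^bsub>Y\<^esub> (\<Oplus>\<^bsub>Y\<^esub>i\<in>I. c i \<odot>\<^bsub>Y\<^esub> proj (h i))"
    using insert.hyps closed by (intro S.finsum_insert) auto
  also have "\<dots> = proj (scalar (c i) * h i) \<oplus>\<^bsub>Y\<^esub> proj (\<Sum>i\<in>I. scalar (c i) * h i)"
    using insert by (simp add: smult_Y)
  finally show ?case using F insert.hyps by (simp add: proj_add)
qed (simp add: proj_zero)

end

theorem theorem2p7:
  fixes r n d :: nat
  assumes "r \<ge> 1" and "n \<ge> 1" and "d \<ge> 1"
  shows "module_basis (ground_ring r d) (cyclotomic_YH r n d)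
    (({1..n} \<rightarrow>\<^sub>E {..<d}) \<times> ({1..n} \<rightarrow>\<^sub>E {..<r}) \<times> {w. w permutes {1..n}})
    (\<lambda>(\<alpha>, \<beta>, w).
       to_cyclotomic r n d (to_affine r n d (X_mon n \<alpha> * t_mon n \<beta> * g_perm n w)))"
proof -
  interpret yh_params r n d using assms by unfold_locales
  let ?I = "monomial_index r n d" and ?b = "monomial_of n (reduced_word n)"
  have index: "({1..n} \<rightarrow>\<^sub>E {..<d}) \<times> ({1..n} \<rightarrow>\<^sub>E {..<r}) \<times> {w. w permutes {1..n}} = ?I"
    by (simp add: monomial_index_def)
  have family: "(\<lambda>(\<alpha>, \<beta>, w). to_cyclotomic r n d (to_affine r n d (X_mon n \<alpha> * t_mon n \<beta> * g_perm n w)))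
    = (\<lambda>i. proj (?b i))"
    by (auto simp: fun_eq_iff proj_def monomial_of_reduced)
  have bF: "?b i \<in> F" if "i \<in> ?I" for i by (rule monomial_of_F[OF word_choice_reduced that])
  have zero: "\<zero>\<^bsub>ground_ring r d\<^esub> = 0" by (simp add: ground_ring_def ring_on_def)
  show ?thesis
    unfolding module_basis_def index family carrier_ground_ring zero
  proof (intro conjI ballI allI impI)
    show "(\<lambda>i. proj (?b i)) \<in> ?I \<rightarrow> carrier Y" using bF proj_closed by auto
  next
    fix y assume "y \<in> carrier Y"
    then obtain p where p: "p \<in> F" "y = proj p" unfolding proj_surj by auto
    obtain C where C: "\<And>i. i \<in> ?I \<Longrightarrow> C i \<in> K"
      and eq: "proj p = proj (\<Sum>i\<in>?I. scalar (C i) * monomial_of n (normal_word n) i)"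
      using spanning[OF p(1)] by blast
    have "proj (\<Sum>i\<in>?I. scalar (C i) * monomial_of n (normal_word n) i) = proj (\<Sum>i\<in>?I. scalar (C i) * ?b i)"
      using C bF monomial_of_F[OF word_choice_normal] monomial_word_independent[OF word_choice_normal word_choice_reduced]
      by (intro proj_sum_cong) (auto intro!: F_closed simp: proj_mult scalar_F)
    also have "\<dots> = (\<Oplus>\<^bsub>Y\<^esub>i\<in>?I. C i \<odot>\<^bsub>Y\<^esub> proj (?b i))"
      using C bF finite_monomial_index by (intro proj_combination[symmetric]) auto
    finally show "\<exists>S c. finite S \<and> S \<subseteq> ?I \<and> c \<in> S \<rightarrow> K \<and> y = (\<Oplus>\<^bsub>Y\<^esub>i\<in>S. c i \<odot>\<^bsub>Y\<^esub> proj (?b i))"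
      using p(2) eq C finite_monomial_index by (intro exI[of _ ?I] exI[of _ C]) auto
  next
    fix S c i
    assume S: "finite S \<and> S \<subseteq> ?I \<and> c \<in> S \<rightarrow> K \<and> (\<Oplus>\<^bsub>Y\<^esub>i\<in>S. c i \<odot>\<^bsub>Y\<^esub> proj (?b i)) = \<zero>\<^bsub>Y\<^esub>"
      and i: "i \<in> S"
    let ?C = "\<lambda>i. if i \<in> S then c i else 0"
    have "(\<Sum>i\<in>?I. scalar (?C i) * ?b i) = (\<Sum>i\<in>S. scalar (c i) * ?b i)"
      using S finite_monomial_index by (intro sum.mono_neutral_cong_right) (auto simp: scalar_def)
    moreover have "(\<Oplus>\<^bsub>Y\<^esub>i\<in>S. c i \<odot>\<^bsub>Y\<^esub> proj (?b i)) = proj (\<Sum>i\<in>S. scalar (c i) * ?b i)"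
      using S bF by (intro proj_combination) auto
    ultimately have "proj (\<Sum>i\<in>?I. scalar (?C i) * ?b i) = \<zero>\<^bsub>Y\<^esub>" using S by simp
    then have "?C i = 0"
      using S i by (intro combination_zero[OF word_choice_reduced]) (auto intro: ground.polys_zero)
    then show "c i = 0" using i by simp
  qed
qed


end
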